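(* The following are provable in $\mathbf{ZF}$: (i) $\mathbf{CMC}(\aleph_0,\infty)\rightarrow\mathbf{ABP}$ and $\mathbf{ABP}\rightarrow\mathbf{PPP}$. (ii) $\mathbf{CACCLO}\leftrightarrow\mathbf{PCACCLO}$. (iii) $\mathbf{AB0P}\rightarrow\mathbf{CACCLO}$ and $\mathbf{CACCLO}\rightarrow\mathbf{IDI}(\mathbb{R})$.
   Context: The base theory is $\mathbf{ZF}$ (no Axiom of Choice). A set is countable if it is equipotent to a subset of $\omega$. A set is Dedekind-infinite if it is equipotent to a proper subset of itself. A choice function of $\{A_i:i\in\omega\}$ is an element of $\prod_{i\in\omega}A_i$; a partial choice function is a choice function of $\{A_i:i\in I\}$ for some infinite $I\subseteq\omega$. A strongly complete linear ordering of a set $A$ is a linear ordering of $A$ such that every non-empty countable subset of $A$ has a maximum. A topological space is a $P$-space if all its $G_\delta$-sets are open. A space is zero-dimensional if its clopen sets form a base. A base $\mathcal{B}$ of a topological space is almost stable under countable intersections if the intersection of every non-empty countable subfamily of $\mathcal{B}\cup\{\emptyset\}$ belongs to $\mathcal{B}\cup\{\emptyset\}$. - $\mathbf{CMC}(\aleph_0,\infty)$: for every family $\{A_i:i\in\omega\}$ of non-empty sets there exists a family $\{B_i:i\in\omega\}$ of non-empty countable sets with $B_i\subseteq A_i$ for every $i\in\omega$. - $\mathbf{ABP}$: every topological space having an almost stable under countable intersections base is a $P$-space. - $\mathbf{AB0P}$: every zero-dimensional $T_1$-space having an almost stable under countable intersections base is a $P$-space. - $\mathbf{PPP}$: for every pair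 $\mathbf{X},\mathbf{Y}$ of $P$-spaces, the product $\mathbf{X}\times\mathbf{Y}$ is a $P$-space. - $\mathbf{CACCLO}$ (respectively, $\mathbf{PCACCLO}$): for every family $\mathcal{A}=\{A_i:i\in\omega\}$ of non-empty sets for which there exists $f\in\prod_{i\in\omega}\mathcal{P}(A_i\times A_i)$ such that, for every $i\in\omega$, $f(i)$ is a strongly complete linear ordering of $A_i$, the family $\mathcal{A}$ has a choice function (respectively, a partial choice function). - $\mathbf{IDI}(\mathbb{R})$: every infinite subset of $\mathbb{R}$ is Dedekind-infinite. *)

theory Defs
  imports Main
begin

text \<open>
  Isabelle/HOL validates the Axiom of Choice, so the principles below are only meaningful inside
  a formal \<open>ZF\<close>: first-order formulas over membership and equality are a datatype, and
  provability is derivability from the \<open>ZF\<close> axioms in classical natural deduction.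
\<close>

section \<open>First-order logic with equality over one binary relation symbol\<close>

text \<open>Variables are de Bruijn indices; they are the only terms.\<close>

datatype fm = Member nat nat | Equal nat nat | Falsum | Implies fm fm | Forall fm

fun lift_ren :: "(nat \<Rightarrow> nat) \<Rightarrow> nat \<Rightarrow> nat" where
  "lift_ren f 0 = 0"
| "lift_ren f (Suc n) = Suc (f n)"

fun ren :: "(nat \<Rightarrow> nat) \<Rightarrow> fm \<Rightarrow> fm" where
  "ren f (Member m n) = Member (f m) (f n)"
| "ren f (Equal m n) = Equal (f m) (f n)"
| "ren f Falsum = Falsum"
| "ren f (Implies p q) = Implies (ren f p) (ren f q)"
| "ren f (Forall p) = Forall (ren (lift_ren f) p)"

text \<open>Replace the free variable \<open>0\<close> by \<open>t\<close> and lower the other free variables.\<close>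

definition instantiate :: "nat \<Rightarrow> fm \<Rightarrow> fm" where
  "instantiate t p = ren (\<lambda>n. case n of 0 \<Rightarrow> t | Suc k \<Rightarrow> k) p"

text \<open>\<open>closed_at k p\<close>: the free variables of \<open>p\<close> are among \<open>0, \<dots>, k - 1\<close>.\<close>

fun closed_at :: "nat \<Rightarrow> fm \<Rightarrow> bool" where
  "closed_at k (Member m n) \<longleftrightarrow> m < k \<and> n < k"
| "closed_at k (Equal m n) \<longleftrightarrow> m < k \<and> n < k"
| "closed_at k Falsum \<longleftrightarrow> True"
| "closed_at k (Implies p q) \<longleftrightarrow> closed_at k p \<and> closed_at k q"
| "closed_at k (Forall p) \<longleftrightarrow> closed_at (Suc k) p"

text \<open>
  In \<open>ForallI\<close> the shift of the context makes index \<open>0\<close> the eigenvariable.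
\<close>

inductive derives :: "fm set \<Rightarrow> fm \<Rightarrow> bool" (infix "\<turnstile>" 40) where
  Assumption: "p \<in> \<Gamma> \<Longrightarrow> \<Gamma> \<turnstile> p"
| ImpliesI: "insert p \<Gamma> \<turnstile> q \<Longrightarrow> \<Gamma> \<turnstile> Implies p q"
| ImpliesE: "\<Gamma> \<turnstile> Implies p q \<Longrightarrow> \<Gamma> \<turnstile> p \<Longrightarrow> \<Gamma> \<turnstile> q"
| Classical: "insert (Implies p Falsum) \<Gamma> \<turnstile> Falsum \<Longrightarrow> \<Gamma> \<turnstile> p"
| ForallI: "ren Suc ` \<Gamma> \<turnstile> p \<Longrightarrow> \<Gamma> \<turnstile> Forall p"
| ForallE: "\<Gamma> \<turnstile> Forall p \<Longrightarrow> \<Gamma> \<turnstile> instantiate t p"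
| Refl: "\<Gamma> \<turnstile> Equal t t"
| Subst: "\<Gamma> \<turnstile> Equal s t \<Longrightarrow> \<Gamma> \<turnstile> instantiate s p \<Longrightarrow> \<Gamma> \<turnstile> instantiate t p"

section \<open>Readable notation for formulas\<close>

text \<open>
  An \<open>fml\<close> is a formula awaiting the number \<open>d\<close> of binders above it.  A \<open>var\<close> is a de Bruijn
  \<^emph>\<open>level\<close>: the number of binders above its own binder.  Hence a new binder at depth \<open>d\<close>
  introduces the level \<open>d\<close>, and at depth \<open>d\<close> the level \<open>x\<close> is the index \<open>d - 1 - x\<close>.  So object
  variables can be written as HOL-bound variables, without capture.  An \<open>fml\<close> without free
  variables denotes the sentence obtained at depth \<open>0\<close>.
\<close>

type_synonym var = nat
type_synonym fml = "nat \<Rightarrow> fm"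

definition fmem :: "var \<Rightarrow> var \<Rightarrow> fml" (infix "\<^bold>\<in>" 60) where
  "(x \<^bold>\<in> y) = (\<lambda>d. Member (d - 1 - x) (d - 1 - y))"

definition feq :: "var \<Rightarrow> var \<Rightarrow> fml" (infix "\<^bold>=" 60) where
  "(x \<^bold>= y) = (\<lambda>d. Equal (d - 1 - x) (d - 1 - y))"

definition fimp :: "fml \<Rightarrow> fml \<Rightarrow> fml" (infixr "\<^bold>\<longrightarrow>" 53) where
  "(\<phi> \<^bold>\<longrightarrow> \<psi>) = (\<lambda>d. Implies (\<phi> d) (\<psi> d))"

definition fneg :: "fml \<Rightarrow> fml" ("\<^bold>\<not> _" [57] 57) where
  "(\<^bold>\<not> \<phi>) = (\<phi> \<^bold>\<longrightarrow> (\<lambda>d. Falsum))"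

definition fconj :: "fml \<Rightarrow> fml \<Rightarrow> fml" (infixr "\<^bold>\<and>" 55) where
  "(\<phi> \<^bold>\<and> \<psi>) = (\<^bold>\<not> (\<phi> \<^bold>\<longrightarrow> \<^bold>\<not> \<psi>))"

definition fdisj :: "fml \<Rightarrow> fml \<Rightarrow> fml" (infixr "\<^bold>\<or>" 54) where
  "(\<phi> \<^bold>\<or> \<psi>) = (\<^bold>\<not> \<phi> \<^bold>\<longrightarrow> \<psi>)"

definition fiff :: "fml \<Rightarrow> fml \<Rightarrow> fml" (infix "\<^bold>\<longleftrightarrow>" 52) where
  "(\<phi> \<^bold>\<longleftrightarrow> \<psi>) = ((\<phi> \<^bold>\<longrightarrow> \<psi>) \<^bold>\<and> (\<psi> \<^bold>\<longrightarrow> \<phi>))"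

definition fall :: "(var \<Rightarrow> fml) \<Rightarrow> fml" (binder "\<^bold>\<forall>" 51) where
  "fall \<Phi> = (\<lambda>d. Forall (\<Phi> d (Suc d)))"

definition fex :: "(var \<Rightarrow> fml) \<Rightarrow> fml" (binder "\<^bold>\<exists>" 51) where
  "(\<^bold>\<exists>x. \<Phi> x) = (\<^bold>\<not> (\<^bold>\<forall>x. \<^bold>\<not> \<Phi> x))"

text \<open>\<open>p\<lbrakk>[x\<^sub>0, \<dots>, x\<^sub>m]\<rbrakk>\<close> replaces the free variable \<open>i\<close> of \<open>p\<close> by \<open>x\<^sub>i\<close>.\<close>

definition at_vars :: "fm \<Rightarrow> var list \<Rightarrow> fml" ("_\<lbrakk>_\<rbrakk>" [100, 0] 100) where
  "p\<lbrakk>xs\<rbrakk> = (\<lambda>d. ren (\<lambda>i. d - 1 - xs ! i) p)"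

section \<open>Set-theoretic vocabulary\<close>

definition fsub :: "var \<Rightarrow> var \<Rightarrow> fml" (infix "\<^bold>\<subseteq>" 60) where
  "(x \<^bold>\<subseteq> y) = (\<^bold>\<forall>z. z \<^bold>\<in> x \<^bold>\<longrightarrow> z \<^bold>\<in> y)"

definition is_empty :: "var \<Rightarrow> fml" where
  "is_empty x = (\<^bold>\<forall>z. \<^bold>\<not> z \<^bold>\<in> x)"

definition nonempty :: "var \<Rightarrow> fml" where
  "nonempty x = (\<^bold>\<exists>z. z \<^bold>\<in> x)"

definition is_upair :: "var \<Rightarrow> var \<Rightarrow> var \<Rightarrow> fml" where
  "is_upair p x y = (\<^bold>\<forall>z. z \<^bold>\<in> p \<^bold>\<longleftrightarrow> z \<^bold>= x \<^bold>\<or> z \<^bold>= y)"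

text \<open>Kuratowski pairs: \<open>p = {{x}, {x, y}}\<close>.\<close>

definition is_pair :: "var \<Rightarrow> var \<Rightarrow> var \<Rightarrow> fml" where
  "is_pair p x y = (\<^bold>\<exists>u v. is_upair u x x \<^bold>\<and> is_upair v x y \<^bold>\<and> is_upair p u v)"

text \<open>For a function \<open>r\<close>, the next formula also says that \<open>r(x) = y\<close>.\<close>

definition pair_mem :: "var \<Rightarrow> var \<Rightarrow> var \<Rightarrow> fml" ("\<^bold>\<langle>_, _\<^bold>\<rangle> \<^bold>\<in> _" [61, 61, 61] 60) where
  "(\<^bold>\<langle>x, y\<^bold>\<rangle> \<^bold>\<in> r) = (\<^bold>\<exists>p. is_pair p x y \<^bold>\<and> p \<^bold>\<in> r)"

definition is_Union :: "var \<Rightarrow> var \<Rightarrow> fml" where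
  "is_Union u s = (\<^bold>\<forall>z. z \<^bold>\<in> u \<^bold>\<longleftrightarrow> (\<^bold>\<exists>v. v \<^bold>\<in> s \<^bold>\<and> z \<^bold>\<in> v))"

text \<open>Used only for non-empty \<open>s\<close>.\<close>

definition is_Inter :: "var \<Rightarrow> var \<Rightarrow> fml" where
  "is_Inter u s = (\<^bold>\<forall>z. z \<^bold>\<in> u \<^bold>\<longleftrightarrow> (\<^bold>\<forall>v. v \<^bold>\<in> s \<^bold>\<longrightarrow> z \<^bold>\<in> v))"

definition is_inter :: "var \<Rightarrow> var \<Rightarrow> var \<Rightarrow> fml" where
  "is_inter u x y = (\<^bold>\<forall>z. z \<^bold>\<in> u \<^bold>\<longleftrightarrow> z \<^bold>\<in> x \<^bold>\<and> z \<^bold>\<in> y)"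

definition is_diff :: "var \<Rightarrow> var \<Rightarrow> var \<Rightarrow> fml" where
  "is_diff u x y = (\<^bold>\<forall>z. z \<^bold>\<in> u \<^bold>\<longleftrightarrow> z \<^bold>\<in> x \<^bold>\<and> \<^bold>\<not> z \<^bold>\<in> y)"

definition is_cart :: "var \<Rightarrow> var \<Rightarrow> var \<Rightarrow> fml" where
  "is_cart c a b = (\<^bold>\<forall>p. p \<^bold>\<in> c \<^bold>\<longleftrightarrow> (\<^bold>\<exists>x y. x \<^bold>\<in> a \<^bold>\<and> y \<^bold>\<in> b \<^bold>\<and> is_pair p x y))"

definition is_succ :: "var \<Rightarrow> var \<Rightarrow> fml" where
  "is_succ s x = (\<^bold>\<forall>z. z \<^bold>\<in> s \<^bold>\<longleftrightarrow> z \<^bold>\<in> x \<^bold>\<or> z \<^bold>= x)"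

definition is_inductive :: "var \<Rightarrow> fml" where
  "is_inductive a = ((\<^bold>\<exists>e. is_empty e \<^bold>\<and> e \<^bold>\<in> a) \<^bold>\<and>
     (\<^bold>\<forall>x. x \<^bold>\<in> a \<^bold>\<longrightarrow> (\<^bold>\<exists>s. is_succ s x \<^bold>\<and> s \<^bold>\<in> a)))"

definition is_omega :: "var \<Rightarrow> fml" where
  "is_omega w = (is_inductive w \<^bold>\<and> (\<^bold>\<forall>a. is_inductive a \<^bold>\<longrightarrow> w \<^bold>\<subseteq> a))"

definition function_on :: "var \<Rightarrow> var \<Rightarrow> fml" where
  "function_on f a =
     ((\<^bold>\<forall>p. p \<^bold>\<in> f \<^bold>\<longrightarrow> (\<^bold>\<exists>x y. x \<^bold>\<in> a \<^bold>\<and> is_pair p x y)) \<^bold>\<and>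
      (\<^bold>\<forall>x. x \<^bold>\<in> a \<^bold>\<longrightarrow> (\<^bold>\<exists>y. \<^bold>\<langle>x, y\<^bold>\<rangle> \<^bold>\<in> f)) \<^bold>\<and>
      (\<^bold>\<forall>x y z. \<^bold>\<langle>x, y\<^bold>\<rangle> \<^bold>\<in> f \<^bold>\<and> \<^bold>\<langle>x, z\<^bold>\<rangle> \<^bold>\<in> f \<^bold>\<longrightarrow> y \<^bold>= z))"

definition function_into :: "var \<Rightarrow> var \<Rightarrow> var \<Rightarrow> fml" where
  "function_into f a b = (function_on f a \<^bold>\<and> (\<^bold>\<forall>x y. \<^bold>\<langle>x, y\<^bold>\<rangle> \<^bold>\<in> f \<^bold>\<longrightarrow> y \<^bold>\<in> b))"

definition bijection :: "var \<Rightarrow> var \<Rightarrow> var \<Rightarrow> fml" where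
  "bijection f a b = (function_into f a b \<^bold>\<and>
     (\<^bold>\<forall>x y z. \<^bold>\<langle>x, z\<^bold>\<rangle> \<^bold>\<in> f \<^bold>\<and> \<^bold>\<langle>y, z\<^bold>\<rangle> \<^bold>\<in> f \<^bold>\<longrightarrow> x \<^bold>= y) \<^bold>\<and>
     (\<^bold>\<forall>y. y \<^bold>\<in> b \<^bold>\<longrightarrow> (\<^bold>\<exists>x. \<^bold>\<langle>x, y\<^bold>\<rangle> \<^bold>\<in> f)))"

definition equipotent :: "var \<Rightarrow> var \<Rightarrow> fml" where
  "equipotent a b = (\<^bold>\<exists>f. bijection f a b)"

definition is_countable :: "var \<Rightarrow> fml" where
  "is_countable a = (\<^bold>\<exists>w s. is_omega w \<^bold>\<and> s \<^bold>\<subseteq> w \<^bold>\<and> equipotent a s)"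

definition is_infinite :: "var \<Rightarrow> fml" where
  "is_infinite a = (\<^bold>\<not> (\<^bold>\<exists>w n. is_omega w \<^bold>\<and> n \<^bold>\<in> w \<^bold>\<and> equipotent a n))"

definition dedekind_infinite :: "var \<Rightarrow> fml" where
  "dedekind_infinite a = (\<^bold>\<exists>s. s \<^bold>\<subseteq> a \<^bold>\<and> \<^bold>\<not> s \<^bold>= a \<^bold>\<and> equipotent a s)"

section \<open>The theory ZF\<close>

definition extensionality_ax :: fml where
  "extensionality_ax = (\<^bold>\<forall>x y. (\<^bold>\<forall>z. z \<^bold>\<in> x \<^bold>\<longleftrightarrow> z \<^bold>\<in> y) \<^bold>\<longrightarrow> x \<^bold>= y)"

definition foundation_ax :: fml where
  "foundation_ax =
     (\<^bold>\<forall>x. nonempty x \<^bold>\<longrightarrow> (\<^bold>\<exists>y. y \<^bold>\<in> x \<^bold>\<and> \<^bold>\<not> (\<^bold>\<exists>z. z \<^bold>\<in> x \<^bold>\<and> z \<^bold>\<in> y)))"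

definition pairing_ax :: fml where
  "pairing_ax = (\<^bold>\<forall>x y. \<^bold>\<exists>p. is_upair p x y)"

definition union_ax :: fml where
  "union_ax = (\<^bold>\<forall>s. \<^bold>\<exists>u. is_Union u s)"

definition power_set_ax :: fml where
  "power_set_ax = (\<^bold>\<forall>a. \<^bold>\<exists>b. \<^bold>\<forall>z. z \<^bold>\<in> b \<^bold>\<longleftrightarrow> z \<^bold>\<subseteq> a)"

definition infinity_ax :: fml where
  "infinity_ax = (\<^bold>\<exists>a. is_inductive a)"

text \<open>
  In the two schemas, the variables \<open>0, \<dots>, k - 1\<close> of \<open>p\<close> are parameters, universally quantified
  by the outermost \<open>k\<close> quantifiers (whose levels are again \<open>0, \<dots>, k - 1\<close>).
\<close>

definition separation_ax :: "nat \<Rightarrow> fm \<Rightarrow> fm" where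
  "separation_ax k p = (Forall ^^ k)
     ((\<^bold>\<forall>a. \<^bold>\<exists>b. \<^bold>\<forall>x. x \<^bold>\<in> b \<^bold>\<longleftrightarrow> x \<^bold>\<in> a \<^bold>\<and> p\<lbrakk>[0..<k] @ [x]\<rbrakk>) k)"

definition replacement_ax :: "nat \<Rightarrow> fm \<Rightarrow> fm" where
  "replacement_ax k p = (Forall ^^ k)
     ((\<^bold>\<forall>a. (\<^bold>\<forall>x y z. x \<^bold>\<in> a \<^bold>\<and> p\<lbrakk>[0..<k] @ [x, y]\<rbrakk> \<^bold>\<and> p\<lbrakk>[0..<k] @ [x, z]\<rbrakk> \<^bold>\<longrightarrow> y \<^bold>= z) \<^bold>\<longrightarrow>
        (\<^bold>\<exists>b. \<^bold>\<forall>y. y \<^bold>\<in> b \<^bold>\<longleftrightarrow> (\<^bold>\<exists>x. x \<^bold>\<in> a \<^bold>\<and> p\<lbrakk>[0..<k] @ [x, y]\<rbrakk>))) k)"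

definition ZF :: "fm set" where
  "ZF = {extensionality_ax 0, foundation_ax 0, pairing_ax 0, union_ax 0, power_set_ax 0,
         infinity_ax 0}
      \<union> {separation_ax k p | k p. closed_at (k + 1) p}
      \<union> {replacement_ax k p | k p. closed_at (k + 2) p}"

definition ZF_proves :: "fml \<Rightarrow> bool" where
  "ZF_proves \<phi> \<longleftrightarrow> ZF \<turnstile> \<phi> 0"

section \<open>Orderings and the real line\<close>

text \<open>Linear orderings are reflexive; \<open>\<langle>x, y\<rangle> \<in> r\<close> means that \<open>x\<close> is less than or equal to \<open>y\<close>.\<close>

definition linear_ordering :: "var \<Rightarrow> var \<Rightarrow> fml" where
  "linear_ordering r a =
     ((\<^bold>\<forall>p. p \<^bold>\<in> r \<^bold>\<longrightarrow> (\<^bold>\<exists>x y. x \<^bold>\<in> a \<^bold>\<and> y \<^bold>\<in> a \<^bold>\<and> is_pair p x y)) \<^bold>\<and>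
      (\<^bold>\<forall>x. x \<^bold>\<in> a \<^bold>\<longrightarrow> \<^bold>\<langle>x, x\<^bold>\<rangle> \<^bold>\<in> r) \<^bold>\<and>
      (\<^bold>\<forall>x y. \<^bold>\<langle>x, y\<^bold>\<rangle> \<^bold>\<in> r \<^bold>\<and> \<^bold>\<langle>y, x\<^bold>\<rangle> \<^bold>\<in> r \<^bold>\<longrightarrow> x \<^bold>= y) \<^bold>\<and>
      (\<^bold>\<forall>x y z. \<^bold>\<langle>x, y\<^bold>\<rangle> \<^bold>\<in> r \<^bold>\<and> \<^bold>\<langle>y, z\<^bold>\<rangle> \<^bold>\<in> r \<^bold>\<longrightarrow> \<^bold>\<langle>x, z\<^bold>\<rangle> \<^bold>\<in> r) \<^bold>\<and>
      (\<^bold>\<forall>x y. x \<^bold>\<in> a \<^bold>\<and> y \<^bold>\<in> a \<^bold>\<longrightarrow> \<^bold>\<langle>x, y\<^bold>\<rangle> \<^bold>\<in> r \<^bold>\<or> \<^bold>\<langle>y, x\<^bold>\<rangle> \<^bold>\<in> r))"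

definition strongly_complete_linear_ordering :: "var \<Rightarrow> var \<Rightarrow> fml" where
  "strongly_complete_linear_ordering r a = (linear_ordering r a \<^bold>\<and>
     (\<^bold>\<forall>s. s \<^bold>\<subseteq> a \<^bold>\<and> nonempty s \<^bold>\<and> is_countable s \<^bold>\<longrightarrow>
        (\<^bold>\<exists>m. m \<^bold>\<in> s \<^bold>\<and> (\<^bold>\<forall>x. x \<^bold>\<in> s \<^bold>\<longrightarrow> \<^bold>\<langle>x, m\<^bold>\<rangle> \<^bold>\<in> r))))"

text \<open>\<open>app2 f x y z\<close>: \<open>f(x, y) = z\<close>.\<close>

definition app2 :: "var \<Rightarrow> var \<Rightarrow> var \<Rightarrow> var \<Rightarrow> fml" where
  "app2 f x y z = (\<^bold>\<exists>p. is_pair p x y \<^bold>\<and> \<^bold>\<langle>p, z\<^bold>\<rangle> \<^bold>\<in> f)"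

definition commutative_monoid :: "var \<Rightarrow> var \<Rightarrow> var \<Rightarrow> fml" where
  "commutative_monoid a f e =
     ((\<^bold>\<exists>c. is_cart c a a \<^bold>\<and> function_into f c a) \<^bold>\<and>
      (\<^bold>\<forall>x y z u v s. app2 f x y u \<^bold>\<and> app2 f u z s \<^bold>\<and> app2 f y z v \<^bold>\<longrightarrow> app2 f x v s) \<^bold>\<and>
      (\<^bold>\<forall>x y u. app2 f x y u \<^bold>\<longrightarrow> app2 f y x u) \<^bold>\<and>
      e \<^bold>\<in> a \<^bold>\<and>
      (\<^bold>\<forall>x. x \<^bold>\<in> a \<^bold>\<longrightarrow> app2 f x e x))"

definition ordered_field :: "var \<Rightarrow> var \<Rightarrow> var \<Rightarrow> var \<Rightarrow> var \<Rightarrow> var \<Rightarrow> fml" where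
  "ordered_field a add mul zero one le =
     (commutative_monoid a add zero \<^bold>\<and>
      (\<^bold>\<forall>x. x \<^bold>\<in> a \<^bold>\<longrightarrow> (\<^bold>\<exists>y. app2 add x y zero)) \<^bold>\<and>
      commutative_monoid a mul one \<^bold>\<and>
      (\<^bold>\<forall>x. x \<^bold>\<in> a \<^bold>\<and> \<^bold>\<not> x \<^bold>= zero \<^bold>\<longrightarrow> (\<^bold>\<exists>y. app2 mul x y one)) \<^bold>\<and>
      \<^bold>\<not> zero \<^bold>= one \<^bold>\<and>
      (\<^bold>\<forall>x y z s t u v. app2 add y z s \<^bold>\<and> app2 mul x s t \<^bold>\<and> app2 mul x y u \<^bold>\<and> app2 mul x z v
         \<^bold>\<longrightarrow> app2 add u v t) \<^bold>\<and>
      linear_ordering le a \<^bold>\<and>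
      (\<^bold>\<forall>x y z u v. \<^bold>\<langle>x, y\<^bold>\<rangle> \<^bold>\<in> le \<^bold>\<and> app2 add x z u \<^bold>\<and> app2 add y z v \<^bold>\<longrightarrow> \<^bold>\<langle>u, v\<^bold>\<rangle> \<^bold>\<in> le) \<^bold>\<and>
      (\<^bold>\<forall>x y u. \<^bold>\<langle>zero, x\<^bold>\<rangle> \<^bold>\<in> le \<^bold>\<and> \<^bold>\<langle>zero, y\<^bold>\<rangle> \<^bold>\<in> le \<^bold>\<and> app2 mul x y u \<^bold>\<longrightarrow> \<^bold>\<langle>zero, u\<^bold>\<rangle> \<^bold>\<in> le))"

definition upper_bound :: "var \<Rightarrow> var \<Rightarrow> var \<Rightarrow> var \<Rightarrow> fml" where
  "upper_bound u s a le = (u \<^bold>\<in> a \<^bold>\<and> (\<^bold>\<forall>x. x \<^bold>\<in> s \<^bold>\<longrightarrow> \<^bold>\<langle>x, u\<^bold>\<rangle> \<^bold>\<in> le))"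

text \<open>
  \<open>a\<close> is the underlying set of a Dedekind complete ordered field, that is, of the real line
  up to isomorphism.
\<close>

definition is_real_line :: "var \<Rightarrow> fml" where
  "is_real_line a = (\<^bold>\<exists>add mul zero one le. ordered_field a add mul zero one le \<^bold>\<and>
     (\<^bold>\<forall>s. s \<^bold>\<subseteq> a \<^bold>\<and> nonempty s \<^bold>\<and> (\<^bold>\<exists>u. upper_bound u s a le) \<^bold>\<longrightarrow>
        (\<^bold>\<exists>u. upper_bound u s a le \<^bold>\<and>
           (\<^bold>\<forall>v. upper_bound v s a le \<^bold>\<longrightarrow> \<^bold>\<langle>u, v\<^bold>\<rangle> \<^bold>\<in> le))))"

section \<open>Topological spaces\<close>

definition topology_on :: "var \<Rightarrow> var \<Rightarrow> fml" where
  "topology_on t x =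
     ((\<^bold>\<forall>u. u \<^bold>\<in> t \<^bold>\<longrightarrow> u \<^bold>\<subseteq> x) \<^bold>\<and>
      (\<^bold>\<exists>e. is_empty e \<^bold>\<and> e \<^bold>\<in> t) \<^bold>\<and>
      x \<^bold>\<in> t \<^bold>\<and>
      (\<^bold>\<forall>u v. u \<^bold>\<in> t \<^bold>\<and> v \<^bold>\<in> t \<^bold>\<longrightarrow> (\<^bold>\<exists>i. is_inter i u v \<^bold>\<and> i \<^bold>\<in> t)) \<^bold>\<and>
      (\<^bold>\<forall>s. s \<^bold>\<subseteq> t \<^bold>\<longrightarrow> (\<^bold>\<exists>u. is_Union u s \<^bold>\<and> u \<^bold>\<in> t)))"

definition G_delta :: "var \<Rightarrow> var \<Rightarrow> fml" where
  "G_delta g t = (\<^bold>\<exists>s. s \<^bold>\<subseteq> t \<^bold>\<and> nonempty s \<^bold>\<and> is_countable s \<^bold>\<and> is_Inter g s)"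

definition P_space :: "var \<Rightarrow> var \<Rightarrow> fml" where
  "P_space x t = (topology_on t x \<^bold>\<and> (\<^bold>\<forall>g. G_delta g t \<^bold>\<longrightarrow> g \<^bold>\<in> t))"

definition base_of :: "var \<Rightarrow> var \<Rightarrow> fml" where
  "base_of b t = (b \<^bold>\<subseteq> t \<^bold>\<and> (\<^bold>\<forall>u. u \<^bold>\<in> t \<^bold>\<longrightarrow> (\<^bold>\<exists>s. s \<^bold>\<subseteq> b \<^bold>\<and> is_Union u s)))"

text \<open>Here \<open>c\<close> is \<open>b \<union> {\<emptyset>}\<close>.\<close>

definition almost_stable :: "var \<Rightarrow> fml" where
  "almost_stable b = (\<^bold>\<exists>c. (\<^bold>\<forall>u. u \<^bold>\<in> c \<^bold>\<longleftrightarrow> u \<^bold>\<in> b \<^bold>\<or> is_empty u) \<^bold>\<and>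
     (\<^bold>\<forall>s. s \<^bold>\<subseteq> c \<^bold>\<and> nonempty s \<^bold>\<and> is_countable s \<^bold>\<longrightarrow> (\<^bold>\<exists>i. is_Inter i s \<^bold>\<and> i \<^bold>\<in> c)))"

definition clopen :: "var \<Rightarrow> var \<Rightarrow> var \<Rightarrow> fml" where
  "clopen u x t = (u \<^bold>\<in> t \<^bold>\<and> (\<^bold>\<exists>v. is_diff v x u \<^bold>\<and> v \<^bold>\<in> t))"

definition zero_dimensional :: "var \<Rightarrow> var \<Rightarrow> fml" where
  "zero_dimensional x t =
     (\<^bold>\<exists>b. (\<^bold>\<forall>u. u \<^bold>\<in> b \<^bold>\<longleftrightarrow> clopen u x t) \<^bold>\<and> base_of b t)"

definition T1 :: "var \<Rightarrow> var \<Rightarrow> fml" where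
  "T1 x t = (\<^bold>\<forall>y z. y \<^bold>\<in> x \<^bold>\<and> z \<^bold>\<in> x \<^bold>\<and> \<^bold>\<not> y \<^bold>= z \<^bold>\<longrightarrow>
     (\<^bold>\<exists>u. u \<^bold>\<in> t \<^bold>\<and> y \<^bold>\<in> u \<^bold>\<and> \<^bold>\<not> z \<^bold>\<in> u))"

text \<open>\<open>t\<close> consists of the unions of families of open rectangles.\<close>

definition product_topology :: "var \<Rightarrow> var \<Rightarrow> var \<Rightarrow> fml" where
  "product_topology t t\<^sub>1 t\<^sub>2 = (\<^bold>\<forall>w. w \<^bold>\<in> t \<^bold>\<longleftrightarrow>
     (\<^bold>\<exists>s. (\<^bold>\<forall>r. r \<^bold>\<in> s \<^bold>\<longrightarrow> (\<^bold>\<exists>u v. u \<^bold>\<in> t\<^sub>1 \<^bold>\<and> v \<^bold>\<in> t\<^sub>2 \<^bold>\<and> is_cart r u v)) \<^bold>\<and> is_Union w s))"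

section \<open>The principles\<close>

definition nonempty_family :: "var \<Rightarrow> var \<Rightarrow> fml" where
  "nonempty_family A w = (function_on A w \<^bold>\<and> (\<^bold>\<forall>i a. \<^bold>\<langle>i, a\<^bold>\<rangle> \<^bold>\<in> A \<^bold>\<longrightarrow> nonempty a))"

text \<open>\<open>g\<close> is an element of the product of the \<open>A\<^sub>i\<close> with \<open>i\<close> in \<open>I\<close>.\<close>

definition choice_function :: "var \<Rightarrow> var \<Rightarrow> var \<Rightarrow> fml" where
  "choice_function g A I = (function_on g I \<^bold>\<and>
     (\<^bold>\<forall>i a x. \<^bold>\<langle>i, a\<^bold>\<rangle> \<^bold>\<in> A \<^bold>\<and> \<^bold>\<langle>i, x\<^bold>\<rangle> \<^bold>\<in> g \<^bold>\<longrightarrow> x \<^bold>\<in> a))"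

text \<open>\<open>f(i)\<close> is a strongly complete linear ordering of \<open>A\<^sub>i\<close> for each \<open>i\<close> in \<open>w\<close>.\<close>

definition strongly_complete_orderings :: "var \<Rightarrow> var \<Rightarrow> var \<Rightarrow> fml" where
  "strongly_complete_orderings f A w = (function_on f w \<^bold>\<and>
     (\<^bold>\<forall>i a r. \<^bold>\<langle>i, a\<^bold>\<rangle> \<^bold>\<in> A \<^bold>\<and> \<^bold>\<langle>i, r\<^bold>\<rangle> \<^bold>\<in> f \<^bold>\<longrightarrow> strongly_complete_linear_ordering r a))"

definition CMC :: fml where
  "CMC = (\<^bold>\<exists>w. is_omega w \<^bold>\<and> (\<^bold>\<forall>A. nonempty_family A w \<^bold>\<longrightarrow>
     (\<^bold>\<exists>B. nonempty_family B w \<^bold>\<and>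
        (\<^bold>\<forall>i a b. \<^bold>\<langle>i, a\<^bold>\<rangle> \<^bold>\<in> A \<^bold>\<and> \<^bold>\<langle>i, b\<^bold>\<rangle> \<^bold>\<in> B \<^bold>\<longrightarrow> b \<^bold>\<subseteq> a \<^bold>\<and> is_countable b))))"

definition ABP :: fml where
  "ABP = (\<^bold>\<forall>x t. topology_on t x \<^bold>\<and> (\<^bold>\<exists>b. base_of b t \<^bold>\<and> almost_stable b) \<^bold>\<longrightarrow> P_space x t)"

definition AB0P :: fml where
  "AB0P = (\<^bold>\<forall>x t. topology_on t x \<^bold>\<and> zero_dimensional x t \<^bold>\<and> T1 x t \<^bold>\<and>
     (\<^bold>\<exists>b. base_of b t \<^bold>\<and> almost_stable b) \<^bold>\<longrightarrow> P_space x t)"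

definition PPP :: fml where
  "PPP = (\<^bold>\<forall>x t\<^sub>1 y t\<^sub>2. P_space x t\<^sub>1 \<^bold>\<and> P_space y t\<^sub>2 \<^bold>\<longrightarrow>
     (\<^bold>\<exists>z t. is_cart z x y \<^bold>\<and> product_topology t t\<^sub>1 t\<^sub>2 \<^bold>\<and> P_space z t))"

definition CACCLO :: fml where
  "CACCLO = (\<^bold>\<exists>w. is_omega w \<^bold>\<and>
     (\<^bold>\<forall>A. nonempty_family A w \<^bold>\<and> (\<^bold>\<exists>f. strongly_complete_orderings f A w) \<^bold>\<longrightarrow>
        (\<^bold>\<exists>g. choice_function g A w)))"

definition PCACCLO :: fml where
  "PCACCLO = (\<^bold>\<exists>w. is_omega w \<^bold>\<and>
     (\<^bold>\<forall>A. nonempty_family A w \<^bold>\<and> (\<^bold>\<exists>f. strongly_complete_orderings f A w) \<^bold>\<longrightarrow>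
        (\<^bold>\<exists>I g. I \<^bold>\<subseteq> w \<^bold>\<and> is_infinite I \<^bold>\<and> choice_function g A I)))"

definition IDI_R :: fml where
  "IDI_R = (\<^bold>\<forall>a. is_real_line a \<^bold>\<longrightarrow>
     (\<^bold>\<forall>s. s \<^bold>\<subseteq> a \<^bold>\<and> is_infinite s \<^bold>\<longrightarrow> dedekind_infinite s))"

end

theory Submission
  imports Defs "HOL-Library.Countable" "HOL-Library.Infinite_Set" "HOL-Library.Nat_Bijection"
begin

text \<open>
  By the completeness theorem it suffices to derive the implications in an arbitrary model of \<open>ZF\<close>;
  every use of separation or replacement there is justified by exhibiting the predicate or function
  as parametrically definable.

  \<open>CMC\<close> to \<open>ABP\<close>: for a point \<open>x\<close> of a countable intersection of open sets \<open>U\<^sub>n\<close>, choose a non-empty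
  countable set of basic \<open>V\<close> with \<open>x\<close> in \<open>V\<close> and \<open>V\<close> inside \<open>U\<^sub>n\<close>, intersect each of these sets, and then
  intersect the results.  \<open>ABP\<close> to \<open>PPP\<close>: in a product of \<open>P\<close>-spaces the open rectangles are almost stable,
  since a countable intersection of rectangles is the product of the intersections of the projections.
  \<open>PCACCLO\<close> to \<open>CACCLO\<close>: finite products are strongly complete in the lexicographic order, and a choice of
  arbitrarily long tuples gives a choice function.  \<open>AB0P\<close> to \<open>PCACCLO\<close>: without partial choice functions,
  countably many basic neighbourhoods of the point at infinity of a suitable space cut only finitely
  many columns, each of them at a maximum, while infinity is not an interior point of the \<open>G\<^sub>\<delta>\<close>-set that
  omits one further isolated point from every column.  \<open>CACCLO\<close> to \<open>IDI_R\<close>: in a Dedekind-finite set \<open>S\<close> of reals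
  every non-empty countable subset has a maximum and a minimum; a non-empty subset \<open>T\<close> of \<open>S\<close> without a
  maximum has a cofinal sequence \<open>c\<^sub>n\<close> of reals, and choosing from the sets of \<open>t\<close> in \<open>T\<close> above \<open>c\<^sub>n\<close> yields a
  countable set without maximum.  So all non-empty subsets of \<open>S\<close> have a maximum and a minimum, and
  \<open>S\<close> is finite.
\<close>

section \<open>Completeness of the calculus\<close>

text \<open>Outside, a model is an ordinary relation in HOL; inside, no choice is available and only
  definable collections can be shown to be sets. So auxiliary objects such as a least index, a
  maximum, an inverse or the value of a function are built as definite descriptions, mostly as the
  union of a singleton. The natural numbers of the model may be nonstandard, hence induction and
  recursion on \<open>omega\<close> are developed for definable predicates and functions. The link
  between cuts and choice is that a strict cut determines its point: countably many neighbourhoods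
  give countably many cut points in each column, and their maxima, being unique, form a choice
  function on the columns that are cut. The extra point \<open>app A i\<close> is outside the set
  \<open>app A i\<close> by foundation. Every cut drops it and every full column keeps it, so the
  decisive countable intersection is described without choosing anything from the columns. For sets
  of reals only maxima are proved directly. Minima come from the same argument for the reversed
  order, which is why it is carried out in a structure that can be reversed.\<close>

lemma lift_ren_comp: "lift_ren f \<circ> lift_ren g = lift_ren (f \<circ> g)"
proof
  fix n show "(lift_ren f \<circ> lift_ren g) n = lift_ren (f \<circ> g) n" by (cases n) auto
qed

lemma ren_ren: "ren f (ren g p) = ren (f \<circ> g) p"
  by (induction p arbitrary: f g) (auto simp: lift_ren_comp)

lemma ren_cong: "closed_at k p \<Longrightarrow> (\<And>i. i < k \<Longrightarrow> f i = g i) \<Longrightarrow> ren f p = ren g p"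
proof (induction p arbitrary: f g k)
  case (Forall p)
  have "lift_ren f i = lift_ren g i" if "i < Suc k" for i
    using that Forall.prems by (cases i) auto
  then have "ren (lift_ren f) p = ren (lift_ren g) p"
    using Forall.prems(1) by (intro Forall.IH[of "Suc k"]) simp_all
  then show ?case by simp
next
  case (Implies p q)
  then show ?case using Implies.IH[of k f g] by simp
qed auto

lemma lift_ren_id: "lift_ren (\<lambda>i. i) = (\<lambda>i. i)"
proof
  fix n show "lift_ren (\<lambda>i. i) n = n" by (cases n) auto
qed

lemma ren_id: "ren (\<lambda>i. i) p = p"
  by (induction p) (auto simp: lift_ren_id)

lemma closed_at_mono: "closed_at k p \<Longrightarrow> k \<le> m \<Longrightarrow> closed_at m p"
proof (induction p arbitrary: k m)
  case (Forall p)
  then show ?case using Forall.IH[of "Suc k" "Suc m"] by auto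
qed auto

lemma closed_at_ex: "\<exists>k. closed_at k p"
proof (induction p)
  case (Implies p q)
  then obtain k m where "closed_at k p" "closed_at m q" by blast
  then have "closed_at (max k m) (Implies p q)" by (auto intro: closed_at_mono)
  then show ?case by blast
next
  case (Forall p)
  then obtain k where "closed_at k p" by blast
  then have "closed_at k (Forall p)" by (auto intro: closed_at_mono)
  then show ?case by blast
next
  case (Member m n)
  have "closed_at (Suc (max m n)) (Member m n)" by auto
  then show ?case by blast
next
  case (Equal m n)
  have "closed_at (Suc (max m n)) (Equal m n)" by auto
  then show ?case by blast
qed auto

lemma closed_at_ren: "closed_at k p \<Longrightarrow> (\<And>i. i < k \<Longrightarrow> f i < m) \<Longrightarrow> closed_at m (ren f p)"
proof (induction p arbitrary: f k m)
  case (Forall p)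
  have "lift_ren f i < Suc m" if "i < Suc k" for i
    using that Forall.prems by (cases i) auto
  then show ?case using Forall.prems(1) by (simp add: Forall.IH[of "Suc k"])
qed auto

lemma ren_instantiate: "ren f (instantiate t p) = instantiate (f t) (ren (lift_ren f) p)"
  unfolding instantiate_def ren_ren
  by (rule arg_cong[of _ _ "\<lambda>f. ren f p"]) (auto simp: fun_eq_iff split: nat.split)

text \<open>Instantiation after a lifted renaming is one renaming that sends \<open>0\<close> to
  \<open>t\<close>; the quantifier case of \<open>truth\<close> needs this form.\<close>

lemma instantiate_ren_lift: "instantiate t (ren (lift_ren f) p) = ren (case_nat t f) p"
  unfolding instantiate_def ren_ren
proof (rule arg_cong[of _ _ "\<lambda>f. ren f p"], rule ext)
  fix n show "(case_nat t (\<lambda>k. k) \<circ> lift_ren f) n = case_nat t f n" by (cases n) auto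
qed

section \<open>Weakening, renaming and finiteness of derivations\<close>

lemma derives_mono: "\<Gamma> \<turnstile> p \<Longrightarrow> \<Gamma> \<subseteq> \<Delta> \<Longrightarrow> \<Delta> \<turnstile> p"
proof (induction arbitrary: \<Delta> rule: derives.induct)
  case (ImpliesI p \<Gamma> q)
  then show ?case by (meson derives.ImpliesI insert_mono)
next
  case (Classical p \<Gamma>)
  then show ?case by (meson derives.Classical insert_mono)
next
  case (ForallI \<Gamma> p)
  then show ?case by (meson derives.ForallI image_mono)
next
  case (ImpliesE \<Gamma> p q)
  then show ?case by (meson derives.ImpliesE)
next
  case (ForallE \<Gamma> p t)
  then show ?case by (meson derives.ForallE)
next
  case (Subst \<Gamma> s t p)
  then show ?case by (meson derives.Subst)
qed (auto intro: derives.Assumption derives.Refl)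

text \<open>A lifted renaming commutes with the shift of the context and fixes the eigenvariable
  \<open>0\<close>, so renaming passes through \<open>ForallI\<close>.\<close>

lemma derives_ren: "\<Gamma> \<turnstile> p \<Longrightarrow> ren f ` \<Gamma> \<turnstile> ren f p"
proof (induction arbitrary: f rule: derives.induct)
  case (ForallI \<Gamma> p)
  have "ren (lift_ren f) ` ren Suc ` \<Gamma> = ren Suc ` ren f ` \<Gamma>"
    by (simp add: image_image ren_ren comp_def)
  then show ?case using ForallI.IH[of "lift_ren f"] by (auto intro: derives.ForallI)
next
  case (ForallE \<Gamma> p t)
  then show ?case using derives.ForallE[of "ren f ` \<Gamma>" "ren (lift_ren f) p" "f t"]
    by (simp add: ren_instantiate)
next
  case (Subst \<Gamma> s t p)
  then show ?case using derives.Subst[of "ren f ` \<Gamma>" "f s" "f t" "ren (lift_ren f) p"]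
    by (simp add: ren_instantiate)
next
  case (ImpliesI p \<Gamma> q)
  then show ?case by (auto intro: derives.ImpliesI)
next
  case (Classical p \<Gamma>)
  then show ?case using derives.Classical[of "ren f p" "ren f ` \<Gamma>"] by simp
next
  case (ImpliesE \<Gamma> p q)
  then show ?case using derives.ImpliesE[of "ren f ` \<Gamma>" "ren f p" "ren f q"] by simp
qed (auto intro: derives.Assumption derives.Refl)

text \<open>Needed to trace an inconsistency of the union of a chain of theories back to one of its
  stages.\<close>

lemma derives_finite: "\<Gamma> \<turnstile> p \<Longrightarrow> \<exists>\<Delta>. finite \<Delta> \<and> \<Delta> \<subseteq> \<Gamma> \<and> \<Delta> \<turnstile> p"
proof (induction rule: derives.induct)
  case (Assumption p \<Gamma>)
  then show ?case by (intro exI[of _ "{p}"]) (auto intro: derives.Assumption)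
next
  case (ImpliesI p \<Gamma> q)
  then obtain \<Delta> where \<Delta>: "finite \<Delta>" "\<Delta> \<subseteq> insert p \<Gamma>" "\<Delta> \<turnstile> q" by blast
  then have "insert p (\<Delta> - {p}) \<turnstile> q" by (elim derives_mono) auto
  then have "\<Delta> - {p} \<turnstile> Implies p q" by (rule derives.ImpliesI)
  then show ?case using \<Delta> by (intro exI[of _ "\<Delta> - {p}"]) auto
next
  case (ImpliesE \<Gamma> p q)
  then obtain \<Delta> \<Delta>' where \<Delta>: "finite \<Delta>" "\<Delta> \<subseteq> \<Gamma>" "\<Delta> \<turnstile> Implies p q"
    and \<Delta>': "finite \<Delta>'" "\<Delta>' \<subseteq> \<Gamma>" "\<Delta>' \<turnstile> p"
    by blast
  have "\<Delta> \<union> \<Delta>' \<turnstile> q"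
    using derives_mono[OF \<Delta>(3), of "\<Delta> \<union> \<Delta>'"] derives_mono[OF \<Delta>'(3), of "\<Delta> \<union> \<Delta>'"]
    by (auto intro: derives.ImpliesE)
  then show ?case using \<Delta> \<Delta>' by (intro exI[of _ "\<Delta> \<union> \<Delta>'"]) auto
next
  case (Classical p \<Gamma>)
  then obtain \<Delta> where \<Delta>: "finite \<Delta>" "\<Delta> \<subseteq> insert (Implies p Falsum) \<Gamma>" "\<Delta> \<turnstile> Falsum" by blast
  then have "insert (Implies p Falsum) (\<Delta> - {Implies p Falsum}) \<turnstile> Falsum" by (elim derives_mono) auto
  then have "\<Delta> - {Implies p Falsum} \<turnstile> p" by (rule derives.Classical)
  then show ?case using \<Delta> by (intro exI[of _ "\<Delta> - {Implies p Falsum}"]) auto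
next
  case (ForallI \<Gamma> p)
  then obtain \<Delta> where \<Delta>: "finite \<Delta>" "\<Delta> \<subseteq> ren Suc ` \<Gamma>" "\<Delta> \<turnstile> p" by blast
  then obtain \<Delta>' where "finite \<Delta>'" "\<Delta>' \<subseteq> \<Gamma>" "\<Delta> = ren Suc ` \<Delta>'"
    by (meson finite_subset_image)
  moreover have "\<Delta>' \<turnstile> Forall p" using calculation \<Delta>(3) by (simp add: derives.ForallI)
  ultimately show ?case by blast
next
  case (ForallE \<Gamma> p t)
  then show ?case by (meson derives.ForallE)
next
  case (Refl \<Gamma> t)
  then show ?case by (intro exI[of _ "{}"]) (auto intro: derives.Refl)
next
  case (Subst \<Gamma> s t p)
  then obtain \<Delta> \<Delta>' where \<Delta>: "finite \<Delta>" "\<Delta> \<subseteq> \<Gamma>" "\<Delta> \<turnstile> Equal s t"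
    and \<Delta>': "finite \<Delta>'" "\<Delta>' \<subseteq> \<Gamma>" "\<Delta>' \<turnstile> instantiate s p"
    by blast
  have "\<Delta> \<union> \<Delta>' \<turnstile> instantiate t p"
    using derives_mono[OF \<Delta>(3), of "\<Delta> \<union> \<Delta>'"] derives_mono[OF \<Delta>'(3), of "\<Delta> \<union> \<Delta>'"]
    by (intro derives.Subst[of _ s t p]) auto
  then show ?case using \<Delta> \<Delta>' by (intro exI[of _ "\<Delta> \<union> \<Delta>'"]) auto
qed

lemma derives_cut: "\<Gamma> \<turnstile> p \<Longrightarrow> insert p \<Gamma> \<turnstile> q \<Longrightarrow> \<Gamma> \<turnstile> q"
  by (meson derives.ImpliesE derives.ImpliesI)

abbreviation Neg :: "fm \<Rightarrow> fm" where "Neg p \<equiv> Implies p Falsum"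

lemma derives_falsum: "\<Gamma> \<turnstile> p \<Longrightarrow> \<Gamma> \<turnstile> Neg p \<Longrightarrow> \<Gamma> \<turnstile> Falsum"
  using derives.ImpliesE by blast

text \<open>\<open>ForallI\<close> generalizes only over index \<open>0\<close> above a shifted
  context. Under the bound \<open>k\<close> on the free variables, the renaming \<open>?f\<close>
  that sends \<open>k\<close> to \<open>0\<close> and shifts the rest agrees with the plain shift on
  the context and undoes the instantiation of \<open>p\<close> at \<open>k\<close>.\<close>

lemma generalize_fresh:
  assumes closed: "\<And>q. q \<in> \<Gamma> \<Longrightarrow> closed_at k q" "closed_at (Suc k) p"
    and "\<Gamma> \<turnstile> instantiate k p"
  shows "\<Gamma> \<turnstile> Forall p"
proof -
  let ?f = "\<lambda>i. if i = k then 0 else Suc i"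
  have 1: "ren ?f ` \<Gamma> \<turnstile> ren ?f (instantiate k p)"
    using assms(3) by (rule derives_ren)
  have 2: "ren ?f ` \<Gamma> = ren Suc ` \<Gamma>"
    by (intro image_cong refl) (rule ren_cong[OF closed(1)], auto)
  have "ren ?f (instantiate k p) = ren (\<lambda>i. i) p"
    unfolding instantiate_def ren_ren
    by (rule ren_cong[OF closed(2)]) (auto split: nat.split)
  then show ?thesis using 1 2 by (simp add: ren_id derives.ForallI)
qed

section \<open>Henkin theories\<close>

instance fm :: countable by countable_datatype

text \<open>A maximal consistent theory with witnesses. Variables are the only terms, so a witness
  is again a variable and the term model lives on \<open>nat\<close>.\<close>

locale henkin =
  fixes G :: "fm set"
  assumes consistent: "\<not> G \<turnstile> Falsum"
    and complete: "p \<in> G \<or> Neg p \<in> G"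
    and witness: "Neg (Forall p) \<in> G \<Longrightarrow> \<exists>t. Neg (instantiate t p) \<in> G"
begin

lemma closure: "G \<turnstile> p \<Longrightarrow> p \<in> G"
  using complete[of p] consistent derives.Assumption derives_falsum by blast

lemma Falsum_iff: "Falsum \<notin> G"
  using consistent derives.Assumption by blast

lemma Implies_iff: "Implies p q \<in> G \<longleftrightarrow> (p \<in> G \<longrightarrow> q \<in> G)"
proof
  assume "p \<in> G \<longrightarrow> q \<in> G"
  then consider "Neg p \<in> G" | "q \<in> G" using complete by blast
  then have "insert p G \<turnstile> q"
  proof cases
    case 1
    then have "insert p G \<turnstile> Falsum"
      by (meson derives.Assumption derives_falsum insertCI)
    then show ?thesis by (meson derives.Classical derives_mono subset_insertI)
  qed (auto intro: derives.Assumption)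
  then show "Implies p q \<in> G" by (intro closure derives.ImpliesI)
qed (meson closure derives.Assumption derives.ImpliesE)

lemma Forall_iff: "Forall p \<in> G \<longleftrightarrow> (\<forall>t. instantiate t p \<in> G)"
proof
  assume *: "\<forall>t. instantiate t p \<in> G"
  show "Forall p \<in> G"
  proof (rule ccontr)
    assume "Forall p \<notin> G"
    then obtain t where "Neg (instantiate t p) \<in> G" using complete witness by blast
    then show False using * Implies_iff Falsum_iff by blast
  qed
qed (meson closure derives.Assumption derives.ForallE)

lemma Equal_refl: "Equal i i \<in> G"
  by (auto intro: closure derives.Refl)

lemma Equal_subst: "Equal i j \<in> G \<Longrightarrow> instantiate i p \<in> G \<Longrightarrow> instantiate j p \<in> G"
  by (meson closure derives.Assumption derives.Subst)

lemma Equal_sym: "Equal i j \<in> G \<Longrightarrow> Equal j i \<in> G"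
  \<comment> \<open>The template \<open>Equal 0 (Suc i)\<close> becomes \<open>Equal i i\<close>
    when instantiated at \<open>i\<close> and \<open>Equal j i\<close> at \<open>j\<close>.\<close>
  using Equal_subst[of i j "Equal 0 (Suc i)"] Equal_refl[of i] by (simp add: instantiate_def)

lemma Equal_trans: "Equal i j \<in> G \<Longrightarrow> Equal j k \<in> G \<Longrightarrow> Equal i k \<in> G"
  using Equal_subst[of j k "Equal (Suc i) 0"] by (simp add: instantiate_def)

lemma Member_cong:
  assumes "Equal i i' \<in> G" "Equal j j' \<in> G" "Member i j \<in> G" shows "Member i' j' \<in> G"
  using Equal_subst[of i i' "Member 0 (Suc j)"] Equal_subst[of j j' "Member (Suc i') 0"] assms
  by (simp add: instantiate_def)

end

text \<open>Deciding a universal formula negatively includes a counterexample, so a single pass over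
  all formulas yields both completeness and witnesses.\<close>

definition decides :: "fm set \<Rightarrow> fm \<Rightarrow> bool" where
  "decides Y p \<longleftrightarrow>
    p \<in> Y \<or> (Neg p \<in> Y \<and> (\<forall>q. p = Forall q \<longrightarrow> (\<exists>t. Neg (instantiate t q) \<in> Y)))"

text \<open>A fresh variable for the counterexample exists because \<open>\<Gamma>\<close> consists
  of sentences and \<open>X\<close> is finite; \<open>generalize_fresh\<close> shows that adding the
  counterexample preserves consistency.\<close>

lemma henkin_step:
  assumes \<Gamma>: "\<And>q. q \<in> \<Gamma> \<Longrightarrow> closed_at 0 q" and X: "finite X" "\<not> \<Gamma> \<union> X \<turnstile> Falsum"
  shows "\<exists>Y. X \<subseteq> Y \<and> finite Y \<and> \<not> \<Gamma> \<union> Y \<turnstile> Falsum \<and> decides Y p"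
proof (cases "\<Gamma> \<union> insert p X \<turnstile> Falsum")
  case False
  then show ?thesis using X by (intro exI[of _ "insert p X"]) (auto simp: decides_def)
next
  case True
  then have neg: "\<Gamma> \<union> X \<turnstile> Neg p" by (auto intro: derives.ImpliesI)
  then have con: "\<not> \<Gamma> \<union> insert (Neg p) X \<turnstile> Falsum"
    using X(2) derives_cut[OF neg] by auto
  show ?thesis
  proof (cases "\<exists>q. p = Forall q")
    case False
    then show ?thesis using X con by (intro exI[of _ "insert (Neg p) X"]) (auto simp: decides_def)
  next
    case True
    then obtain q where q: "p = Forall q" by blast
    have "\<exists>k. \<forall>r\<in>F. closed_at k r" if "finite F" for F
      using that
    proof (induction F)
      case (insert r F)
      then obtain k m where "\<forall>s\<in>F. closed_at k s" "closed_at m r" using closed_at_ex by blast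
      then have "\<forall>s\<in>insert r F. closed_at (max k m) s" by (auto intro: closed_at_mono)
      then show ?case by blast
    qed auto
    then obtain k where k: "\<And>r. r \<in> insert (Neg p) X \<Longrightarrow> closed_at k r"
      using X(1) by (meson finite_insert)
    let ?Y = "insert (Neg (instantiate k q)) (insert (Neg p) X)"
    have "\<not> \<Gamma> \<union> ?Y \<turnstile> Falsum"
    proof
      assume "\<Gamma> \<union> ?Y \<turnstile> Falsum"
      then have "\<Gamma> \<union> insert (Neg p) X \<turnstile> instantiate k q" by (auto intro: derives.Classical)
      moreover have "closed_at k r" if "r \<in> \<Gamma> \<union> insert (Neg p) X" for r
        using that \<Gamma> k by (auto intro: closed_at_mono)
      moreover have "closed_at (Suc k) q" using k[of "Neg p"] q by auto
      ultimately have "\<Gamma> \<union> insert (Neg p) X \<turnstile> p" using q generalize_fresh by blast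
      then show False using con derives_falsum[of "\<Gamma> \<union> insert (Neg p) X" p]
        by (auto intro: derives.Assumption)
    qed
    then show ?thesis using X q by (intro exI[of _ ?Y]) (auto simp: decides_def)
  qed
qed

lemma henkin_extension:
  assumes \<Gamma>: "\<And>q. q \<in> \<Gamma> \<Longrightarrow> closed_at 0 q" and con: "\<not> \<Gamma> \<turnstile> Falsum"
  shows "\<exists>G. \<Gamma> \<subseteq> G \<and> henkin G"
proof -
  let ?P = "\<lambda>(n::nat) (X::fm set). finite X \<and> \<not> \<Gamma> \<union> X \<turnstile> Falsum"
  \<comment> \<open>Stage \<open>n + 1\<close> decides the formula coded by \<open>n\<close>;
    countability of \<open>fm\<close> ensures that every formula gets its turn.\<close>
  let ?Q = "\<lambda>n X Y. X \<subseteq> Y \<and> decides Y (from_nat n)"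
  have "\<exists>f. \<forall>n. ?P n (f n) \<and> ?Q n (f n) (f (Suc n))"
  proof (rule dependent_nat_choice)
    show "\<exists>X. ?P 0 X" using con by (intro exI[of _ "{}"]) auto
  next
    fix X n assume "?P n X"
    then show "\<exists>Y. ?P (Suc n) Y \<and> ?Q n X Y"
      using henkin_step[OF \<Gamma>, where X = X and p = "from_nat n :: fm"] by blast
  qed
  then obtain f where "\<forall>n. ?P n (f n) \<and> ?Q n (f n) (f (Suc n))" by (rule exE)
  then have f: "?P n (f n)" "?Q n (f n) (f (Suc n))" for n by simp_all
  have mono: "f m \<subseteq> f n" if "m \<le> n" for m n
    by (rule lift_Suc_mono_le[of f, OF _ that]) (use f(2) in blast)
  define G where "G = \<Gamma> \<union> (\<Union>n. f n)"
  have dec: "decides G p" for p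
  proof -
    have "decides (f (Suc (to_nat p))) p" using f(2)[of "to_nat p"] by simp
    moreover have "f (Suc (to_nat p)) \<subseteq> G" unfolding G_def by blast
    ultimately show ?thesis unfolding decides_def by blast
  qed
  have con': "\<not> G \<turnstile> Falsum"
  proof
    assume "G \<turnstile> Falsum"
    then obtain \<Delta> where \<Delta>: "finite \<Delta>" "\<Delta> \<subseteq> G" "\<Delta> \<turnstile> Falsum" using derives_finite by blast
    have "\<exists>n. \<Delta> \<subseteq> \<Gamma> \<union> f n" using \<Delta>(1,2)
    proof (induction \<Delta>)
      case (insert p \<Delta>)
      then obtain n m where "\<Delta> \<subseteq> \<Gamma> \<union> f n" "p \<in> \<Gamma> \<union> f m" unfolding G_def by blast
      then have "insert p \<Delta> \<subseteq> \<Gamma> \<union> f (max n m)"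
        using mono[of n "max n m"] mono[of m "max n m"] by auto
      then show ?case by blast
    qed auto
    then obtain n where "\<Delta> \<subseteq> \<Gamma> \<union> f n" ..
    then show False using f(1)[of n] derives_mono[OF \<Delta>(3)] by simp
  qed
  have "henkin G"
  proof
    fix p assume "Neg (Forall p) \<in> G"
    moreover have "Forall p \<notin> G"
      using calculation con' derives_falsum derives.Assumption by blast
    ultimately show "\<exists>t. Neg (instantiate t p) \<in> G" using dec[of "Forall p"] unfolding decides_def by blast
  qed (use con' dec decides_def in blast)+
  then show ?thesis unfolding G_def by blast
qed

text \<open>Equality is interpreted by an arbitrary relation \<open>Q\<close>, because in the term
  model it is only a congruence; \<open>sat_quotient\<close> replaces it by true equality.\<close>

fun sat :: "('a \<Rightarrow> 'a \<Rightarrow> bool) \<Rightarrow> ('a \<Rightarrow> 'a \<Rightarrow> bool) \<Rightarrow> (nat \<Rightarrow> 'a) \<Rightarrow> fm \<Rightarrow> bool" where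
  "sat E Q e (Member m n) \<longleftrightarrow> E (e m) (e n)"
| "sat E Q e (Equal m n) \<longleftrightarrow> Q (e m) (e n)"
| "sat E Q e Falsum \<longleftrightarrow> False"
| "sat E Q e (Implies p q) \<longleftrightarrow> (sat E Q e p \<longrightarrow> sat E Q e q)"
| "sat E Q e (Forall p) \<longleftrightarrow> (\<forall>x. sat E Q (case_nat x e) p)"

lemma case_nat_lift_ren: "case_nat x e \<circ> lift_ren f = case_nat x (e \<circ> f)"
proof
  fix n show "(case_nat x e \<circ> lift_ren f) n = case_nat x (e \<circ> f) n" by (cases n) auto
qed

lemma sat_ren: "sat E Q e (ren f p) \<longleftrightarrow> sat E Q (e \<circ> f) p"
  by (induction p arbitrary: e f) (auto simp: case_nat_lift_ren)

lemma sat_cong: "closed_at k p \<Longrightarrow> (\<And>i. i < k \<Longrightarrow> e i = e' i) \<Longrightarrow> sat E Q e p \<longleftrightarrow> sat E Q e' p"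
proof (induction p arbitrary: e e' k)
  case (Implies p q)
  show ?case using Implies.IH[of k e e'] Implies.prems by simp
next
  case (Forall p)
  have "sat E Q (case_nat x e) p \<longleftrightarrow> sat E Q (case_nat x e') p" for x
    using Forall.prems by (intro Forall.IH[of "Suc k"]) (auto split: nat.split)
  then show ?case by simp
qed auto

text \<open>Elements of the term model are variables, so an assignment is the same thing as a
  renaming.\<close>

lemma (in henkin) truth:
  "sat (\<lambda>i j. Member i j \<in> G) (\<lambda>i j. Equal i j \<in> G) e p \<longleftrightarrow> ren e p \<in> G"
  by (induction p arbitrary: e) (auto simp: Implies_iff Forall_iff Falsum_iff instantiate_ren_lift)

text \<open>\<open>r\<close> enumerates one representative of each class and \<open>e'\<close>
  assigns indices of classes. The quantifier case works because every element is equivalent to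
  exactly one representative.\<close>

lemma sat_quotient:
  fixes r :: "'b \<Rightarrow> 'a"
  assumes Q: "\<And>i. Q i i" "\<And>i j. Q i j \<Longrightarrow> Q j i" "\<And>i j k. Q i j \<Longrightarrow> Q j k \<Longrightarrow> Q i k"
    and E: "\<And>i i' j j'. Q i i' \<Longrightarrow> Q j j' \<Longrightarrow> E i j \<Longrightarrow> E i' j'"
    and r: "\<And>n. \<exists>!i. Q n (r i)"
    and e: "\<And>i. Q (e i) (r (e' i))"
  shows "sat E Q e p \<longleftrightarrow> sat (\<lambda>i j. E (r i) (r j)) (=) e' p"
  using e
proof (induction p arbitrary: e e')
  case (Member m n)
  then show ?case using E Q(2) unfolding sat.simps by meson
next
  case (Equal m n)
  then show ?case using r Q unfolding sat.simps by metis
next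
  case (Implies p q)
  then show ?case unfolding sat.simps by blast
next
  case (Forall p)
  have 1: "sat E Q (case_nat x e) p \<longleftrightarrow> sat (\<lambda>i j. E (r i) (r j)) (=) (case_nat y e') p"
    if "Q x (r y)" for x y
    using that Forall.prems by (intro Forall.IH) (auto split: nat.split)
  show ?case unfolding sat.simps using 1 r Q(1) by metis
qed auto

text \<open>With singletons and an empty set there are infinitely many classes: \<open>x \<mapsto> {x}\<close> is injective on
  classes and misses the class of the empty set.\<close>

lemma quotient_enumeration:
  fixes Q E :: "nat \<Rightarrow> nat \<Rightarrow> bool"
  assumes Q: "\<And>i. Q i i" "\<And>i j. Q i j \<Longrightarrow> Q j i" "\<And>i j k. Q i j \<Longrightarrow> Q j k \<Longrightarrow> Q i k"
    and E: "\<And>i i' j j'. Q i i' \<Longrightarrow> Q j j' \<Longrightarrow> E i j \<Longrightarrow> E i' j'"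
    and sing: "\<And>x. \<exists>p. \<forall>z. E z p \<longleftrightarrow> Q z x" and empty: "\<exists>x. \<forall>z. \<not> E z x"
  shows "\<exists>r::nat \<Rightarrow> nat. \<forall>n. \<exists>!i. Q n (r i)"
proof -
  define h where "h n = (LEAST m. Q n m)" for n
  have h: "Q n (h n)" for n unfolding h_def using Q(1) by (rule LeastI)
  have heq: "h m = h n" if "Q m n" for m n
  proof -
    have "Q m = Q n" using that Q by blast
    then show ?thesis unfolding h_def by simp
  qed
  obtain s where s: "\<And>x z. E z (s x) \<longleftrightarrow> Q z x" using sing by metis
  obtain o' where o': "\<And>z. \<not> E z o'" using empty by blast
  have inf: "infinite (range h)"
  proof
    assume fin: "finite (range h)"
    have "inj_on (h \<circ> s) (range h)"
    proof (rule inj_onI)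
      fix x y assume xy: "x \<in> range h" "y \<in> range h" "(h \<circ> s) x = (h \<circ> s) y"
      then have "Q (s x) (s y)" using h Q by (metis comp_apply)
      then have "E x (s y)" using s[of x x] E[of x x "s x" "s y"] Q(1) by simp
      then have "Q x y" using s by simp
      then show "x = y" using xy heq h Q by (metis imageE)
    qed
    then have "(h \<circ> s) ` range h = range h"
      using fin by (intro endo_inj_surj) auto
    then obtain x where "h o' = h (s x)" by (metis comp_apply imageE rangeI)
    then have "Q (s x) o'" using h Q by metis
    then have "E x o'" using s[of x x] E[of x x "s x" o'] Q(1) by simp
    then show False using o' by simp
  qed
  let ?r = "enumerate (range h)"
  have "\<exists>!i. Q n (?r i)" for n
  proof -
    obtain i where i: "?r i = h n" using enumerate_Ex[OF inf, of "h n"] by blast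
    show ?thesis
    proof (rule ex1I[of _ i])
      show "Q n (?r i)" using h i by simp
      fix j assume "Q n (?r j)"
      moreover obtain m where "?r j = h m" using enumerate_in_set[OF inf, of j] by blast
      ultimately have "?r j = ?r i" using i heq h Q by metis
      then show "j = i" using strict_mono_enumerate[OF inf] strict_mono_eq by blast
    qed
  qed
  then show ?thesis by blast
qed

text \<open>The last assumption makes the term model infinite, so that models on \<open>nat\<close> with true equality
  suffice.\<close>

lemma completeness:
  assumes \<Gamma>: "\<And>q. q \<in> \<Gamma> \<Longrightarrow> closed_at 0 q" "closed_at 0 p"
    and valid: "\<And>(E :: nat \<Rightarrow> nat \<Rightarrow> bool) e. (\<And>q e. q \<in> \<Gamma> \<Longrightarrow> sat E (=) e q) \<Longrightarrow> sat E (=) e p"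
    and infinite: "\<And>(E :: nat \<Rightarrow> nat \<Rightarrow> bool) Q. (\<And>q e. q \<in> \<Gamma> \<Longrightarrow> sat E Q e q) \<Longrightarrow>
      (\<forall>x. \<exists>p. \<forall>z. E z p \<longleftrightarrow> Q z x) \<and> (\<exists>x. \<forall>z. \<not> E z x)"
  shows "\<Gamma> \<turnstile> p"
proof (rule ccontr)
  assume "\<not> \<Gamma> \<turnstile> p"
  then have "\<not> insert (Neg p) \<Gamma> \<turnstile> Falsum" using derives.Classical by blast
  moreover have "closed_at 0 q" if "q \<in> insert (Neg p) \<Gamma>" for q using that \<Gamma> by auto
  ultimately obtain G where G: "insert (Neg p) \<Gamma> \<subseteq> G" "henkin G"
    using henkin_extension[of "insert (Neg p) \<Gamma>"] by blast
  interpret henkin G by fact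
  let ?E = "\<lambda>i j. Member i j \<in> G" and ?Q = "\<lambda>i j. Equal i j \<in> G"
  have ren_closed: "ren e q = q" if "closed_at 0 q" for e q
    using ren_cong[OF that, of e "\<lambda>i. i"] by (simp add: ren_id)
  have sat: "sat ?E ?Q e q" if "q \<in> \<Gamma>" for q e
    using that G(1) \<Gamma>(1) by (auto simp: truth ren_closed)
  have inf: "(\<forall>x. \<exists>p. \<forall>z. ?E z p \<longleftrightarrow> ?Q z x) \<and> (\<exists>x. \<forall>z. \<not> ?E z x)"
    using sat by (rule infinite)
  have "\<exists>r::nat \<Rightarrow> nat. \<forall>n. \<exists>!i. ?Q n (r i)"
    by (rule quotient_enumeration[where Q = ?Q and E = ?E])
      (fact Equal_refl Equal_sym Equal_trans Member_cong inf[THEN conjunct1, rule_format]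
        inf[THEN conjunct2])+
  then obtain r :: "nat \<Rightarrow> nat" where r: "\<And>n. \<exists>!i. ?Q n (r i)" by blast
  have quot: "sat ?E ?Q (r \<circ> e) q \<longleftrightarrow> sat (\<lambda>i j. ?E (r i) (r j)) (=) e q" for e q
    by (rule sat_quotient)
      (fact Equal_refl Equal_sym Equal_trans Member_cong r | simp add: Equal_refl)+
  have "sat (\<lambda>i j. ?E (r i) (r j)) (=) e p" for e
  proof (rule valid)
    fix q e assume "q \<in> \<Gamma>"
    then show "sat (\<lambda>i j. ?E (r i) (r j)) (=) e q" using sat[of q "r \<circ> e"] quot[of e q] by simp
  qed
  then have "ren r p \<in> G" using quot[of "\<lambda>i. i" p] by (simp add: truth comp_def)
  moreover have "Neg p \<in> G" using G(1) by simp
  ultimately show False using ren_closed[OF \<Gamma>(2)] Implies_iff Falsum_iff by simp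
qed

section \<open>Semantics of formulas with named variables\<close>

text \<open>Turns an assignment \<open>l\<close> to levels into an assignment to de Bruijn indices
  at depth \<open>d\<close>. Indices from \<open>d\<close> on do not occur free in formulas closed
  at \<open>d\<close>.\<close>

definition env :: "nat \<Rightarrow> (nat \<Rightarrow> 'a) \<Rightarrow> nat \<Rightarrow> 'a" where
  "env d l i = (if i < d then l (d - 1 - i) else undefined)"

lemma case_nat_env: "case_nat x (env d l) = env (Suc d) (l(d := x))"
  by (auto simp: env_def fun_eq_iff split: nat.split)

lemma env_index: "x < d \<Longrightarrow> env d l (d - Suc x) = l x"
  by (auto simp: env_def)

definition qsat :: "('a \<Rightarrow> 'a \<Rightarrow> bool) \<Rightarrow> ('a \<Rightarrow> 'a \<Rightarrow> bool) \<Rightarrow> nat \<Rightarrow> (nat \<Rightarrow> 'a) \<Rightarrow> fml \<Rightarrow> bool" where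
  "qsat E Q d l \<phi> \<longleftrightarrow> sat E Q (env d l) (\<phi> d)"

lemma qsat_simps:
  "x < d \<Longrightarrow> y < d \<Longrightarrow> qsat E Q d l (x \<^bold>\<in> y) \<longleftrightarrow> E (l x) (l y)"
  "x < d \<Longrightarrow> y < d \<Longrightarrow> qsat E Q d l (x \<^bold>= y) \<longleftrightarrow> Q (l x) (l y)"
  "qsat E Q d l (\<phi> \<^bold>\<longrightarrow> \<psi>) \<longleftrightarrow> (qsat E Q d l \<phi> \<longrightarrow> qsat E Q d l \<psi>)"
  "qsat E Q d l (\<^bold>\<not> \<phi>) \<longleftrightarrow> \<not> qsat E Q d l \<phi>"
  "qsat E Q d l (\<phi> \<^bold>\<and> \<psi>) \<longleftrightarrow> qsat E Q d l \<phi> \<and> qsat E Q d l \<psi>"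
  "qsat E Q d l (\<phi> \<^bold>\<or> \<psi>) \<longleftrightarrow> qsat E Q d l \<phi> \<or> qsat E Q d l \<psi>"
  "qsat E Q d l (\<phi> \<^bold>\<longleftrightarrow> \<psi>) \<longleftrightarrow> (qsat E Q d l \<phi> \<longleftrightarrow> qsat E Q d l \<psi>)"
  "qsat E Q d l (fall \<Phi>) \<longleftrightarrow> (\<forall>v. qsat E Q (Suc d) (l(d := v)) (\<Phi> d))"
  "qsat E Q d l (fex \<Phi>) \<longleftrightarrow> (\<exists>v. qsat E Q (Suc d) (l(d := v)) (\<Phi> d))"
  by (auto simp: qsat_def fmem_def feq_def fimp_def fneg_def fconj_def fdisj_def fiff_def fall_def
      fex_def env_index case_nat_env)

text \<open>Strips the parameter quantifiers from an instance of a schema: the levels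
  \<open>j, ..., j + k - 1\<close> receive arbitrary values, collected in \<open>l'\<close>.\<close>

lemma sat_Forall_power:
  "sat E Q (env j l) ((Forall ^^ k) q) \<Longrightarrow> (\<And>i. i < j \<Longrightarrow> l' i = l i) \<Longrightarrow> sat E Q (env (j + k) l') q"
proof (induction k arbitrary: j l)
  case 0
  have "env j l = env j l'" using 0 by (auto simp: env_def)
  then show ?case using 0 by simp
next
  case (Suc k)
  have "sat E Q (env (Suc j) (l(j := l' j))) ((Forall ^^ k) q)"
    using Suc.prems(1) by (simp add: case_nat_env)
  then have "sat E Q (env (Suc j + k) l') q"
    by (rule Suc.IH) (use Suc.prems(2) in \<open>auto simp: less_Suc_eq\<close>)
  then show ?case by simp
qed

section \<open>Closed formulas, and the reduction of provability to models\<close>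

definition clo :: "nat \<Rightarrow> fml \<Rightarrow> bool" where "clo d \<phi> \<longleftrightarrow> closed_at d (\<phi> d)"

text \<open>Atomic formulas are closed at every positive depth, whatever their levels, because
  truncated subtraction keeps \<open>d - 1 - x\<close> below \<open>d\<close>.\<close>

lemma clo_simps:
  "0 < d \<Longrightarrow> clo d (x \<^bold>\<in> y)" "0 < d \<Longrightarrow> clo d (x \<^bold>= y)"
  "clo d (\<phi> \<^bold>\<longrightarrow> \<psi>) \<longleftrightarrow> clo d \<phi> \<and> clo d \<psi>" "clo d (\<^bold>\<not> \<phi>) \<longleftrightarrow> clo d \<phi>"
  "clo d (\<phi> \<^bold>\<and> \<psi>) \<longleftrightarrow> clo d \<phi> \<and> clo d \<psi>" "clo d (\<phi> \<^bold>\<or> \<psi>) \<longleftrightarrow> clo d \<phi> \<and> clo d \<psi>"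
  "clo d (\<phi> \<^bold>\<longleftrightarrow> \<psi>) \<longleftrightarrow> clo d \<phi> \<and> clo d \<psi>"
  "clo d (fall \<Phi>) \<longleftrightarrow> clo (Suc d) (\<Phi> d)" "clo d (fex \<Phi>) \<longleftrightarrow> clo (Suc d) (\<Phi> d)"
  by (auto simp: clo_def fmem_def feq_def fimp_def fneg_def fconj_def fdisj_def fiff_def fall_def
      fex_def)

lemma clo_at_vars: "closed_at (length xs) p \<Longrightarrow> 0 < d \<Longrightarrow> clo d (p\<lbrakk>xs\<rbrakk>)"
  unfolding clo_def at_vars_def by (rule closed_at_ren) auto

lemma closed_at_Forall_power: "closed_at j ((Forall ^^ k) q) \<longleftrightarrow> closed_at (j + k) q"
  by (induction k arbitrary: j) auto

lemmas vocabulary_defs = fsub_def is_empty_def nonempty_def is_upair_def is_pair_def pair_mem_def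
  is_Union_def is_Inter_def is_inter_def is_diff_def is_cart_def is_succ_def is_inductive_def
  is_omega_def function_on_def function_into_def bijection_def equipotent_def is_countable_def
  is_infinite_def dedekind_infinite_def extensionality_ax_def foundation_ax_def pairing_ax_def
  union_ax_def power_set_ax_def infinity_ax_def linear_ordering_def
  strongly_complete_linear_ordering_def app2_def commutative_monoid_def ordered_field_def
  upper_bound_def is_real_line_def topology_on_def G_delta_def P_space_def base_of_def
  almost_stable_def clopen_def zero_dimensional_def T1_def product_topology_def
  nonempty_family_def choice_function_def strongly_complete_orderings_def CMC_def ABP_def
  AB0P_def PPP_def CACCLO_def PCACCLO_def IDI_R_def

lemma ZF_closed: "p \<in> ZF \<Longrightarrow> closed_at 0 p"
proof -
  have sep: "closed_at 0 (separation_ax k q)" if "closed_at (k + 1) q" for k q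
    unfolding separation_ax_def closed_at_Forall_power
    using that by (simp add: clo_simps clo_at_vars flip: clo_def)
  have rep: "closed_at 0 (replacement_ax k q)" if "closed_at (k + 2) q" for k q
    unfolding replacement_ax_def closed_at_Forall_power
    using that by (simp add: clo_simps clo_at_vars flip: clo_def)
  have "clo 0 extensionality_ax" "clo 0 foundation_ax" "clo 0 pairing_ax" "clo 0 union_ax"
    "clo 0 power_set_ax" "clo 0 infinity_ax"
    by (simp_all add: vocabulary_defs clo_simps)
  then show "p \<in> ZF \<Longrightarrow> closed_at 0 p"
    using sep rep by (auto simp: ZF_def clo_def)
qed

lemma ZF_provesI:
  assumes "clo 0 \<phi>"
    and "\<And>E :: nat \<Rightarrow> nat \<Rightarrow> bool. (\<And>q e. q \<in> ZF \<Longrightarrow> sat E (=) e q) \<Longrightarrow> sat E (=) (env 0 undefined) (\<phi> 0)"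
  shows "ZF_proves \<phi>"
  unfolding ZF_proves_def
proof (rule completeness)
  show "closed_at 0 (\<phi> 0)" using assms(1) by (simp add: clo_def)
next
  fix E :: "nat \<Rightarrow> nat \<Rightarrow> bool" and e
  assume "\<And>q e. q \<in> ZF \<Longrightarrow> sat E (=) e q"
  then have "sat E (=) (env 0 undefined) (\<phi> 0)" by (rule assms(2))
  then show "sat E (=) e (\<phi> 0)"
    using sat_cong[of 0 "\<phi> 0" e "env 0 undefined" E "(=)"] assms(1) by (simp add: clo_def)
next
  fix E Q :: "nat \<Rightarrow> nat \<Rightarrow> bool"
  assume "\<And>q e. q \<in> ZF \<Longrightarrow> sat E Q e q"
  \<comment> \<open>Pairing an element with itself gives singletons and infinity gives an empty set,
    even when \<open>Q\<close> is not the identity.\<close>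
  then have "qsat E Q 0 undefined pairing_ax" "qsat E Q 0 undefined infinity_ax"
    by (simp_all add: ZF_def qsat_def)
  then have pair: "\<forall>x y. \<exists>p. \<forall>z. E z p \<longleftrightarrow> Q z x \<or> Q z y"
    and inf: "\<exists>a e. (\<forall>z. \<not> E z e) \<and> E e a"
    by (simp_all add: vocabulary_defs qsat_simps) fast
  show "(\<forall>x. \<exists>p. \<forall>z. E z p \<longleftrightarrow> Q z x) \<and> (\<exists>x. \<forall>z. \<not> E z x)"
  proof (intro conjI allI)
    fix x show "\<exists>p. \<forall>z. E z p \<longleftrightarrow> Q z x" using pair[rule_format, of x x] by simp
    show "\<exists>x. \<forall>z. \<not> E z x" using inf by fast
  qed
qed (rule ZF_closed)

text \<open>Collects the rules that reduce definability of a predicate or function to that of its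
  parts, so that \<open>intro dfn\<close> discharges the side conditions of separation and
  replacement.\<close>

named_theorems dfn

locale membership =
  fixes E :: "'a \<Rightarrow> 'a \<Rightarrow> bool" (infix "mem" 50)
begin

abbreviation lsat :: "nat \<Rightarrow> (nat \<Rightarrow> 'a) \<Rightarrow> fml \<Rightarrow> bool" where
  "lsat \<equiv> qsat E (=)"

lemmas lsat_def = qsat_def[of E "(=)"]
lemmas lsat_simps = qsat_simps[where E = E and Q = "(=)"]

lemma lsat_at_vars:
  assumes "closed_at (length xs) p" "\<And>x. x \<in> set xs \<Longrightarrow> x < d"
    and "\<And>i. i < length xs \<Longrightarrow> l (xs ! i) = e i"
  shows "lsat d l (p\<lbrakk>xs\<rbrakk>) \<longleftrightarrow> sat E (=) e p"
  unfolding lsat_def at_vars_def sat_ren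
  by (rule sat_cong[OF assms(1)]) (use assms(2,3) in \<open>simp add: env_index\<close>)

section \<open>Definability with parameters\<close>

text \<open>A parametrically definable predicate of environments: the formula \<open>p\<close> reads the environment
  at the even indices and the parameters \<open>c\<close> at the odd ones.\<close>

definition params :: "(nat \<Rightarrow> 'a) \<Rightarrow> (nat \<Rightarrow> 'a) \<Rightarrow> nat \<Rightarrow> 'a" where
  "params c e = case_sum e c \<circ> sum_decode"

definition D :: "((nat \<Rightarrow> 'a) \<Rightarrow> bool) \<Rightarrow> bool" where
  "D P \<longleftrightarrow> (\<exists>p c. \<forall>e. P e \<longleftrightarrow> sat E (=) (params c e) p)"

text \<open>Definability of the graph: index \<open>0\<close> holds the value, and the arguments are
  shifted up by one.\<close>

definition DF :: "((nat \<Rightarrow> 'a) \<Rightarrow> 'a) \<Rightarrow> bool" where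
  "DF F \<longleftrightarrow> D (\<lambda>e. e 0 = F (\<lambda>i. e (Suc i)))"

lemma params_comp: "params c e \<circ> (sum_encode \<circ> f \<circ> sum_decode) = case_sum e c \<circ> f \<circ> sum_decode"
  by (simp add: params_def fun_eq_iff)

text \<open>The common source of renaming and of substituting constants: \<open>s\<close> tells for
  each variable whether it becomes another variable or a value of \<open>c'\<close>. Old and new
  parameters are merged into \<open>c''\<close>, which fills the odd indices.\<close>

lemma D_rearrange:
  fixes s :: "nat \<Rightarrow> nat + nat"
  assumes "D P"
  shows "D (\<lambda>e. P (\<lambda>i. case s i of Inl j \<Rightarrow> e j | Inr j \<Rightarrow> c' j))"
proof -
  obtain p c where p: "\<And>e. P e \<longleftrightarrow> sat E (=) (params c e) p" using assms unfolding D_def by blast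
  define c'' where "c'' = case_sum c c' \<circ> sum_decode"
  define f where "f = case_sum (\<lambda>i. case s i of Inl j \<Rightarrow> Inl j | Inr j \<Rightarrow> Inr (sum_encode (Inr j)))
    (\<lambda>k. Inr (sum_encode (Inl k)))"
  have "params c (\<lambda>i. case s i of Inl j \<Rightarrow> e j | Inr j \<Rightarrow> c' j) =
      params c'' e \<circ> (sum_encode \<circ> f \<circ> sum_decode)" for e
    unfolding params_comp
    by (auto simp: params_def fun_eq_iff f_def c''_def split: sum.split)
  then show ?thesis unfolding D_def p by (metis sat_ren)
qed

lemma D_ren: "D P \<Longrightarrow> D (\<lambda>e. P (\<lambda>i. e (f i)))"
  using D_rearrange[where P = P and s = "\<lambda>i. Inl (f i)"] by simp

lemma D_const: "D (\<lambda>e. b)"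
  unfolding D_def
  by (rule exI[of _ "if b then Implies Falsum Falsum else Falsum"]) simp

lemma D_imp: assumes "D P" "D Q" shows "D (\<lambda>e. P e \<longrightarrow> Q e)"
proof -
  obtain p c where p: "\<And>e. P e \<longleftrightarrow> sat E (=) (params c e) p" using assms(1) unfolding D_def by blast
  obtain q c' where q: "\<And>e. Q e \<longleftrightarrow> sat E (=) (params c' e) q" using assms(2) unfolding D_def by blast
  define c'' where "c'' = case_sum c c' \<circ> sum_decode"
  have 1: "params c e = params c'' e \<circ> (sum_encode \<circ> case_sum Inl (\<lambda>k. Inr (sum_encode (Inl k))) \<circ> sum_decode)" for e
    unfolding params_comp by (auto simp: params_def fun_eq_iff c''_def split: sum.split)
  have 2: "params c' e = params c'' e \<circ> (sum_encode \<circ> case_sum Inl (\<lambda>k. Inr (sum_encode (Inr k))) \<circ> sum_decode)" for e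
    unfolding params_comp by (auto simp: params_def fun_eq_iff c''_def split: sum.split)
  show ?thesis unfolding D_def p q 1 2 sat_ren[symmetric] by (metis sat.simps(4))
qed

lemma D_all: assumes "D (\<lambda>e. P (\<lambda>i. e (Suc i)) (e 0))" shows "D (\<lambda>e. \<forall>x. P e x)"
proof -
  obtain p c where p: "\<And>e. P (\<lambda>i. e (Suc i)) (e 0) \<longleftrightarrow> sat E (=) (params c e) p"
    using assms unfolding D_def by blast
  \<comment> \<open>Adding the bound variable shifts only the even slots of \<open>params\<close>,
    whereas \<open>Forall\<close> shifts every index; \<open>g\<close> translates between the two
    layouts.\<close>
  define g where "g n = (case sum_decode n of Inl i \<Rightarrow> (case i of 0 \<Rightarrow> 0 | Suc i \<Rightarrow> Suc (sum_encode (Inl i)))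
    | Inr k \<Rightarrow> Suc (sum_encode (Inr k)))" for n
  have "params c (case_nat x e) = case_nat x (params c e) \<circ> g" for x e
    by (auto simp: params_def fun_eq_iff g_def split: sum.split nat.split)
  then have "P e x \<longleftrightarrow> sat E (=) (case_nat x (params c e)) (ren g p)" for e x
    using p[of "case_nat x e"] by (simp add: sat_ren)
  then show ?thesis unfolding D_def by (metis sat.simps(5))
qed

lemma D_not: "D P \<Longrightarrow> D (\<lambda>e. \<not> P e)"
  using D_imp[of P "\<lambda>e. False"] D_const by simp

lemma D_conj: "D P \<Longrightarrow> D Q \<Longrightarrow> D (\<lambda>e. P e \<and> Q e)"
  using D_not[OF D_imp[OF _ D_not]] by simp

lemma D_disj: "D P \<Longrightarrow> D Q \<Longrightarrow> D (\<lambda>e. P e \<or> Q e)"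
  using D_imp[OF D_not] by (simp add: disj_imp)

lemma D_iff: "D P \<Longrightarrow> D Q \<Longrightarrow> D (\<lambda>e. P e \<longleftrightarrow> Q e)"
  using D_conj[OF D_imp[of P Q] D_imp[of Q P]] by (simp add: iff_conv_conj_imp)

lemma D_ex: "D (\<lambda>e. P (\<lambda>i. e (Suc i)) (e 0)) \<Longrightarrow> D (\<lambda>e. \<exists>x. P e x)"
  using D_not[OF D_all[of "\<lambda>e x. \<not> P e x"]] D_not by simp

lemma D_if: "D P \<Longrightarrow> D Q \<Longrightarrow> D R \<Longrightarrow> D (\<lambda>e. if P e then Q e else R e)"
  using D_conj[OF D_imp[of P Q] D_imp[OF D_not, of P R]] by (simp add: if_bool_eq_conj)

lemma D_mem_vars: "D (\<lambda>e. e i mem e j)"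
  unfolding D_def
  by (rule exI[of _ "Member (sum_encode (Inl i)) (sum_encode (Inl j))"]) (simp add: params_def)

lemma D_eq_vars: "D (\<lambda>e. e i = e j)"
  unfolding D_def
  by (rule exI[of _ "Equal (sum_encode (Inl i)) (sum_encode (Inl j))"]) (simp add: params_def)

lemma DF_var: "DF (\<lambda>e. e n)"
  unfolding DF_def by (rule D_eq_vars)

lemma DF_const: "DF (\<lambda>e. c)"
  unfolding DF_def
  using D_rearrange[OF D_eq_vars[of 0 1], where s = "\<lambda>i. if i = 0 then Inl 0 else Inr 0" and c' = "\<lambda>_. c"] by simp

lemma DF_ren: "DF F \<Longrightarrow> DF (\<lambda>e. F (\<lambda>i. e (f i)))"
  unfolding DF_def using D_ren[of _ "case_nat 0 (\<lambda>i. Suc (f i))"] by fastforce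

lemma DF_shift: "DF F \<Longrightarrow> DF (\<lambda>e. F (\<lambda>i. e (Suc i)))"
  by (rule DF_ren)

text \<open>The language has no function symbols, so a definable term is eliminated by quantifying
  over its value.\<close>

lemma D_comp1: assumes "D (\<lambda>e. Q (e 0))" "DF F" shows "D (\<lambda>e. Q (F e))"
proof -
  have "D (\<lambda>e. \<exists>x. x = F e \<and> Q x)"
    by (intro D_ex D_conj assms assms(2)[unfolded DF_def])
  then show ?thesis by simp
qed

lemma D_comp2: assumes "D (\<lambda>e. Q (e 0) (e 1))" "DF F" "DF G" shows "D (\<lambda>e. Q (F e) (G e))"
proof -
  have 1: "D (\<lambda>e. e (Suc 0) = F (\<lambda>i. e (Suc (Suc i))))"
    using D_ren[OF assms(2)[unfolded DF_def], of Suc] by simp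
  \<comment> \<open>Truncated subtraction makes \<open>1 - i\<close> swap the indices
    \<open>0\<close> and \<open>1\<close>, the only ones that \<open>Q\<close> reads.\<close>
  have 2: "D (\<lambda>e. Q (e (Suc 0)) (e 0))"
    using D_ren[OF assms(1), of "\<lambda>i. 1 - i"] by simp
  have "D (\<lambda>e. \<exists>x y. x = F e \<and> y = G e \<and> Q x y)"
    by (intro D_ex D_conj 1 2 DF_shift[OF assms(3), unfolded DF_def])
  then show ?thesis by simp
qed

lemma D_comp3:
  assumes "D (\<lambda>e. Q (e 0) (e 1) (e 2))" "DF F" "DF G" "DF H" shows "D (\<lambda>e. Q (F e) (G e) (H e))"
proof -
  have 1: "D (\<lambda>e. e (Suc 0) = F (\<lambda>i. e (Suc (Suc i))))"
    using D_ren[OF assms(2)[unfolded DF_def], of Suc] by simp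
  have 2: "D (\<lambda>e. Q (e 2) (e 1) (e 0))"
    using D_ren[OF assms(1), of "\<lambda>i. 2 - i"] by simp
  have F: "D (\<lambda>e. e (Suc (Suc 0)) = F (\<lambda>i. e (Suc (Suc (Suc i)))))"
    using D_ren[OF assms(2)[unfolded DF_def], of "\<lambda>i. Suc (Suc i)"] by simp
  have G: "D (\<lambda>e. e (Suc 0) = G (\<lambda>i. e (Suc (Suc (Suc i)))))"
    using D_ren[OF DF_shift[OF assms(3), unfolded DF_def], of Suc] by simp
  have "D (\<lambda>e. \<exists>x y z. x = F e \<and> y = G e \<and> z = H e \<and> Q x y z)"
    by (intro D_ex D_conj F G 2[simplified] DF_shift[OF DF_shift[OF assms(4)], unfolded DF_def])
      (use 2 in \<open>simp add: numeral_2_eq_2\<close>)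
  then show ?thesis by simp
qed

lemma D_mem: "DF F \<Longrightarrow> DF G \<Longrightarrow> D (\<lambda>e. F e mem G e)"
  by (rule D_comp2[where Q = "\<lambda>x y. x mem y", OF D_mem_vars])

lemma D_eq: "DF F \<Longrightarrow> DF G \<Longrightarrow> D (\<lambda>e. F e = G e)"
  by (rule D_comp2[where Q = "\<lambda>x y. x = y", OF D_eq_vars])

lemma DF_comp1: "D (\<lambda>e. e 0 = H (e 1)) \<Longrightarrow> DF F \<Longrightarrow> DF (\<lambda>e. H (F e))"
  unfolding DF_def[of "\<lambda>e. H (F e)"]
  by (rule D_comp2[of "\<lambda>x y. x = H y" "\<lambda>e. e 0" "\<lambda>e. F (\<lambda>i. e (Suc i))"])
    (auto intro: DF_var DF_shift)

lemma DF_comp2: "D (\<lambda>e. e 0 = H (e 1) (e 2)) \<Longrightarrow> DF F \<Longrightarrow> DF G \<Longrightarrow> DF (\<lambda>e. H (F e) (G e))"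
  unfolding DF_def[of "\<lambda>e. H (F e) (G e)"]
  by (rule D_comp3[of "\<lambda>x y z. x = H y z" "\<lambda>e. e 0" "\<lambda>e. F (\<lambda>i. e (Suc i))" "\<lambda>e. G (\<lambda>i. e (Suc i))"])
    (auto intro: DF_var DF_shift)

lemma DF_If: assumes "D P" "DF F" "DF G" shows "DF (\<lambda>e. if P e then F e else G e)"
proof -
  have "D (\<lambda>e. if P (\<lambda>i. e (Suc i)) then e 0 = F (\<lambda>i. e (Suc i)) else e 0 = G (\<lambda>i. e (Suc i)))"
    by (intro D_if D_ren[OF assms(1)] assms(2,3)[unfolded DF_def])
  then show ?thesis unfolding DF_def by (simp add: if_distrib[of "\<lambda>x. _ = x"])
qed

declare D_const [dfn] DF_const [dfn] DF_var [dfn] D_imp [dfn] D_all [dfn] D_not [dfn] D_conj [dfn]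
  D_disj [dfn] D_iff [dfn] D_ex [dfn] D_if [dfn] D_mem [dfn] D_eq [dfn] DF_If [dfn]

end

locale zf = membership E for E :: "'a \<Rightarrow> 'a \<Rightarrow> bool" (infix "mem" 50) +
  assumes ZF: "q \<in> ZF \<Longrightarrow> sat E (=) e q"
begin

lemma ZF_lsat: "\<phi> 0 \<in> ZF \<Longrightarrow> lsat 0 l \<phi>"
  using ZF by (simp add: lsat_def)

lemma ext: assumes "\<And>z. z mem x \<longleftrightarrow> z mem y" shows "x = y"
  using ZF_lsat[of extensionality_ax] assms
  by (simp add: ZF_def vocabulary_defs lsat_simps)

lemma foundation: assumes "z mem x" shows "\<exists>y. y mem x \<and> (\<forall>z. z mem x \<longrightarrow> \<not> z mem y)"
  using ZF_lsat[of foundation_ax] assms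
  by (simp add: ZF_def vocabulary_defs lsat_simps) blast

lemma upair_ex: "\<exists>p. \<forall>z. z mem p \<longleftrightarrow> z = x \<or> z = y"
  using ZF_lsat[of pairing_ax]
  by (simp add: ZF_def vocabulary_defs lsat_simps)

lemma union_ex: "\<exists>u. \<forall>z. z mem u \<longleftrightarrow> (\<exists>v. v mem s \<and> z mem v)"
  using ZF_lsat[of union_ax]
  by (simp add: ZF_def vocabulary_defs lsat_simps)

lemma power_ex: "\<exists>b. \<forall>z. z mem b \<longleftrightarrow> (\<forall>y. y mem z \<longrightarrow> y mem a)"
  using ZF_lsat[of power_set_ax]
  by (simp add: ZF_def vocabulary_defs lsat_simps)

lemma infinity_ex: "\<exists>a. (\<exists>e. (\<forall>z. \<not> z mem e) \<and> e mem a) \<and>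
    (\<forall>x. x mem a \<longrightarrow> (\<exists>s. (\<forall>z. z mem s \<longleftrightarrow> z mem x \<or> z = x) \<and> s mem a))"
  using ZF_lsat[of infinity_ax]
  by (simp add: ZF_def vocabulary_defs lsat_simps)

text \<open>The formula for \<open>P\<close> reads its variable at the slot of \<open>Inl 0\<close>,
  in the midst of the parameters, while the schema expects it at index \<open>k\<close>, after them.
  The bound \<open>k\<close> on the free variables makes this position fresh.\<close>

lemma separation_ex:
  assumes "D (\<lambda>e. P (e 0))" shows "\<exists>b. \<forall>x. x mem b \<longleftrightarrow> x mem a \<and> P x"
proof -
  obtain p c where p: "\<And>e. P (e 0) \<longleftrightarrow> sat E (=) (params c e) p" using assms unfolding D_def by blast
  obtain k where k: "closed_at k p" using closed_at_ex by blast
  define f where "f i = (if sum_decode i = Inl 0 then k else i)" for i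
  define q where "q = ren f p"
  have q: "closed_at (k + 1) q"
    unfolding q_def by (rule closed_at_ren[OF k]) (auto simp: f_def)
  define l where "l = params c (\<lambda>_. a)"
  have "separation_ax k q \<in> ZF" using q by (auto simp: ZF_def)
  then have "sat E (=) (env 0 l) (separation_ax k q)" by (rule ZF)
  then have "lsat k l (\<^bold>\<forall>a. \<^bold>\<exists>b. \<^bold>\<forall>x. x \<^bold>\<in> b \<^bold>\<longleftrightarrow> x \<^bold>\<in> a \<^bold>\<and> q\<lbrakk>[0..<k] @ [x]\<rbrakk>)"
    unfolding separation_ax_def lsat_def using sat_Forall_power[of E "(=)" 0 l k _ l] by simp
  then have 1: "\<exists>b. \<forall>x. x mem b \<longleftrightarrow> x mem a \<and>
      lsat (k + 3) (l(k := a, k + 1 := b, k + 2 := x)) (q\<lbrakk>[0..<k] @ [k + 2]\<rbrakk>)" for a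
    by (simp add: lsat_simps numeral_3_eq_3)
  have 2: "lsat (k + 3) (l(k := a, k + 1 := b, k + 2 := x)) (q\<lbrakk>[0..<k] @ [k + 2]\<rbrakk>) \<longleftrightarrow> P x" for a b x
  proof -
    have "lsat (k + 3) (l(k := a, k + 1 := b, k + 2 := x)) (q\<lbrakk>[0..<k] @ [k + 2]\<rbrakk>) \<longleftrightarrow>
        sat E (=) (l(k := x)) q"
      by (rule lsat_at_vars) (use q in \<open>auto simp: nth_append\<close>)
    also have "\<dots> \<longleftrightarrow> sat E (=) (params c (\<lambda>i. if i = 0 then x else l (sum_encode (Inl i)))) p"
      unfolding q_def sat_ren
      by (rule sat_cong[OF k]) (auto simp: f_def l_def params_def split: sum.split)
    also have "\<dots> \<longleftrightarrow> P x" by (simp flip: p)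
    finally show ?thesis .
  qed
  show ?thesis using 1[of a] unfolding 2 .
qed

text \<open>As for separation, with argument and value moved to the fresh positions \<open>k\<close>
  and \<open>k + 1\<close>.\<close>

lemma replacement_ex:
  assumes "D (\<lambda>e. e 1 = F (e 0))" shows "\<exists>b. \<forall>y. y mem b \<longleftrightarrow> (\<exists>x. x mem a \<and> y = F x)"
proof -
  obtain p c where p: "\<And>e. e 1 = F (e 0) \<longleftrightarrow> sat E (=) (params c e) p" using assms unfolding D_def by blast
  obtain k where k: "closed_at k p" using closed_at_ex by blast
  define f where "f i = (if sum_decode i = Inl 0 then k else if sum_decode i = Inl 1 then k + 1 else i)" for i
  define q where "q = ren f p"
  have q: "closed_at (k + 2) q"
    unfolding q_def by (rule closed_at_ren[OF k]) (auto simp: f_def)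
  define l where "l = params c (\<lambda>_. a)"
  have 2: "sat E (=) (l(k := x, k + 1 := y)) q \<longleftrightarrow> y = F x" for x y
  proof -
    have "sat E (=) (l(k := x, k + 1 := y)) q \<longleftrightarrow>
        sat E (=) (params c (\<lambda>i. if i = 0 then x else if i = 1 then y else l (sum_encode (Inl i)))) p"
      unfolding q_def sat_ren
      by (rule sat_cong[OF k]) (auto simp: f_def l_def params_def split: sum.split)
    also have "\<dots> \<longleftrightarrow> y = F x" by (simp flip: p)
    finally show ?thesis .
  qed
  have 3: "lsat d l' (q\<lbrakk>[0..<k] @ [x, y]\<rbrakk>) \<longleftrightarrow> l' y = F (l' x)"
    if "k \<le> d" "x < d" "y < d" "\<And>i. i < k \<Longrightarrow> l' i = l i" for d l' x y
    unfolding 2[symmetric]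
    by (rule lsat_at_vars) (use q that in \<open>auto simp: nth_append nth_Cons split: nat.split\<close>)
  have "replacement_ax k q \<in> ZF" using q by (auto simp: ZF_def)
  then have "sat E (=) (env 0 l) (replacement_ax k q)" by (rule ZF)
  then have "lsat k l (\<^bold>\<forall>a. (\<^bold>\<forall>x y z. x \<^bold>\<in> a \<^bold>\<and> q\<lbrakk>[0..<k] @ [x, y]\<rbrakk> \<^bold>\<and> q\<lbrakk>[0..<k] @ [x, z]\<rbrakk> \<^bold>\<longrightarrow> y \<^bold>= z) \<^bold>\<longrightarrow>
        (\<^bold>\<exists>b. \<^bold>\<forall>y. y \<^bold>\<in> b \<^bold>\<longleftrightarrow> (\<^bold>\<exists>x. x \<^bold>\<in> a \<^bold>\<and> q\<lbrakk>[0..<k] @ [x, y]\<rbrakk>)))"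
    unfolding replacement_ax_def lsat_def using sat_Forall_power[of E "(=)" 0 l k _ l] by simp
  then show ?thesis by (simp add: lsat_simps 3)
qed

section \<open>Set theory inside a model\<close>

text \<open>A definite description justified by extensionality, not a choice; it has its intended
  meaning only once existence is derived from an axiom.\<close>

definition coll :: "('a \<Rightarrow> bool) \<Rightarrow> 'a" where "coll P = (THE b. \<forall>x. x mem b \<longleftrightarrow> P x)"

lemma coll: assumes "\<exists>b. \<forall>x. x mem b \<longleftrightarrow> P x" shows "x mem coll P \<longleftrightarrow> P x"
proof -
  obtain b where b: "\<forall>x. x mem b \<longleftrightarrow> P x" using assms ..
  have "\<forall>x. x mem coll P \<longleftrightarrow> P x"
    unfolding coll_def
  proof (rule theI[where P = "\<lambda>b. \<forall>x. x mem b \<longleftrightarrow> P x"])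
    show "\<forall>x. x mem b \<longleftrightarrow> P x" by (rule b)
    fix c assume "\<forall>x. x mem c \<longleftrightarrow> P x"
    then show "c = b" using b by (intro ext) simp
  qed
  then show ?thesis ..
qed

lemma eq_iff_mem: "x = y \<longleftrightarrow> (\<forall>z. z mem x \<longleftrightarrow> z mem y)"
  using ext by blast

definition sub :: "'a \<Rightarrow> 'a \<Rightarrow> bool" where "sub x y \<longleftrightarrow> (\<forall>z. z mem x \<longrightarrow> z mem y)"
definition eset :: 'a where "eset = coll (\<lambda>z. False)"
definition upair :: "'a \<Rightarrow> 'a \<Rightarrow> 'a" where "upair x y = coll (\<lambda>z. z = x \<or> z = y)"
definition Uni :: "'a \<Rightarrow> 'a" where "Uni s = coll (\<lambda>z. \<exists>v. v mem s \<and> z mem v)"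
definition Pw :: "'a \<Rightarrow> 'a" where "Pw a = coll (\<lambda>z. sub z a)"
definition Sep :: "'a \<Rightarrow> ('a \<Rightarrow> bool) \<Rightarrow> 'a" where "Sep a P = coll (\<lambda>z. z mem a \<and> P z)"
definition Rep :: "'a \<Rightarrow> ('a \<Rightarrow> 'a) \<Rightarrow> 'a" where "Rep a F = coll (\<lambda>y. \<exists>x. x mem a \<and> y = F x)"
definition pair :: "'a \<Rightarrow> 'a \<Rightarrow> 'a" where "pair x y = upair (upair x x) (upair x y)"
definition cup :: "'a \<Rightarrow> 'a \<Rightarrow> 'a" where "cup x y = Uni (upair x y)"
definition cap :: "'a \<Rightarrow> 'a \<Rightarrow> 'a" where "cap x y = Sep x (\<lambda>z. z mem y)"
definition dif :: "'a \<Rightarrow> 'a \<Rightarrow> 'a" where "dif x y = Sep x (\<lambda>z. \<not> z mem y)"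
definition cart :: "'a \<Rightarrow> 'a \<Rightarrow> 'a" where "cart a b = Uni (Rep a (\<lambda>x. Rep b (\<lambda>y. pair x y)))"
definition suc :: "'a \<Rightarrow> 'a" where "suc x = cup x (upair x x)"
text \<open>For a function \<open>f\<close> defined at \<open>x\<close>, the \<open>y\<close> with
  \<open>pair x y mem f\<close> form a singleton whose union is the value. Expressed by
  \<open>Sep\<close> and \<open>Uni\<close>, application is definable. The bound
  \<open>Uni (Uni f)\<close> contains the components of all Kuratowski pairs in
  \<open>f\<close>.\<close>

definition app :: "'a \<Rightarrow> 'a \<Rightarrow> 'a" where "app f x = Uni (Sep (Uni (Uni f)) (\<lambda>y. pair x y mem f))"
definition lam :: "'a \<Rightarrow> ('a \<Rightarrow> 'a) \<Rightarrow> 'a" where "lam a F = Rep a (\<lambda>x. pair x (F x))"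

lemma D_sub [dfn]: "DF F \<Longrightarrow> DF G \<Longrightarrow> D (\<lambda>e. sub (F e) (G e))"
  by (rule D_comp2[of sub]) (unfold sub_def, intro dfn)

lemma mem_eset [simp]: "\<not> z mem eset"
proof -
  have "\<exists>b. \<forall>z. \<not> z mem b" using infinity_ex by blast
  then show ?thesis using coll[of "\<lambda>z. False" z] unfolding eset_def by simp
qed

lemma mem_upair [simp]: "z mem upair x y \<longleftrightarrow> z = x \<or> z = y"
  unfolding upair_def by (rule coll[OF upair_ex])

lemma mem_Uni [simp]: "z mem Uni s \<longleftrightarrow> (\<exists>v. v mem s \<and> z mem v)"
  unfolding Uni_def by (rule coll[OF union_ex])

lemma mem_Pw [simp]: "z mem Pw a \<longleftrightarrow> sub z a"
  unfolding Pw_def sub_def by (rule coll[OF power_ex])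

lemma mem_Sep: "D (\<lambda>e. P (e 0)) \<Longrightarrow> z mem Sep a P \<longleftrightarrow> z mem a \<and> P z"
  unfolding Sep_def by (rule coll[OF separation_ex])

lemma mem_Rep: assumes "DF (\<lambda>e. F (e 0))" shows "y mem Rep a F \<longleftrightarrow> (\<exists>x. x mem a \<and> y = F x)"
proof -
  have "D (\<lambda>e. e 1 = F (e 0))"
    using D_ren[OF assms[unfolded DF_def], of "\<lambda>i. 1 - i"] by simp
  then show ?thesis unfolding Rep_def by (rule coll[OF replacement_ex])
qed

lemma DF_subst1: "DF (\<lambda>e. H (e 0)) \<Longrightarrow> DF F \<Longrightarrow> DF (\<lambda>e. H (F e))"
  by (rule DF_comp1[of H]) (simp_all add: DF_def[of "\<lambda>e. H (e 0)"])

lemma DF_upair [dfn]: "DF F \<Longrightarrow> DF G \<Longrightarrow> DF (\<lambda>e. upair (F e) (G e))"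
  by (rule DF_comp2) (unfold eq_iff_mem[of _ "upair _ _"] mem_upair, intro dfn)

lemma DF_Uni [dfn]: "DF F \<Longrightarrow> DF (\<lambda>e. Uni (F e))"
  by (rule DF_comp1) (unfold eq_iff_mem[of _ "Uni _"] mem_Uni, intro dfn)

lemma DF_Pw [dfn]: "DF F \<Longrightarrow> DF (\<lambda>e. Pw (F e))"
  by (rule DF_comp1) (unfold eq_iff_mem[of _ "Pw _"] mem_Pw, intro dfn)

lemma D_first: "D (\<lambda>e. P (\<lambda>i. e (Suc i)) (e 0)) \<Longrightarrow> D (\<lambda>e. P c (e 0))"
  using D_rearrange[where s = "case_nat (Inl 0) Inr" and c' = c] by fastforce

text \<open>\<open>Sep\<close> binds a variable, so the premise speaks of the body with the bound
  variable at index \<open>0\<close>. The rule \<open>mem_Sep\<close> covers predicates of one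
  variable; \<open>D_first\<close> provides them by freezing the rest of the environment as
  parameters.\<close>

lemma DF_Sep [dfn]:
  assumes "DF A" "D (\<lambda>e. P (\<lambda>i. e (Suc i)) (e 0))" shows "DF (\<lambda>e. Sep (A e) (P e))"
proof -
  have "D (\<lambda>e. P (\<lambda>i. e (Suc (Suc i))) (e 0))"
    using D_ren[OF assms(2), of "case_nat 0 (\<lambda>i. Suc (Suc i))"] by simp
  then show ?thesis
    unfolding DF_def eq_iff_mem[of _ "Sep _ _"] mem_Sep[OF D_first[OF assms(2)]]
    by (intro dfn DF_shift[OF DF_shift[OF assms(1)]])
qed

lemma DF_Rep [dfn]:
  assumes "DF A" "DF (\<lambda>e. F (\<lambda>i. e (Suc i)) (e 0))" shows "DF (\<lambda>e. Rep (A e) (F e))"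
proof -
  have 0: "DF (\<lambda>e. F c (e 0))" for c
  proof -
    have "D (\<lambda>e. e 0 = F (\<lambda>i. e (Suc (Suc i))) (e 1))" using assms(2) by (simp add: DF_def)
    then have "D (\<lambda>e. e 0 = F c (e 1))"
      using D_rearrange[where s = "case_nat (Inl 0) (case_nat (Inl 1) Inr)" and c' = c
          and P = "\<lambda>e. e 0 = F (\<lambda>i. e (Suc (Suc i))) (e 1)"] by simp
    then show ?thesis by (simp add: DF_def)
  qed
  have "DF (\<lambda>e. F (\<lambda>i. e (Suc (Suc (Suc i)))) (e 0))"
    using DF_ren[OF assms(2), of "case_nat 0 (\<lambda>i. Suc (Suc (Suc i)))"] by simp
  then show ?thesis
    unfolding DF_def[of "\<lambda>e. Rep (A e) (F e)"] eq_iff_mem[of _ "Rep _ _"] mem_Rep[OF 0]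
    by (intro dfn DF_shift[OF DF_shift[OF DF_shift[OF assms(1)]]])
qed

lemma DF_pair [dfn]: "DF F \<Longrightarrow> DF G \<Longrightarrow> DF (\<lambda>e. pair (F e) (G e))"
  unfolding pair_def by (intro dfn)

lemma DF_cup [dfn]: "DF F \<Longrightarrow> DF G \<Longrightarrow> DF (\<lambda>e. cup (F e) (G e))"
  unfolding cup_def by (intro dfn)

lemma DF_dif [dfn]: "DF F \<Longrightarrow> DF G \<Longrightarrow> DF (\<lambda>e. dif (F e) (G e))"
  by (rule DF_comp2) (unfold dif_def, intro dfn)

lemma DF_cart [dfn]: "DF F \<Longrightarrow> DF G \<Longrightarrow> DF (\<lambda>e. cart (F e) (G e))"
  by (rule DF_comp2) (unfold cart_def, intro dfn)

lemma DF_suc [dfn]: "DF F \<Longrightarrow> DF (\<lambda>e. suc (F e))"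
  unfolding suc_def by (intro dfn)

lemma DF_app [dfn]: "DF F \<Longrightarrow> DF G \<Longrightarrow> DF (\<lambda>e. app (F e) (G e))"
  by (rule DF_comp2) (unfold app_def, intro dfn)

lemma mem_cup [simp]: "z mem cup x y \<longleftrightarrow> z mem x \<or> z mem y"
  unfolding cup_def by auto

lemma mem_cap [simp]: "z mem cap x y \<longleftrightarrow> z mem x \<and> z mem y"
  unfolding cap_def by (rule mem_Sep) (intro dfn)

lemma mem_dif [simp]: "z mem dif x y \<longleftrightarrow> z mem x \<and> \<not> z mem y"
  unfolding dif_def by (rule mem_Sep) (intro dfn)

lemma mem_suc [simp]: "z mem suc x \<longleftrightarrow> z mem x \<or> z = x"
  unfolding suc_def by auto

lemma upair_eq_iff: "upair x y = upair u v \<longleftrightarrow> (x = u \<and> y = v) \<or> (x = v \<and> y = u)"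
proof
  assume "upair x y = upair u v"
  then have z: "z = x \<or> z = y \<longleftrightarrow> z = u \<or> z = v" for z
    using mem_upair[of z x y] mem_upair[of z u v] by simp
  show "(x = u \<and> y = v) \<or> (x = v \<and> y = u)" using z[of x] z[of y] z[of u] z[of v] by auto
next
  assume "(x = u \<and> y = v) \<or> (x = v \<and> y = u)"
  then show "upair x y = upair u v" by (intro ext) auto
qed

lemma pair_eq_iff [simp]: "pair x y = pair u v \<longleftrightarrow> x = u \<and> y = v"
  unfolding pair_def upair_eq_iff by auto

lemma mem_cart: "p mem cart a b \<longleftrightarrow> (\<exists>x y. x mem a \<and> y mem b \<and> p = pair x y)"
proof -
  have 1: "\<And>v. v mem Rep a (\<lambda>x. Rep b (\<lambda>y. pair x y)) \<longleftrightarrow> (\<exists>x. x mem a \<and> v = Rep b (\<lambda>y. pair x y))"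
    by (rule mem_Rep) (intro dfn)
  have 2: "\<And>x p. p mem Rep b (\<lambda>y. pair x y) \<longleftrightarrow> (\<exists>y. y mem b \<and> p = pair x y)"
    by (rule mem_Rep) (intro dfn)
  show ?thesis unfolding cart_def mem_Uni 1 by (auto simp: 2)
qed

lemma pair_mem_cart [simp]: "pair x y mem cart a b \<longleftrightarrow> x mem a \<and> y mem b"
  by (auto simp: mem_cart)

lemma pair_ne_eset: "pair x y \<noteq> eset"
proof
  assume "pair x y = eset"
  then show False using mem_upair[of "upair x x" "upair x x" "upair x y"] by (simp add: pair_def)
qed

lemma mem_irrefl [simp]: "\<not> x mem x"
  using foundation[of x "upair x x"] by auto

lemma mem_asym: "x mem y \<Longrightarrow> \<not> y mem x"
  using foundation[of x "upair x y"] by auto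

lemma sub_refl [simp]: "sub x x"
  by (simp add: sub_def)

subsection \<open>Functions\<close>

definition fun_on :: "'a \<Rightarrow> 'a \<Rightarrow> bool" where
  "fun_on f a \<longleftrightarrow> (\<forall>p. p mem f \<longrightarrow> (\<exists>x y. x mem a \<and> p = pair x y)) \<and>
    (\<forall>x. x mem a \<longrightarrow> (\<exists>y. pair x y mem f)) \<and> (\<forall>x y z. pair x y mem f \<and> pair x z mem f \<longrightarrow> y = z)"

lemma D_fun_on [dfn]: "DF F \<Longrightarrow> DF G \<Longrightarrow> D (\<lambda>e. fun_on (F e) (G e))"
  by (rule D_comp2[of fun_on]) (unfold fun_on_def, intro dfn)

lemma fun_on_unique: "fun_on f a \<Longrightarrow> pair x y mem f \<Longrightarrow> pair x z mem f \<Longrightarrow> y = z"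
  unfolding fun_on_def by simp

lemma fun_on_ex: "fun_on f a \<Longrightarrow> x mem a \<Longrightarrow> \<exists>y. pair x y mem f"
  unfolding fun_on_def by simp

lemma fun_on_pair: "fun_on f a \<Longrightarrow> p mem f \<Longrightarrow> \<exists>x y. x mem a \<and> p = pair x y"
  unfolding fun_on_def by simp

lemma app_eq: assumes "fun_on f a" "pair x y mem f" shows "app f x = y"
proof -
  have 1: "\<And>z. z mem Sep (Uni (Uni f)) (\<lambda>y. pair x y mem f) \<longleftrightarrow> z mem Uni (Uni f) \<and> pair x z mem f"
    by (rule mem_Sep) (intro dfn)
  have "y mem Uni (Uni f)"
    unfolding mem_Uni using assms(2)
    by (intro exI[of _ "upair x y"] conjI exI[of _ "pair x y"]) (auto simp: pair_def)
  then have "\<And>z. z mem Sep (Uni (Uni f)) (\<lambda>y. pair x y mem f) \<longleftrightarrow> z = y"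
    unfolding 1 using fun_on_unique[OF assms(1,2)] assms(2) by blast
  then show ?thesis unfolding app_def by (intro ext) simp
qed

lemma pair_mem_fun: assumes "fun_on f a" shows "pair x y mem f \<longleftrightarrow> x mem a \<and> y = app f x"
proof
  assume "pair x y mem f"
  then show "x mem a \<and> y = app f x" using app_eq[OF assms] fun_on_pair[OF assms] by force
next
  assume "x mem a \<and> y = app f x"
  moreover then obtain z where "pair x z mem f" using fun_on_ex[OF assms] by blast
  ultimately show "pair x y mem f" using app_eq[OF assms] by simp
qed

lemma mem_fun: assumes "fun_on f a" shows "p mem f \<longleftrightarrow> (\<exists>x. x mem a \<and> p = pair x (app f x))"
proof
  assume "p mem f"
  then show "\<exists>x. x mem a \<and> p = pair x (app f x)"
    using fun_on_pair[OF assms, of p] pair_mem_fun[OF assms] by auto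
qed (use pair_mem_fun[OF assms] in auto)

lemma fun_ext:
  assumes "fun_on f a" "fun_on g a" "\<And>x. x mem a \<Longrightarrow> app f x = app g x" shows "f = g"
  by (rule ext) (use assms in \<open>auto simp: mem_fun\<close>)

lemma mem_lam: "DF (\<lambda>e. F (e 0)) \<Longrightarrow> p mem lam a F \<longleftrightarrow> (\<exists>x. x mem a \<and> p = pair x (F x))"
  unfolding lam_def by (rule mem_Rep) (intro dfn)

lemma fun_on_lam: "DF (\<lambda>e. F (e 0)) \<Longrightarrow> fun_on (lam a F) a"
  unfolding fun_on_def by (auto simp: mem_lam)

lemma app_lam: "DF (\<lambda>e. F (e 0)) \<Longrightarrow> x mem a \<Longrightarrow> app (lam a F) x = F x"
  by (rule app_eq[OF fun_on_lam]) (auto simp: mem_lam)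

definition bij :: "'a \<Rightarrow> 'a \<Rightarrow> 'a \<Rightarrow> bool" where
  "bij f a b \<longleftrightarrow> fun_on f a \<and> (\<forall>x. x mem a \<longrightarrow> app f x mem b) \<and>
    (\<forall>x y. x mem a \<longrightarrow> y mem a \<longrightarrow> app f x = app f y \<longrightarrow> x = y) \<and>
    (\<forall>y. y mem b \<longrightarrow> (\<exists>x. x mem a \<and> app f x = y))"

definition eqp :: "'a \<Rightarrow> 'a \<Rightarrow> bool" where "eqp a b \<longleftrightarrow> (\<exists>f. bij f a b)"

lemma D_bij [dfn]: "DF F \<Longrightarrow> DF G \<Longrightarrow> DF H \<Longrightarrow> D (\<lambda>e. bij (F e) (G e) (H e))"
  by (rule D_comp3[of bij]) (unfold bij_def, intro dfn)

lemma D_eqp [dfn]: "DF F \<Longrightarrow> DF G \<Longrightarrow> D (\<lambda>e. eqp (F e) (G e))"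
  by (rule D_comp2[of eqp]) (unfold eqp_def, intro dfn)

text \<open>Definability makes the HOL function \<open>F\<close>, restricted to \<open>a\<close>, a
  set of the model.\<close>

lemma eqpI:
  assumes "DF (\<lambda>e. F (e 0))" "\<And>x. x mem a \<Longrightarrow> F x mem b"
    and "\<And>x y. x mem a \<Longrightarrow> y mem a \<Longrightarrow> F x = F y \<Longrightarrow> x = y"
    and "\<And>y. y mem b \<Longrightarrow> \<exists>x. x mem a \<and> F x = y"
  shows "eqp a b"
  unfolding eqp_def bij_def
  by (rule exI[of _ "lam a F"]) (use assms in \<open>auto simp: fun_on_lam app_lam cong: conj_cong\<close>)

subsection \<open>The natural numbers\<close>

definition indset :: "'a \<Rightarrow> bool" where
  "indset a \<longleftrightarrow> eset mem a \<and> (\<forall>x. x mem a \<longrightarrow> suc x mem a)"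

definition omega :: 'a where
  "omega = coll (\<lambda>x. \<forall>a. indset a \<longrightarrow> x mem a)"

lemma D_indset [dfn]: "DF F \<Longrightarrow> D (\<lambda>e. indset (F e))"
  by (rule D_comp1[of indset]) (unfold indset_def, intro dfn)

lemma eset_iff: "(\<forall>z. \<not> z mem x) \<longleftrightarrow> x = eset"
  by (auto intro: ext)

lemma suc_iff: "(\<forall>z. z mem s \<longleftrightarrow> z mem x \<or> z = x) \<longleftrightarrow> s = suc x"
  by (auto intro: ext)

lemma mem_omega: "x mem omega \<longleftrightarrow> (\<forall>a. indset a \<longrightarrow> x mem a)"
proof -
  obtain a where a: "indset a"
    using infinity_ex unfolding indset_def eset_iff suc_iff by auto
  have "\<exists>b. \<forall>x. x mem b \<longleftrightarrow> x mem a \<and> (\<forall>a. indset a \<longrightarrow> x mem a)"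
    by (rule separation_ex) (intro dfn)
  then have "\<exists>b. \<forall>x. x mem b \<longleftrightarrow> (\<forall>a. indset a \<longrightarrow> x mem a)" using a by blast
  then show ?thesis unfolding omega_def by (rule coll)
qed

lemma omega_0 [simp]: "eset mem omega" and omega_suc [simp]: "x mem omega \<Longrightarrow> suc x mem omega"
  unfolding mem_omega by (auto simp: indset_def)

text \<open>Separation turns a definable predicate into an inductive subset of \<open>omega\<close>.
  Without definability the principle may fail, since \<open>omega\<close> may contain nonstandard
  elements.\<close>

lemma omega_induct:
  assumes "n mem omega" "D (\<lambda>e. P (e 0))" "P eset" "\<And>n. n mem omega \<Longrightarrow> P n \<Longrightarrow> P (suc n)"
  shows "P n"
proof -
  have "indset (Sep omega P)"
    unfolding indset_def mem_Sep[OF assms(2)] using assms(3,4) by simp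
  then have "n mem Sep omega P" using assms(1) mem_omega[of n] by blast
  then show ?thesis using mem_Sep[OF assms(2)] by blast
qed

lemma omega_mem: assumes "n mem omega" "x mem n" shows "x mem omega"
proof -
  have "\<forall>x. x mem n \<longrightarrow> x mem omega"
    by (rule omega_induct[OF assms(1)], intro dfn) auto
  then show ?thesis using assms(2) by blast
qed

lemma omega_trans: assumes "n mem omega" "x mem n" "y mem x" shows "y mem n"
proof -
  have "\<forall>x y. x mem n \<and> y mem x \<longrightarrow> y mem n"
    by (rule omega_induct[OF assms(1)], intro dfn) auto
  then show ?thesis using assms(2,3) by blast
qed

lemma eset_le: assumes "n mem omega" shows "eset = n \<or> eset mem n"
  by (rule omega_induct[OF assms], intro dfn) auto

lemma suc_le: assumes "n mem omega" "m mem n" shows "suc m = n \<or> suc m mem n"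
proof -
  have "\<forall>m. m mem n \<longrightarrow> suc m = n \<or> suc m mem n"
    by (rule omega_induct[OF assms(1)], intro dfn) auto
  then show ?thesis using assms(2) by blast
qed

lemma omega_linear: assumes "m mem omega" "n mem omega" shows "m mem n \<or> m = n \<or> n mem m"
proof -
  have "\<forall>n. n mem omega \<longrightarrow> m mem n \<or> m = n \<or> n mem m"
  proof (rule omega_induct[OF assms(1)], intro dfn)
    show "\<forall>n. n mem omega \<longrightarrow> eset mem n \<or> eset = n \<or> n mem eset" using eset_le by blast
  next
    fix m assume "m mem omega" "\<forall>n. n mem omega \<longrightarrow> m mem n \<or> m = n \<or> n mem m"
    then show "\<forall>n. n mem omega \<longrightarrow> suc m mem n \<or> suc m = n \<or> n mem suc m"
      using suc_le by (metis mem_suc)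
  qed
  then show ?thesis using assms(2) by blast
qed

lemma suc_inject: "suc m = suc n \<Longrightarrow> m = n"
  using mem_suc[of m m] mem_suc[of n n] mem_suc[of m n] mem_suc[of n m] mem_asym by metis

lemma suc_ne_eset: "suc n \<noteq> eset"
  using mem_suc mem_eset by metis

text \<open>The union of the singleton of least elements: a definable substitute for choosing an
  index.\<close>

definition lst :: "'a \<Rightarrow> 'a" where
  "lst N = Uni (Sep N (\<lambda>n. \<forall>m. m mem N \<longrightarrow> n = m \<or> n mem m))"

lemma DF_lst [dfn]: "DF F \<Longrightarrow> DF (\<lambda>e. lst (F e))"
  by (rule DF_comp1) (unfold lst_def, intro dfn)

lemma lst:
  assumes "sub N omega" "z mem N"
  shows lst_mem: "lst N mem N" and lst_le: "m mem N \<Longrightarrow> lst N = m \<or> lst N mem m"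
proof -
  obtain y where y: "y mem N" "\<And>z. z mem N \<Longrightarrow> \<not> z mem y" using foundation[OF assms(2)] by blast
  then have le: "y = m \<or> y mem m" if "m mem N" for m
    using omega_linear[of y m] assms(1) that unfolding sub_def by blast
  have S: "\<And>n. n mem Sep N (\<lambda>n. \<forall>m. m mem N \<longrightarrow> n = m \<or> n mem m) \<longleftrightarrow>
      n mem N \<and> (\<forall>m. m mem N \<longrightarrow> n = m \<or> n mem m)"
    by (rule mem_Sep) (intro dfn)
  have "n mem Sep N (\<lambda>n. \<forall>m. m mem N \<longrightarrow> n = m \<or> n mem m) \<longleftrightarrow> n = y" for n
    unfolding S using y le by blast
  then have "lst N = y" unfolding lst_def by (intro ext) simp
  then show "lst N mem N" "m mem N \<Longrightarrow> lst N = m \<or> lst N mem m"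
    using y(1) le[of m] by simp_all
qed

text \<open>The graph is the least relation \<open>G\<close> that contains the initial pair and is
  closed under the step. It is functional by minimality: deleting a second value at some argument
  would leave a smaller closed relation.\<close>

lemma recursion:
  assumes m: "DF (\<lambda>e. m (e 0))" "\<And>x. x mem a \<Longrightarrow> m x mem a" and x0: "x0 mem a"
  shows "\<exists>c. fun_on c omega \<and> app c eset = x0 \<and>
    (\<forall>n. n mem omega \<longrightarrow> app c n mem a \<and> app c (suc n) = m (app c n))"
proof -
  define closed where "closed R \<longleftrightarrow> pair eset x0 mem R \<and>
    (\<forall>n x. n mem omega \<longrightarrow> x mem a \<longrightarrow> pair n x mem R \<longrightarrow> pair (suc n) (m x) mem R)" for R
  have m': "DF F \<Longrightarrow> DF (\<lambda>e. m (F e))" for F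
    by (rule DF_subst1[OF m(1)])
  have D_closed: "DF F \<Longrightarrow> D (\<lambda>e. closed (F e))" for F
    by (rule D_comp1[of closed]) (unfold closed_def, intro dfn m')
  define G where "G = Sep (cart omega a) (\<lambda>p. \<forall>R. closed R \<longrightarrow> p mem R)"
  have G: "\<And>p. p mem G \<longleftrightarrow> p mem cart omega a \<and> (\<forall>R. closed R \<longrightarrow> p mem R)"
    unfolding G_def by (rule mem_Sep) (intro dfn D_closed)
  have G_least: "p mem G \<Longrightarrow> closed R \<Longrightarrow> p mem R" for p R unfolding G by blast
  have "closed G"
    using m(2) x0 unfolding closed_def G by auto
  then have G0: "pair eset x0 mem G"
    and Gs: "\<And>n x. n mem omega \<Longrightarrow> x mem a \<Longrightarrow> pair n x mem G \<Longrightarrow> pair (suc n) (m x) mem G"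
    unfolding closed_def by blast+
  have dom: "pair n x mem G \<Longrightarrow> n mem omega \<and> x mem a" for n x unfolding G by simp
  have ex1: "\<exists>x. \<forall>y. pair n y mem G \<longleftrightarrow> y = x" if "n mem omega" for n
  proof (rule omega_induct[OF that], intro dfn)
    have "x = x0" if "pair eset x mem G" for x
    proof (rule ccontr)
      assume "x \<noteq> x0"
      then have "closed (dif G (upair (pair eset x) (pair eset x)))"
        using G0 Gs unfolding closed_def by (auto simp: suc_ne_eset)
      then show False using G_least[OF that] by fastforce
    qed
    then show "\<exists>x. \<forall>y. pair eset y mem G \<longleftrightarrow> y = x" using G0 by blast
  next
    fix n assume n: "n mem omega" "\<exists>x. \<forall>y. pair n y mem G \<longleftrightarrow> y = x"
    then obtain x where x: "\<And>y. pair n y mem G \<longleftrightarrow> y = x" by blast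
    have mx: "pair (suc n) (m x) mem G" using Gs n x dom by blast
    have "y = m x" if "pair (suc n) y mem G" for y
    proof (rule ccontr)
      assume "y \<noteq> m x"
      then have "closed (dif G (upair (pair (suc n) y) (pair (suc n) y)))"
        using G0 Gs x unfolding closed_def by (auto simp: suc_ne_eset[symmetric] dest!: suc_inject)
      then show False using G_least[OF that] by fastforce
    qed
    then show "\<exists>x. \<forall>y. pair (suc n) y mem G \<longleftrightarrow> y = x" using mx by blast
  qed
  have funG: "fun_on G omega"
    unfolding fun_on_def
  proof (intro conjI allI impI)
    fix p assume "p mem G"
    then show "\<exists>x y. x mem omega \<and> p = pair x y" unfolding G mem_cart by blast
  next
    fix x assume "x mem omega"
    then show "\<exists>y. pair x y mem G" using ex1 by blast
  next
    fix x y z assume *: "pair x y mem G \<and> pair x z mem G"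
    then obtain u where "\<And>y. pair x y mem G \<longleftrightarrow> y = u" using ex1[of x] dom[of x y] by auto
    then show "y = z" using * by simp
  qed
  have "app G (suc n) = m (app G n) \<and> app G n mem a" if "n mem omega" for n
  proof -
    have *: "pair n (app G n) mem G" using pair_mem_fun[OF funG] that by simp
    then have "app G n mem a" using dom by blast
    then show ?thesis using app_eq[OF funG Gs[OF that _ *]] by simp
  qed
  then show ?thesis using funG app_eq[OF funG G0] by blast
qed

subsection \<open>Countable and finite sets\<close>

definition countable :: "'a \<Rightarrow> bool" where
  "countable a \<longleftrightarrow> (\<exists>s. sub s omega \<and> eqp a s)"

text \<open>A definable relation replaces an injection: each element is sent to its least index, and
  functionality keeps different elements apart.\<close>

lemma countableI:
  assumes R: "D (\<lambda>e. R (e 0) (e 1))"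
    and total: "\<And>y. y mem s \<Longrightarrow> \<exists>n. n mem omega \<and> R n y"
    and functional: "\<And>n y y'. n mem omega \<Longrightarrow> y mem s \<Longrightarrow> y' mem s \<Longrightarrow> R n y \<Longrightarrow> R n y' \<Longrightarrow> y = y'"
  shows "countable s"
proof -
  define h where "h y = lst (Sep omega (\<lambda>n. R n y))" for y
  have S: "\<And>y n. n mem Sep omega (\<lambda>n. R n y) \<longleftrightarrow> n mem omega \<and> R n y"
    by (rule mem_Sep) (intro dfn D_comp2[of R, OF R])
  have h: "h y mem omega \<and> R (h y) y" if y: "y mem s" for y
  proof -
    obtain n where "n mem Sep omega (\<lambda>n. R n y)" using total[OF y] S by blast
    then have "h y mem Sep omega (\<lambda>n. R n y)" unfolding h_def
      by (intro lst_mem[of _ n]) (auto simp: sub_def S)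
    then show ?thesis using S by blast
  qed
  have dh: "DF (\<lambda>e. h (e 0))" unfolding h_def by (intro dfn D_comp2[of R, OF R])
  have "eqp s (Rep s h)"
    using h functional by (intro eqpI[of h, OF dh]) (auto simp: mem_Rep[OF dh], metis)
  moreover have "sub (Rep s h) omega" unfolding sub_def using h by (auto simp: mem_Rep[OF dh])
  ultimately show ?thesis unfolding countable_def by blast
qed

lemma countableD:
  "countable s \<Longrightarrow> \<exists>f. (\<forall>x. x mem s \<longrightarrow> app f x mem omega) \<and>
    (\<forall>x y. x mem s \<longrightarrow> y mem s \<longrightarrow> app f x = app f y \<longrightarrow> x = y)"
  unfolding countable_def eqp_def bij_def sub_def by blast

lemma countable_image:
  assumes "countable s" and R: "D (\<lambda>e. R (e 0) (e 1))"
    and total: "\<And>y. y mem t \<Longrightarrow> \<exists>x. x mem s \<and> R x y"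
    and functional: "\<And>x y y'. x mem s \<Longrightarrow> y mem t \<Longrightarrow> y' mem t \<Longrightarrow> R x y \<Longrightarrow> R x y' \<Longrightarrow> y = y'"
  shows "countable t"
proof -
  obtain f where f: "\<And>x. x mem s \<Longrightarrow> app f x mem omega"
    "\<And>x y. x mem s \<Longrightarrow> y mem s \<Longrightarrow> app f x = app f y \<Longrightarrow> x = y" using countableD[OF assms(1)] by auto
  show ?thesis
  proof (rule countableI[of "\<lambda>n y. \<exists>x. x mem s \<and> app f x = n \<and> R x y"])
    show "D (\<lambda>e. \<exists>x. x mem s \<and> app f x = e 0 \<and> R x (e 1))"
      by (intro dfn D_comp2[of R, OF R])
  next
    fix y assume "y mem t"
    then show "\<exists>n. n mem omega \<and> (\<exists>x. x mem s \<and> app f x = n \<and> R x y)" using total f(1) by blast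
  qed (use f(2) functional in blast)
qed

lemma countable_omega: "countable omega"
  by (rule countableI[of "\<lambda>x y. x = y"]) (intro dfn, auto)

lemma countable_sub: "countable s \<Longrightarrow> sub t s \<Longrightarrow> countable t"
  by (rule countable_image[of s "\<lambda>x y. x = y"]) (auto simp: sub_def intro!: dfn)

lemma countable_Rep: "countable s \<Longrightarrow> DF (\<lambda>e. F (e 0)) \<Longrightarrow> countable (Rep s F)"
  by (rule countable_image[of s "\<lambda>x y. y = F x"])
    (auto simp: mem_Rep intro!: dfn DF_subst1[of F])

text \<open>Induction on \<open>n\<close> for all subsets of \<open>n\<close> at once: in a subset
  of \<open>suc n\<close>, either \<open>n\<close> or the maximum of the rest wins. Here
  \<open>r\<close> is a total preorder, meant to be transported from other sets along a
  bijection.\<close>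

lemma finite_max:
  assumes r: "D (\<lambda>e. r (e 0) (e 1))"
    and total: "\<And>x y. x mem M \<Longrightarrow> y mem M \<Longrightarrow> r x y \<or> r y x"
    and trans: "\<And>x y z. x mem M \<Longrightarrow> y mem M \<Longrightarrow> z mem M \<Longrightarrow> r x y \<Longrightarrow> r y z \<Longrightarrow> r x z"
    and n: "n mem omega" "sub M n" "\<exists>z. z mem M"
  shows "\<exists>k. k mem M \<and> (\<forall>j. j mem M \<longrightarrow> r j k)"
proof -
  have r': "DF F \<Longrightarrow> DF G \<Longrightarrow> D (\<lambda>e. r (F e) (G e))" for F G by (rule D_comp2[of r, OF r])
  have "\<forall>N. sub N n \<and> sub N M \<and> (\<exists>z. z mem N) \<longrightarrow> (\<exists>k. k mem N \<and> (\<forall>j. j mem N \<longrightarrow> r j k))"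
  proof (rule omega_induct[OF n(1)], intro dfn r')
    show "\<forall>N. sub N eset \<and> sub N M \<and> (\<exists>z. z mem N) \<longrightarrow> (\<exists>k. k mem N \<and> (\<forall>j. j mem N \<longrightarrow> r j k))"
      by (auto simp: sub_def)
  next
    fix n assume IH: "\<forall>N. sub N n \<and> sub N M \<and> (\<exists>z. z mem N) \<longrightarrow> (\<exists>k. k mem N \<and> (\<forall>j. j mem N \<longrightarrow> r j k))"
    show "\<forall>N. sub N (suc n) \<and> sub N M \<and> (\<exists>z. z mem N) \<longrightarrow> (\<exists>k. k mem N \<and> (\<forall>j. j mem N \<longrightarrow> r j k))"
    proof (intro allI impI, elim conjE)
      fix N assume N: "sub N (suc n)" "sub N M" "\<exists>z. z mem N"
      have refl: "r x x" if "x mem N" for x using total N(2) that unfolding sub_def by blast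
      show "\<exists>k. k mem N \<and> (\<forall>j. j mem N \<longrightarrow> r j k)"
      proof (cases "\<exists>z. z mem cap N n")
        case False
        then have "j mem N \<Longrightarrow> j = n" for j using N(1) unfolding sub_def by auto
        then show ?thesis using N(3) refl by metis
      next
        case True
        moreover have "sub (cap N n) n" "sub (cap N n) M" using N(2) by (auto simp: sub_def)
        ultimately obtain k where k: "k mem N" "\<And>j. j mem N \<Longrightarrow> j mem n \<Longrightarrow> r j k"
          using IH by (metis mem_cap)
        have split: "j mem N \<Longrightarrow> j mem n \<or> j = n" for j using N(1) unfolding sub_def by auto
        show ?thesis
        proof (cases "n mem N \<and> r k n")
          case True
          then have "j mem N \<Longrightarrow> r j n" for j
            using split k refl trans[of j k n] N(2) unfolding sub_def by blast
          then show ?thesis using True by blast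
        next
          case False
          then have "j mem N \<Longrightarrow> r j k" for j
            using split[of j] k total[of n k] N(2) unfolding sub_def by blast
          then show ?thesis using k by blast
        qed
      qed
    qed
  qed
  then show ?thesis using n(2,3) by simp
qed

text \<open>A bijection onto \<open>n\<close> would carry the order of \<open>N\<close> over to
  \<open>n\<close>, where \<open>finite_max\<close> provides a maximum; its preimage would bound
  \<open>N\<close>.\<close>

lemma unbounded_infinite:
  assumes "\<And>n. n mem omega \<Longrightarrow> \<exists>m. m mem N \<and> n mem m" and N: "sub N omega" and n: "n mem omega"
  shows "\<not> eqp N n"
proof
  assume "eqp N n"
  then obtain f where f: "\<And>x. x mem N \<Longrightarrow> app f x mem n"
    "\<And>x y. x mem N \<Longrightarrow> y mem N \<Longrightarrow> app f x = app f y \<Longrightarrow> x = y"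
    "\<And>y. y mem n \<Longrightarrow> \<exists>x. x mem N \<and> app f x = y" unfolding eqp_def bij_def by blast
  have lin: "x mem y \<or> x = y \<or> y mem x" if "x mem N" "y mem N" for x y
    using that omega_linear N unfolding sub_def by blast
  have tr: "x mem y \<Longrightarrow> y mem z \<Longrightarrow> x mem z" if "z mem N" for x y z
    using that omega_trans N unfolding sub_def by blast
  define r where "r i j \<longleftrightarrow>
    (\<exists>x y. x mem N \<and> y mem N \<and> app f x = i \<and> app f y = j \<and> (x = y \<or> x mem y))" for i j
  have r: "r (app f x) (app f y) \<longleftrightarrow> x = y \<or> x mem y" if "x mem N" "y mem N" for x y
    unfolding r_def using f(2) that by blast
  have "\<exists>k. k mem n \<and> (\<forall>j. j mem n \<longrightarrow> r j k)"
  proof (rule finite_max[of r])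
    show "D (\<lambda>e. r (e 0) (e 1))" unfolding r_def by (intro dfn)
    show "r x y \<or> r y x" if xy: "x mem n" "y mem n" for x y
    proof -
      obtain x' y' where "x' mem N" "app f x' = x" "y' mem N" "app f y' = y"
        using f(3)[OF xy(1)] f(3)[OF xy(2)] by blast
      then show ?thesis using r[of x' y'] r[of y' x'] lin[of x' y'] by auto
    qed
    show "r x z" if xyz: "x mem n" "y mem n" "z mem n" "r x y" "r y z" for x y z
    proof -
      obtain x' y' z' where "x' mem N" "app f x' = x" "y' mem N" "app f y' = y" "z' mem N" "app f z' = z"
        using f(3)[OF xyz(1)] f(3)[OF xyz(2)] f(3)[OF xyz(3)] by blast
      then show ?thesis
        using xyz(4,5) r[of x' y'] r[of y' z'] r[of x' z'] tr[of z' x' y'] by auto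
    qed
    show "\<exists>z. z mem n" using assms(1)[OF n] f(1) by blast
  qed (use n in auto)
  then obtain k where k: "k mem n" "\<And>j. j mem n \<Longrightarrow> r j k" by blast
  then obtain y where y: "y mem N" "app f y = k" using f(3) by blast
  then obtain m where m: "m mem N" "y mem m" using assms(1) N unfolding sub_def by blast
  then have "m = y \<or> m mem y" using r[of m y] k(2)[OF f(1)] y by simp
  then show False using m(2) mem_asym by auto
qed

lemma eqp_insert: assumes "eqp a m" "\<not> x mem a" shows "eqp (cup a (upair x x)) (suc m)"
proof -
  obtain f where f: "\<And>x. x mem a \<Longrightarrow> app f x mem m"
    "\<And>x y. x mem a \<Longrightarrow> y mem a \<Longrightarrow> app f x = app f y \<Longrightarrow> x = y"
    "\<And>y. y mem m \<Longrightarrow> \<exists>x. x mem a \<and> app f x = y" using assms(1) unfolding eqp_def bij_def by blast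
  show ?thesis
  proof (rule eqpI[of "\<lambda>y. if y = x then m else app f y"])
    show "DF (\<lambda>e. if e 0 = x then m else app f (e 0))" by (intro dfn)
    show "\<exists>z. z mem cup a (upair x x) \<and> (if z = x then m else app f z) = y" if "y mem suc m" for y
    proof (cases "y = m")
      case True
      then show ?thesis by (intro exI[of _ x]) simp
    next
      case False
      then obtain z where "z mem a" "app f z = y" using f(3) \<open>y mem suc m\<close> by auto
      then show ?thesis using assms(2) by (intro exI[of _ z]) auto
    qed
  next
    fix u v assume uv: "u mem cup a (upair x x)" "v mem cup a (upair x x)"
      "(if u = x then m else app f u) = (if v = x then m else app f v)"
    have "app f y \<noteq> m" if "y mem a" for y using f(1)[OF that] by auto
    then show "u = v" using uv f(2)[of u v] by (auto split: if_splits)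
  qed (use f in auto)
qed

lemma eqp_eset: "eqp eset eset"
  by (rule eqpI[of "\<lambda>x. x"]) (auto intro: dfn)

lemma bounded_finite:
  assumes "n mem omega" "sub N n" shows "\<exists>m. m mem omega \<and> eqp N m"
proof -
  have "\<forall>N. sub N n \<longrightarrow> (\<exists>m. m mem omega \<and> eqp N m)"
  proof (rule omega_induct[OF assms(1)], intro dfn)
    have "N = eset" if "sub N eset" for N using that by (intro ext) (simp add: sub_def)
    then show "\<forall>N. sub N eset \<longrightarrow> (\<exists>m. m mem omega \<and> eqp N m)" using eqp_eset omega_0 by blast
  next
    fix n assume IH: "\<forall>N. sub N n \<longrightarrow> (\<exists>m. m mem omega \<and> eqp N m)"
    show "\<forall>N. sub N (suc n) \<longrightarrow> (\<exists>m. m mem omega \<and> eqp N m)"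
    proof (intro allI impI)
      fix N assume N: "sub N (suc n)"
      obtain m where m: "m mem omega" "eqp (cap N n) m" using IH[rule_format, of "cap N n"] by (auto simp: sub_def)
      show "\<exists>m. m mem omega \<and> eqp N m"
      proof (cases "n mem N")
        case True
        have "cup (cap N n) (upair n n) = N" using N True by (intro ext) (auto simp: sub_def)
        then show ?thesis using eqp_insert[OF m(2), of n] m(1) by (metis mem_cap mem_irrefl omega_suc)
      next
        case False
        have "cap N n = N" using N False by (intro ext) (auto simp: sub_def)
        then show ?thesis using m by metis
      qed
    qed
  qed
  then show ?thesis using assms(2) by blast
qed

lemma infinite_unbounded:
  assumes "sub N omega" "\<not> (\<exists>n. n mem omega \<and> eqp N n)" and n: "n mem omega"
  shows "\<exists>m. m mem N \<and> n mem m"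
proof (rule ccontr)
  assume "\<not> ?thesis"
  then have "sub N (suc n)" using assms(1) n omega_linear unfolding sub_def by (metis mem_suc)
  then show False using bounded_finite[of "suc n" N] assms by auto
qed

subsection \<open>The vocabulary in a model\<close>

definition inter_of :: "'a \<Rightarrow> 'a \<Rightarrow> bool" where
  "inter_of i s \<longleftrightarrow> (\<forall>z. z mem i \<longleftrightarrow> (\<forall>v. v mem s \<longrightarrow> z mem v))"

definition linord :: "'a \<Rightarrow> 'a \<Rightarrow> bool" where
  "linord r a \<longleftrightarrow> (\<forall>p. p mem r \<longrightarrow> (\<exists>x y. x mem a \<and> y mem a \<and> p = pair x y)) \<and>
    (\<forall>x. x mem a \<longrightarrow> pair x x mem r) \<and>
    (\<forall>x y. pair x y mem r \<and> pair y x mem r \<longrightarrow> x = y) \<and>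
    (\<forall>x y z. pair x y mem r \<and> pair y z mem r \<longrightarrow> pair x z mem r) \<and>
    (\<forall>x y. x mem a \<and> y mem a \<longrightarrow> pair x y mem r \<or> pair y x mem r)"

definition sclo :: "'a \<Rightarrow> 'a \<Rightarrow> bool" where
  "sclo r a \<longleftrightarrow> linord r a \<and> (\<forall>s. sub s a \<and> (\<exists>z. z mem s) \<and> countable s \<longrightarrow>
    (\<exists>m. m mem s \<and> (\<forall>x. x mem s \<longrightarrow> pair x m mem r)))"

definition topology :: "'a \<Rightarrow> 'a \<Rightarrow> bool" where
  "topology t x \<longleftrightarrow> (\<forall>u. u mem t \<longrightarrow> sub u x) \<and> eset mem t \<and> x mem t \<and>
    (\<forall>u v. u mem t \<and> v mem t \<longrightarrow> cap u v mem t) \<and> (\<forall>s. sub s t \<longrightarrow> Uni s mem t)"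

definition pspace :: "'a \<Rightarrow> 'a \<Rightarrow> bool" where
  "pspace x t \<longleftrightarrow> topology t x \<and> (\<forall>g s. sub s t \<and> (\<exists>z. z mem s) \<and> countable s \<and> inter_of g s \<longrightarrow> g mem t)"

definition base :: "'a \<Rightarrow> 'a \<Rightarrow> bool" where
  "base b t \<longleftrightarrow> sub b t \<and> (\<forall>u. u mem t \<longrightarrow> (\<exists>s. sub s b \<and> u = Uni s))"

definition stable :: "'a \<Rightarrow> bool" where
  "stable b \<longleftrightarrow> (\<exists>c. (\<forall>u. u mem c \<longleftrightarrow> u mem b \<or> u = eset) \<and>
    (\<forall>s. sub s c \<and> (\<exists>z. z mem s) \<and> countable s \<longrightarrow> (\<exists>i. inter_of i s \<and> i mem c)))"

definition family :: "'a \<Rightarrow> bool" where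
  "family A \<longleftrightarrow> fun_on A omega \<and> (\<forall>i. i mem omega \<longrightarrow> (\<exists>z. z mem app A i))"

definition choice :: "'a \<Rightarrow> 'a \<Rightarrow> 'a \<Rightarrow> bool" where
  "choice g A I \<longleftrightarrow> fun_on g I \<and> (\<forall>i. i mem I \<longrightarrow> app g i mem app A i)"

definition orderings :: "'a \<Rightarrow> 'a \<Rightarrow> bool" where
  "orderings f A \<longleftrightarrow> fun_on f omega \<and> (\<forall>i. i mem omega \<longrightarrow> sclo (app f i) (app A i))"

lemma mem_simps:
  "(\<forall>z. \<not> z mem x) \<longleftrightarrow> x = eset"
  "(\<forall>z. z mem p \<longleftrightarrow> z = x \<or> z = y) \<longleftrightarrow> p = upair x y"
  "(\<forall>z. z mem u \<longleftrightarrow> (\<exists>v. v mem s \<and> z mem v)) \<longleftrightarrow> u = Uni s"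
  "(\<forall>z. z mem u \<longleftrightarrow> z mem x \<and> z mem y) \<longleftrightarrow> u = cap x y"
  "(\<forall>z. z mem u \<longleftrightarrow> z mem x \<and> \<not> z mem y) \<longleftrightarrow> u = dif x y"
  "(\<forall>z. z mem s \<longleftrightarrow> z mem x \<or> z = x) \<longleftrightarrow> s = suc x"
  "(\<forall>z. z mem x \<longrightarrow> z mem y) \<longleftrightarrow> sub x y"
  by (simp_all add: eq_iff_mem sub_def)

lemma cart_iff: "(\<forall>p. p mem c \<longleftrightarrow> (\<exists>x. x mem a \<and> (\<exists>y. y mem b \<and> p = pair x y))) \<longleftrightarrow> c = cart a b"
  by (simp add: eq_iff_mem mem_cart)

lemma omega_iff: "(indset w \<and> (\<forall>a. indset a \<longrightarrow> sub w a)) \<longleftrightarrow> w = omega"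
proof
  assume w: "indset w \<and> (\<forall>a. indset a \<longrightarrow> sub w a)"
  show "w = omega" by (rule ext) (use w in \<open>auto simp: mem_omega sub_def\<close>)
next
  assume "w = omega"
  then show "indset w \<and> (\<forall>a. indset a \<longrightarrow> sub w a)"
    by (auto simp: indset_def sub_def mem_omega)
qed

lemma bijection_iff:
  "(fun_on f a \<and> (\<forall>x y. pair x y mem f \<longrightarrow> y mem b)) \<and>
    (\<forall>x y z. pair x z mem f \<and> pair y z mem f \<longrightarrow> x = y) \<and>
    (\<forall>y. y mem b \<longrightarrow> (\<exists>x. pair x y mem f)) \<longleftrightarrow> bij f a b"
proof (cases "fun_on f a")
  case True
  show ?thesis unfolding bij_def using True by (auto simp: pair_mem_fun[OF True])
qed (simp add: bij_def)

lemma family_iff: "fun_on A omega \<and> (\<forall>i a. pair i a mem A \<longrightarrow> (\<exists>z. z mem a)) \<longleftrightarrow> family A"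
  unfolding family_def using pair_mem_fun[of A omega] by auto

section \<open>Evaluation of the object formulas in the model\<close>

lemma lsat_basic:
  "x < d \<Longrightarrow> y < d \<Longrightarrow> lsat d l (x \<^bold>\<subseteq> y) \<longleftrightarrow> sub (l x) (l y)"
  "x < d \<Longrightarrow> lsat d l (is_empty x) \<longleftrightarrow> l x = eset"
  "x < d \<Longrightarrow> lsat d l (nonempty x) \<longleftrightarrow> (\<exists>z. z mem l x)"
  "p < d \<Longrightarrow> x < d \<Longrightarrow> y < d \<Longrightarrow> lsat d l (is_upair p x y) \<longleftrightarrow> l p = upair (l x) (l y)"
  "x < d \<Longrightarrow> y < d \<Longrightarrow> lsat d l (is_Union x y) \<longleftrightarrow> l x = Uni (l y)"
  "x < d \<Longrightarrow> y < d \<Longrightarrow> lsat d l (is_Inter x y) \<longleftrightarrow> inter_of (l x) (l y)"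
  "p < d \<Longrightarrow> x < d \<Longrightarrow> y < d \<Longrightarrow> lsat d l (is_inter p x y) \<longleftrightarrow> l p = cap (l x) (l y)"
  "p < d \<Longrightarrow> x < d \<Longrightarrow> y < d \<Longrightarrow> lsat d l (is_diff p x y) \<longleftrightarrow> l p = dif (l x) (l y)"
  "x < d \<Longrightarrow> y < d \<Longrightarrow> lsat d l (is_succ x y) \<longleftrightarrow> l x = suc (l y)"
  by (simp_all add: fsub_def is_empty_def nonempty_def is_upair_def is_Union_def is_Inter_def
      is_inter_def is_diff_def is_succ_def lsat_simps mem_simps inter_of_def)

lemma lsat_pair:
  "p < d \<Longrightarrow> x < d \<Longrightarrow> y < d \<Longrightarrow> lsat d l (is_pair p x y) \<longleftrightarrow> l p = pair (l x) (l y)"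
  by (simp add: is_pair_def lsat_simps lsat_basic pair_def)

lemma lsat_pair_mem:
  "p < d \<Longrightarrow> x < d \<Longrightarrow> y < d \<Longrightarrow> lsat d l (\<^bold>\<langle>x, y\<^bold>\<rangle> \<^bold>\<in> p) \<longleftrightarrow> pair (l x) (l y) mem l p"
  by (simp add: pair_mem_def lsat_simps lsat_pair)

lemma lsat_cart:
  "p < d \<Longrightarrow> x < d \<Longrightarrow> y < d \<Longrightarrow> lsat d l (is_cart p x y) \<longleftrightarrow> l p = cart (l x) (l y)"
  by (simp add: is_cart_def lsat_simps lsat_pair cart_iff)

lemma lsat_omega: "x < d \<Longrightarrow> lsat d l (is_omega x) \<longleftrightarrow> l x = omega"
  by (simp add: is_omega_def is_inductive_def lsat_simps lsat_basic flip: omega_iff)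
    (auto simp: indset_def)

lemma lsat_function_on:
  "x < d \<Longrightarrow> y < d \<Longrightarrow> lsat d l (function_on x y) \<longleftrightarrow> fun_on (l x) (l y)"
  by (simp add: function_on_def lsat_simps lsat_pair lsat_pair_mem fun_on_def)

lemma lsat_equipotent:
  "x < d \<Longrightarrow> y < d \<Longrightarrow> lsat d l (equipotent x y) \<longleftrightarrow> eqp (l x) (l y)"
  by (simp add: equipotent_def bijection_def function_into_def lsat_simps lsat_function_on
      lsat_pair_mem eqp_def flip: bijection_iff)

lemma lsat_countable: "x < d \<Longrightarrow> lsat d l (is_countable x) \<longleftrightarrow> countable (l x)"
  by (simp add: is_countable_def lsat_simps lsat_basic lsat_omega lsat_equipotent countable_def)

lemma lsat_infinite:
  "x < d \<Longrightarrow> lsat d l (is_infinite x) \<longleftrightarrow> \<not> (\<exists>n. n mem omega \<and> eqp (l x) n)"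
  by (simp add: is_infinite_def lsat_simps lsat_omega lsat_equipotent)

lemma lsat_dedekind_infinite:
  "x < d \<Longrightarrow> lsat d l (dedekind_infinite x) \<longleftrightarrow> (\<exists>s. sub s (l x) \<and> s \<noteq> l x \<and> eqp (l x) s)"
  by (simp add: dedekind_infinite_def lsat_simps lsat_basic lsat_equipotent)

lemma lsat_linear_ordering:
  "x < d \<Longrightarrow> y < d \<Longrightarrow> lsat d l (linear_ordering x y) \<longleftrightarrow> linord (l x) (l y)"
  by (simp add: linear_ordering_def lsat_simps lsat_pair lsat_pair_mem linord_def)

lemma lsat_sclo:
  "x < d \<Longrightarrow> y < d \<Longrightarrow> lsat d l (strongly_complete_linear_ordering x y) \<longleftrightarrow> sclo (l x) (l y)"
  by (simp add: strongly_complete_linear_ordering_def lsat_simps lsat_basic lsat_countable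
      lsat_linear_ordering lsat_pair_mem sclo_def)

lemma lsat_topology:
  "x < d \<Longrightarrow> y < d \<Longrightarrow> lsat d l (topology_on x y) \<longleftrightarrow> topology (l x) (l y)"
  by (simp add: topology_on_def lsat_simps lsat_basic topology_def)

lemma lsat_P_space:
  "x < d \<Longrightarrow> y < d \<Longrightarrow> lsat d l (P_space x y) \<longleftrightarrow> pspace (l x) (l y)"
  by (simp add: P_space_def G_delta_def lsat_simps lsat_basic lsat_topology lsat_countable pspace_def)

lemma lsat_base_of:
  "x < d \<Longrightarrow> y < d \<Longrightarrow> lsat d l (base_of x y) \<longleftrightarrow> base (l x) (l y)"
  by (simp add: base_of_def lsat_simps lsat_basic base_def)

lemma lsat_almost_stable: "x < d \<Longrightarrow> lsat d l (almost_stable x) \<longleftrightarrow> stable (l x)"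
  by (simp add: almost_stable_def lsat_simps lsat_basic lsat_countable stable_def)

lemma lsat_family:
  "x < d \<Longrightarrow> y < d \<Longrightarrow> l y = omega \<Longrightarrow> lsat d l (nonempty_family x y) \<longleftrightarrow> family (l x)"
  by (simp add: nonempty_family_def lsat_simps lsat_basic lsat_function_on lsat_pair_mem
      flip: family_iff)

text \<open>The formula is relational; it agrees with \<open>choice\<close> because every index in
  \<open>l z\<close> lies in \<open>omega\<close>, where the family has exactly one value.\<close>

lemma lsat_choice:
  assumes "x < d" "y < d" "z < d" "family (l y)" "sub (l z) omega"
  shows "lsat d l (choice_function x y z) \<longleftrightarrow> choice (l x) (l y) (l z)"
  using assms pair_mem_fun[of "l y" omega] pair_mem_fun[of "l x" "l z"]
  by (auto simp: choice_function_def choice_def family_def sub_def lsat_simps lsat_function_on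
      lsat_pair_mem)

lemma lsat_orderings:
  assumes "x < d" "y < d" "z < d" "family (l y)" "l z = omega"
  shows "lsat d l (strongly_complete_orderings x y z) \<longleftrightarrow> orderings (l x) (l y)"
  using assms pair_mem_fun[of "l y" omega] pair_mem_fun[of "l x" omega]
  by (auto simp: strongly_complete_orderings_def orderings_def family_def lsat_simps lsat_function_on
      lsat_pair_mem lsat_sclo)

lemma lsat_CMC: "lsat 0 l CMC \<longleftrightarrow> (\<forall>A. family A \<longrightarrow>
  (\<exists>B. family B \<and> (\<forall>i. i mem omega \<longrightarrow> sub (app B i) (app A i) \<and> countable (app B i))))"
proof -
  have "family A \<Longrightarrow> family B \<Longrightarrow> (\<forall>i a b. pair i a mem A \<and> pair i b mem B \<longrightarrow> sub b a \<and> countable b) \<longleftrightarrow>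
      (\<forall>i. i mem omega \<longrightarrow> sub (app B i) (app A i) \<and> countable (app B i))" for A B
    using pair_mem_fun[of A omega] pair_mem_fun[of B omega] by (auto simp: family_def)
  then show ?thesis
    by (simp add: CMC_def lsat_simps lsat_omega lsat_family lsat_pair_mem lsat_basic lsat_countable
        cong: conj_cong)
qed

lemma lsat_ABP: "lsat 0 l ABP \<longleftrightarrow>
  (\<forall>x t. topology t x \<and> (\<exists>b. base b t \<and> stable b) \<longrightarrow> pspace x t)"
  by (simp add: ABP_def lsat_simps lsat_topology lsat_base_of lsat_almost_stable lsat_P_space)

lemma lsat_AB0P: "lsat 0 l AB0P \<longleftrightarrow>
  (\<forall>x t. topology t x \<and>
    (\<exists>b. (\<forall>u. u mem b \<longleftrightarrow> u mem t \<and> dif x u mem t) \<and> base b t) \<and>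
    (\<forall>y z. y mem x \<and> z mem x \<and> y \<noteq> z \<longrightarrow> (\<exists>u. u mem t \<and> y mem u \<and> \<not> z mem u)) \<and>
    (\<exists>b. base b t \<and> stable b) \<longrightarrow> pspace x t)"
  by (simp add: AB0P_def zero_dimensional_def clopen_def T1_def lsat_simps lsat_basic lsat_topology
      lsat_base_of lsat_almost_stable lsat_P_space)

lemma lsat_PPP: "lsat 0 l PPP \<longleftrightarrow> (\<forall>x t1 y t2. pspace x t1 \<and> pspace y t2 \<longrightarrow>
  (\<exists>t. (\<forall>w. w mem t \<longleftrightarrow> (\<exists>s. (\<forall>r. r mem s \<longrightarrow> (\<exists>u v. u mem t1 \<and> v mem t2 \<and> r = cart u v)) \<and> w = Uni s)) \<and>
    pspace (cart x y) t))"
  by (simp add: PPP_def product_topology_def lsat_simps lsat_basic lsat_cart lsat_P_space)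

lemma lsat_CACCLO: "lsat 0 l CACCLO \<longleftrightarrow>
  (\<forall>A f. family A \<longrightarrow> orderings f A \<longrightarrow> (\<exists>g. choice g A omega))"
  by (simp add: CACCLO_def lsat_simps lsat_omega lsat_family lsat_choice lsat_orderings
      cong: conj_cong imp_cong) blast

lemma lsat_PCACCLO: "lsat 0 l PCACCLO \<longleftrightarrow>
  (\<forall>A f. family A \<longrightarrow> orderings f A \<longrightarrow>
    (\<exists>I g. sub I omega \<and> \<not> (\<exists>n. n mem omega \<and> eqp I n) \<and> choice g A I))"
  by (simp add: PCACCLO_def lsat_simps lsat_omega lsat_family lsat_choice lsat_orderings
      lsat_basic lsat_infinite cong: conj_cong imp_cong) blast

section \<open>Almost stable bases and products\<close>

definition meet :: "'a \<Rightarrow> 'a" where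
  "meet s = Sep (Uni s) (\<lambda>z. \<forall>v. v mem s \<longrightarrow> z mem v)"

lemma DF_meet [dfn]: "DF F \<Longrightarrow> DF (\<lambda>e. meet (F e))"
  by (rule DF_comp1) (unfold meet_def, intro dfn)

lemma mem_meet: assumes "x mem s" shows "z mem meet s \<longleftrightarrow> (\<forall>v. v mem s \<longrightarrow> z mem v)"
proof -
  have "z mem meet s \<longleftrightarrow> z mem Uni s \<and> (\<forall>v. v mem s \<longrightarrow> z mem v)"
    unfolding meet_def by (rule mem_Sep) (intro dfn)
  then show ?thesis using assms by auto
qed

lemma inter_of_meet: assumes "x mem s" shows "inter_of i s \<longleftrightarrow> i = meet s"
  unfolding inter_of_def eq_iff_mem mem_meet[OF assms] ..

lemma subD: "sub x y \<Longrightarrow> z mem x \<Longrightarrow> z mem y"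
  by (simp add: sub_def)

lemma base_mem:
  assumes "base b t" "u mem t" "p mem u" shows "\<exists>v. v mem b \<and> p mem v \<and> sub v u"
proof -
  obtain s where "sub s b" "u = Uni s" using assms(1,2) unfolding base_def by blast
  then show ?thesis using assms(3) unfolding sub_def by auto
qed

text \<open>Taking all members of \<open>b\<close> inside \<open>u\<close> avoids choosing one of
  them for each point.\<close>

lemma eq_Uni_Sep:
  assumes "\<And>p. p mem u \<Longrightarrow> \<exists>v. v mem b \<and> p mem v \<and> sub v u"
  shows "u = Uni (Sep b (\<lambda>v. sub v u))"
proof -
  have 1: "\<And>v. v mem Sep b (\<lambda>v. sub v u) \<longleftrightarrow> v mem b \<and> sub v u" by (rule mem_Sep) (intro dfn)
  show ?thesis
  proof (rule ext)
    fix z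
    show "z mem u \<longleftrightarrow> z mem Uni (Sep b (\<lambda>v. sub v u))"
      unfolding mem_Uni 1 using assms[of z] subD by blast
  qed
qed

lemma sub_Sep: "D (\<lambda>e. P (e 0)) \<Longrightarrow> sub (Sep b P) b"
  by (simp add: sub_def mem_Sep)

lemma baseI:
  assumes "sub b t" "\<And>u p. u mem t \<Longrightarrow> p mem u \<Longrightarrow> \<exists>v. v mem b \<and> p mem v \<and> sub v u"
  shows "base b t"
  unfolding base_def
proof (intro conjI allI impI)
  fix u assume u: "u mem t"
  have "u = Uni (Sep b (\<lambda>v. sub v u))" by (rule eq_Uni_Sep) (rule assms(2)[OF u])
  moreover have "sub (Sep b (\<lambda>v. sub v u)) b" by (rule sub_Sep) (intro dfn)
  ultimately show "\<exists>s. sub s b \<and> u = Uni s" by blast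
qed (rule assms(1))

lemma topology_Uni: "topology t x \<Longrightarrow> sub s t \<Longrightarrow> Uni s mem t"
  by (simp add: topology_def)

lemma openI:
  assumes "topology t x" "\<And>p. p mem u \<Longrightarrow> \<exists>v. v mem t \<and> p mem v \<and> sub v u"
  shows "u mem t"
proof -
  have "u = Uni (Sep t (\<lambda>v. sub v u))" by (rule eq_Uni_Sep) (rule assms(2))
  moreover have "sub (Sep t (\<lambda>v. sub v u)) t" by (rule sub_Sep) (intro dfn)
  ultimately show ?thesis using topology_Uni[OF assms(1)] by metis
qed

lemma CMC_imp_ABP:
  assumes CMC: "\<And>A. family A \<Longrightarrow>
      \<exists>B. family B \<and> (\<forall>i. i mem omega \<longrightarrow> sub (app B i) (app A i) \<and> countable (app B i))"
    and t: "topology t x" and b: "base b t" "stable b"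
  shows "pspace x t"
proof -
  obtain c where c: "\<And>u. u mem c \<longleftrightarrow> u mem b \<or> u = eset"
    and c_inter: "\<And>s. sub s c \<Longrightarrow> \<exists>z. z mem s \<Longrightarrow> countable s \<Longrightarrow> \<exists>i. inter_of i s \<and> i mem c"
    using b(2) unfolding stable_def by blast
  have c_meet: "meet s mem c" if "sub s c" "z mem s" "countable s" for s z
    using c_inter[OF that(1) _ that(3)] that(2) inter_of_meet[OF that(2)] by auto
  have bt: "v mem t" if "v mem b" for v using b(1) that unfolding base_def sub_def by blast
  have "g mem t" if s: "sub s t" "z mem s" "countable s" and g: "inter_of g s" for g s z
  proof (rule openI[OF t])
    fix p assume p: "p mem g"
    then have ps: "p mem u" if "u mem s" for u using g that unfolding inter_of_def by blast
    obtain f where f: "\<And>u. u mem s \<Longrightarrow> app f u mem omega"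
      "\<And>u v. u mem s \<Longrightarrow> v mem s \<Longrightarrow> app f u = app f v \<Longrightarrow> u = v" using countableD[OF s(3)] by auto
    \<comment> \<open>The open sets are indexed by the values of the injection \<open>f\<close>. An
      index that is not a value imposes no condition, so \<open>a i\<close> is non-empty for every
      \<open>i\<close>.\<close>
    define a where "a i = Sep b (\<lambda>v. p mem v \<and> (\<forall>u. u mem s \<and> app f u = i \<longrightarrow> sub v u))" for i
    have da: "DF (\<lambda>e. a (e 0))" unfolding a_def by (intro dfn)
    have a: "v mem a i \<longleftrightarrow> v mem b \<and> p mem v \<and> (\<forall>u. u mem s \<and> app f u = i \<longrightarrow> sub v u)" for v i
      unfolding a_def by (rule mem_Sep) (intro dfn)
    have "\<exists>v. v mem a i" for i
    proof (cases "\<exists>u. u mem s \<and> app f u = i")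
      case True
      then obtain u where u: "u mem s" "app f u = i" by blast
      moreover obtain v where "v mem b" "p mem v" "sub v u"
        using base_mem[OF b(1) _ ps[OF u(1)]] u(1) s(1) unfolding sub_def by blast
      ultimately have "v mem a i" unfolding a using f(2) by auto
      then show ?thesis ..
    next
      case False
      obtain v where "v mem b" "p mem v"
        using base_mem[OF b(1) _ ps[OF s(2)]] s(1,2) unfolding sub_def by blast
      then have "v mem a i" unfolding a using False by auto
      then show ?thesis ..
    qed
    then have "family (lam omega a)"
      unfolding family_def by (simp add: fun_on_lam[OF da] app_lam[OF da])
    from CMC[OF this] obtain B where B: "family B"
      "\<And>i. i mem omega \<Longrightarrow> sub (app B i) (a i) \<and> countable (app B i)"
      by (auto simp: app_lam[OF da])
    have Bne: "\<exists>z. z mem app B i" if "i mem omega" for i using B(1) that unfolding family_def by blast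
    define W where "W = Rep omega (\<lambda>i. meet (app B i))"
    have dW: "DF (\<lambda>e. meet (app B (e 0)))" by (intro dfn)
    have W: "w mem W \<longleftrightarrow> (\<exists>i. i mem omega \<and> w = meet (app B i))" for w
      unfolding W_def by (rule mem_Rep[OF dW])
    \<comment> \<open>\<open>app B i\<close> is a non-empty countable set of basic sets around
      \<open>p\<close>, so its intersection lies in \<open>c\<close> without a choice from
      \<open>app B i\<close>.\<close>
    have 1: "meet (app B i) mem c" "p mem meet (app B i)" if i: "i mem omega" for i
    proof -
      obtain z where z: "z mem app B i" using Bne[OF i] ..
      have "v mem b \<and> p mem v" if "v mem app B i" for v
        using B(2)[OF i] that a[of v i] unfolding sub_def by blast
      then show "meet (app B i) mem c" "p mem meet (app B i)"
        using c_meet[of "app B i" z] z B(2)[OF i] mem_meet[OF z] unfolding sub_def c by auto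
    qed
    have Wne: "meet (app B eset) mem W" unfolding W using omega_0 by blast
    have "meet W mem c"
    proof (rule c_meet[OF _ Wne])
      show "sub W c" unfolding sub_def W using 1(1) by blast
      show "countable W" unfolding W_def by (rule countable_Rep[OF countable_omega dW])
    qed
    \<comment> \<open>Containing \<open>p\<close>, the intersection is not empty; as a member of
      \<open>c\<close> it therefore belongs to the base and is open.\<close>
    moreover have pW: "p mem meet W" unfolding mem_meet[OF Wne] W using 1(2) by blast
    ultimately have "meet W mem t" using bt c by auto
    moreover have "sub (meet W) g"
      unfolding sub_def
    proof (intro allI impI)
      fix y assume y: "y mem meet W"
      have "y mem u" if u: "u mem s" for u
      proof -
        obtain v where v: "v mem app B (app f u)" using Bne[OF f(1)[OF u]] ..
        have "y mem meet (app B (app f u))"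
          using y f(1)[OF u] unfolding mem_meet[OF Wne] W by blast
        then have "y mem v" using v unfolding mem_meet[OF v] by blast
        moreover have "sub v u" using B(2)[OF f(1)[OF u]] v a u unfolding sub_def by blast
        ultimately show ?thesis unfolding sub_def by blast
      qed
      then show "y mem g" using g unfolding inter_of_def by blast
    qed
    ultimately show "\<exists>v. v mem t \<and> p mem v \<and> sub v g" using pW by blast
  qed
  then show ?thesis unfolding pspace_def using t by blast
qed

section \<open>Products of P-spaces\<close>

lemma countable_meet_open:
  assumes "pspace x t" "countable s" "z mem s" "DF (\<lambda>e. F (e 0))" "\<And>r. r mem s \<Longrightarrow> F r mem t"
  shows "meet (Rep s F) mem t"
proof -
  have "F z mem Rep s F" using mem_Rep[OF assms(4)] assms(3) by blast
  then show ?thesis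
    using assms(1) countable_Rep[OF assms(2,4)] inter_of_meet[of "F z"] assms(5)
    unfolding pspace_def sub_def by (metis mem_Rep[OF assms(4)])
qed

lemma ABP_imp_PPP:
  assumes ABP: "\<And>x t b. topology t x \<Longrightarrow> base b t \<Longrightarrow> stable b \<Longrightarrow> pspace x t"
    and X: "pspace x t1" and Y: "pspace y t2"
  shows "\<exists>t. (\<forall>w. w mem t \<longleftrightarrow>
    (\<exists>s. (\<forall>r. r mem s \<longrightarrow> (\<exists>u v. u mem t1 \<and> v mem t2 \<and> r = cart u v)) \<and> w = Uni s)) \<and> pspace (cart x y) t"
proof -
  define rect where "rect r \<longleftrightarrow> (\<exists>u v. u mem t1 \<and> v mem t2 \<and> r = cart u v)" for r
  have Drect: "DF F \<Longrightarrow> D (\<lambda>e. rect (F e))" for F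
    by (rule D_comp1[of rect]) (unfold rect_def, intro dfn)
  have t1: "topology t1 x" and t2: "topology t2 y" using X Y unfolding pspace_def by blast+
  have sub1: "sub u x" if "u mem t1" for u using t1 that unfolding topology_def by blast
  have sub2: "sub v y" if "v mem t2" for v using t2 that unfolding topology_def by blast
  have rect_sub: "sub r (cart x y)" if r: "rect r" for r
  proof -
    obtain u v where "u mem t1" "v mem t2" "r = cart u v" using r unfolding rect_def by blast
    then show ?thesis using sub1[of u] sub2[of v] by (auto simp: sub_def mem_cart)
  qed
  define opn where "opn w \<longleftrightarrow> (\<exists>s. (\<forall>r. r mem s \<longrightarrow> rect r) \<and> w = Uni s)" for w
  define t where "t = Sep (Pw (cart x y)) opn"
  have t0: "w mem t \<longleftrightarrow> sub w (cart x y) \<and> opn w" for w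
    unfolding t_def mem_Pw[symmetric] by (rule mem_Sep) (unfold opn_def, intro dfn Drect)
  have t: "w mem t \<longleftrightarrow> opn w" for w
  proof -
    have "sub w (cart x y)" if "\<forall>r. r mem s \<longrightarrow> rect r" "w = Uni s" for s
      unfolding sub_def that(2) mem_Uni using that(1) subD[OF rect_sub] by blast
    then show ?thesis unfolding t0 opn_def by blast
  qed
  \<comment> \<open>Openness in pointwise form. The converse takes all open rectangles inside
    \<open>w\<close>, so no rectangle is chosen for a point.\<close>
  have t_iff: "w mem t \<longleftrightarrow> (\<forall>p. p mem w \<longrightarrow> (\<exists>r. rect r \<and> p mem r \<and> sub r w))" for w
  proof
    assume "w mem t"
    then obtain s where s: "\<And>r. r mem s \<Longrightarrow> rect r" "w = Uni s" unfolding t opn_def by blast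
    show "\<forall>p. p mem w \<longrightarrow> (\<exists>r. rect r \<and> p mem r \<and> sub r w)"
      unfolding s(2) sub_def mem_Uni using s(1) by blast
  next
    assume w: "\<forall>p. p mem w \<longrightarrow> (\<exists>r. rect r \<and> p mem r \<and> sub r w)"
    have S: "\<And>r. r mem Sep (Pw w) rect \<longleftrightarrow> r mem Pw w \<and> rect r"
      by (rule mem_Sep) (intro Drect dfn)
    have "w = Uni (Sep (Pw w) rect)"
    proof (rule ext)
      fix z show "z mem w \<longleftrightarrow> z mem Uni (Sep (Pw w) rect)"
        unfolding mem_Uni S mem_Pw using w subD by blast
    qed
    then show "w mem t" unfolding t opn_def using S by blast
  qed
  have cap_rect: "rect (cap r r')" if rr: "rect r" "rect r'" for r r'
  proof -
    obtain u v u' v' where *: "u mem t1" "v mem t2" "r = cart u v" "u' mem t1" "v' mem t2" "r' = cart u' v'"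
      using rr unfolding rect_def by blast
    then have "cap r r' = cart (cap u u') (cap v v')" by (intro ext) (auto simp: mem_cart)
    moreover have "cap u u' mem t1" "cap v v' mem t2" using * t1 t2 unfolding topology_def by blast+
    ultimately show ?thesis unfolding rect_def by blast
  qed
  have rect_cart: "rect (cart x y)"
    unfolding rect_def using t1 t2 unfolding topology_def by blast
  have "topology t (cart x y)"
    unfolding topology_def
  proof (intro conjI allI impI)
    fix u assume "u mem t"
    then show "sub u (cart x y)" unfolding t0 ..
  next
    show "eset mem t" unfolding t_iff by simp
  next
    show "cart x y mem t" unfolding t_iff using rect_cart sub_refl by blast
  next
    fix u v assume uv: "u mem t \<and> v mem t"
    show "cap u v mem t"
      unfolding t_iff
    proof (intro allI impI)
      fix p assume "p mem cap u v"
      then obtain r r' where "rect r" "p mem r" "sub r u" "rect r'" "p mem r'" "sub r' v"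
        using uv unfolding t_iff mem_cap by blast
      then show "\<exists>r. rect r \<and> p mem r \<and> sub r (cap u v)"
        using cap_rect[of r r'] unfolding sub_def by (intro exI[of _ "cap r r'"]) auto
    qed
  next
    fix s assume s: "sub s t"
    show "Uni s mem t"
      unfolding t_iff
    proof (intro allI impI)
      fix p assume "p mem Uni s"
      then obtain u where u: "u mem s" "p mem u" by auto
      then obtain r where "rect r" "p mem r" "sub r u" using s unfolding sub_def t_iff by blast
      then show "\<exists>r. rect r \<and> p mem r \<and> sub r (Uni s)"
        using u(1) unfolding sub_def mem_Uni by blast
    qed
  qed
  define b where "b = Sep t rect"
  have rect_t: "r mem t" if "rect r" for r unfolding t_iff using that sub_refl by blast
  have b: "r mem b \<longleftrightarrow> rect r" for r
  proof -
    have "r mem b \<longleftrightarrow> r mem t \<and> rect r" unfolding b_def by (rule mem_Sep) (intro Drect dfn)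
    then show ?thesis using rect_t by blast
  qed
  have base: "base b t"
  proof (rule baseI)
    show "sub b t" unfolding sub_def b using rect_t by blast
    show "\<exists>v. v mem b \<and> p mem v \<and> sub v u" if "u mem t" "p mem u" for u p
      using that(1)[unfolded t_iff] that(2) unfolding b by blast
  qed
  \<comment> \<open>The empty set is an open rectangle, so \<open>b\<close> coincides with its
    extension by the empty set and can itself witness \<open>stable b\<close>.\<close>
  have eset_rect: "rect eset"
  proof -
    have "eset = cart eset eset" by (intro ext) (simp add: mem_cart)
    then show ?thesis unfolding rect_def using t1 t2 unfolding topology_def by blast
  qed
  \<comment> \<open>Projections replace a choice of sides for each rectangle. They are the sides of
    a non-empty rectangle; for an empty one both are empty, hence open as well.\<close>
  define dm where "dm r = Sep x (\<lambda>p. \<exists>q. pair p q mem r)" for r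
  define rn where "rn r = Sep y (\<lambda>q. \<exists>p. pair p q mem r)" for r
  have ddm: "DF (\<lambda>e. dm (e 0))" unfolding dm_def by (intro dfn)
  have drn: "DF (\<lambda>e. rn (e 0))" unfolding rn_def by (intro dfn)
  have dm: "p mem dm r \<longleftrightarrow> p mem x \<and> (\<exists>q. pair p q mem r)" for p r
    unfolding dm_def by (rule mem_Sep) (intro dfn)
  have rn: "q mem rn r \<longleftrightarrow> q mem y \<and> (\<exists>p. pair p q mem r)" for q r
    unfolding rn_def by (rule mem_Sep) (intro dfn)
  have rect_dm: "dm r mem t1" "rn r mem t2" "p mem r \<longleftrightarrow> (\<exists>a b. a mem dm r \<and> b mem rn r \<and> p = pair a b)"
    if "rect r" for r p
  proof -
    obtain u v where uv: "u mem t1" "v mem t2" "r = cart u v" using \<open>rect r\<close> unfolding rect_def by blast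
    have eset_t: "eset mem t1" "eset mem t2" using t1 t2 unfolding topology_def by blast+
    have dm': "a mem dm r \<longleftrightarrow> a mem u \<and> (\<exists>q. q mem v)" for a
      unfolding dm uv(3) using sub1[OF uv(1)] unfolding sub_def by auto
    have rn': "a mem rn r \<longleftrightarrow> a mem v \<and> (\<exists>q. q mem u)" for a
      unfolding rn uv(3) using sub2[OF uv(2)] unfolding sub_def by auto
    have "dm r = u \<or> dm r = eset" unfolding eq_iff_mem dm' by auto
    then show "dm r mem t1" using uv eset_t by auto
    have "rn r = v \<or> rn r = eset" unfolding eq_iff_mem rn' by auto
    then show "rn r mem t2" using uv eset_t by auto
    show "p mem r \<longleftrightarrow> (\<exists>a b. a mem dm r \<and> b mem rn r \<and> p = pair a b)"
      unfolding dm' rn' unfolding uv(3) mem_cart by blast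
  qed
  have "stable b"
    unfolding stable_def
  proof (rule exI[of _ b], intro conjI allI impI)
    fix u show "u mem b \<longleftrightarrow> u mem b \<or> u = eset" using b eset_rect by blast
  next
    fix s assume s: "sub s b \<and> (\<exists>z. z mem s) \<and> countable s"
    then obtain z where z: "z mem s" by blast
    have sr: "rect r" if "r mem s" for r using that s b unfolding sub_def by blast
    let ?U = "meet (Rep s dm)" and ?V = "meet (Rep s rn)"
    have U: "a mem ?U \<longleftrightarrow> (\<forall>r. r mem s \<longrightarrow> a mem dm r)" for a
      using mem_meet[of "dm z" "Rep s dm" a] z unfolding mem_Rep[OF ddm] by blast
    have V: "a mem ?V \<longleftrightarrow> (\<forall>r. r mem s \<longrightarrow> a mem rn r)" for a
      using mem_meet[of "rn z" "Rep s rn" a] z unfolding mem_Rep[OF drn] by blast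
    have "?U mem t1" "?V mem t2"
      by (rule countable_meet_open[OF X _ z ddm] countable_meet_open[OF Y _ z drn];
        use s sr rect_dm(1,2) in blast)+
    then have "rect (cart ?U ?V)" unfolding rect_def by blast
    moreover have "inter_of (cart ?U ?V) s"
      unfolding inter_of_def
    proof
      fix p
      show "p mem cart ?U ?V \<longleftrightarrow> (\<forall>v. v mem s \<longrightarrow> p mem v)"
      proof
        assume "p mem cart ?U ?V"
        then show "\<forall>v. v mem s \<longrightarrow> p mem v" unfolding mem_cart U V using rect_dm(3) sr by blast
      next
        assume p: "\<forall>v. v mem s \<longrightarrow> p mem v"
        then obtain a' b' where ab: "p = pair a' b'" using rect_dm(3)[OF sr[OF z]] z by blast
        have "a' mem dm r \<and> b' mem rn r" if "r mem s" for r
          using rect_dm(3)[OF sr[OF that], of p] p that ab by auto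
        then show "p mem cart ?U ?V" unfolding ab pair_mem_cart U V by blast
      qed
    qed
    ultimately show "\<exists>i. inter_of i s \<and> i mem b" using b by blast
  qed
  then have "pspace (cart x y) t" by (rule ABP[OF \<open>topology t (cart x y)\<close> base])
  then show ?thesis using t[unfolded opn_def rect_def] by (intro exI[of _ t]) simp
qed

section \<open>Partial choice functions\<close>

lemma linordD:
  assumes "linord r a"
  shows linord_antisym: "pair x y mem r \<Longrightarrow> pair y x mem r \<Longrightarrow> x = y"
    and linord_trans: "pair x y mem r \<Longrightarrow> pair y w mem r \<Longrightarrow> pair x w mem r"
    and linord_total: "x mem a \<Longrightarrow> y mem a \<Longrightarrow> pair x y mem r \<or> pair y x mem r"
proof -
  note 1 = assms[unfolded linord_def, THEN conjunct2, THEN conjunct2]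
  show "pair x y mem r \<Longrightarrow> pair y x mem r \<Longrightarrow> x = y" using 1[THEN conjunct1] by blast
  note 2 = 1[THEN conjunct2]
  show "pair x y mem r \<Longrightarrow> pair y w mem r \<Longrightarrow> pair x w mem r" using 2[THEN conjunct1] by blast
  show "x mem a \<Longrightarrow> y mem a \<Longrightarrow> pair x y mem r \<or> pair y x mem r"
    using 2[THEN conjunct2] by blast
qed

lemma CACCLO_imp_PCACCLO:
  assumes "choice g A omega"
  shows "\<exists>I g. sub I omega \<and> \<not> (\<exists>n. n mem omega \<and> eqp I n) \<and> choice g A I"
proof -
  have "\<not> eqp omega n" if "n mem omega" for n
    by (rule unbounded_infinite[OF _ sub_refl that]) (use omega_suc mem_suc in blast)
  then show ?thesis using assms sub_refl by blast
qed

lemma sclo_linord: "sclo r a \<Longrightarrow> linord r a"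
  by (simp add: sclo_def)

lemma sclo_max:
  assumes "sclo r a" "sub s a" "z mem s" "countable s"
  shows "\<exists>m. m mem s \<and> (\<forall>x. x mem s \<longrightarrow> pair x m mem r)"
  using assms(1)[unfolded sclo_def, THEN conjunct2] assms(2-) by blast

text \<open>The partial choice function is sought for the finite products of the members of the family:
  \<open>lexle f n\<close> orders tuples of length \<open>n\<close>, not distinguishing tuples that agree below \<open>n\<close>.\<close>

definition lexle :: "'a \<Rightarrow> 'a \<Rightarrow> 'a \<Rightarrow> 'a \<Rightarrow> bool" where
  "lexle f n s t \<longleftrightarrow> (\<forall>j. j mem n \<longrightarrow> app s j = app t j) \<or>
    (\<exists>i. i mem n \<and> (\<forall>j. j mem i \<longrightarrow> app s j = app t j) \<and> app s i \<noteq> app t i \<and>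
      pair (app s i) (app t i) mem app f i)"

lemma D_lexle: "DF G \<Longrightarrow> DF H \<Longrightarrow> D (\<lambda>e. lexle f n (G e) (H e))"
  by (rule D_comp2[of "lexle f n"]) (unfold lexle_def, intro dfn)

lemma lexle_less:
  assumes "i mem n" "\<And>j. j mem i \<Longrightarrow> app s j = app t j" "app s i \<noteq> app t i"
    "pair (app s i) (app t i) mem app f i"
  shows "lexle f n s t"
  using assms unfolding lexle_def by blast

lemma lexle_cases:
  assumes "lexle f n s t"
  obtains (eq) "\<And>j. j mem n \<Longrightarrow> app s j = app t j"
    | (less) i where "i mem n" "\<And>j. j mem i \<Longrightarrow> app s j = app t j" "app s i \<noteq> app t i"
      "pair (app s i) (app t i) mem app f i"
  using assms unfolding lexle_def by blast

text \<open>Both comparisons would name a place of difference. If the two places differ, the other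
  comparison makes the smaller one a place of agreement; if they coincide, antisymmetry of
  \<open>app f i\<close> applies.\<close>

lemma lexle_antisym:
  assumes n: "n mem omega" and f: "\<And>i. i mem n \<Longrightarrow> linord (app f i) (a i)"
    and st: "lexle f n s t" "lexle f n t s" and j: "j mem n"
  shows "app s j = app t j"
  using st(1)
proof (cases rule: lexle_cases)
  case (less i)
  from st(2) show ?thesis
  proof (cases rule: lexle_cases)
    case eq
    then show ?thesis using j by simp
  next
    case (less k)
    consider "i mem k" | "i = k" | "k mem i"
      using omega_linear omega_mem[OF n] \<open>i mem n\<close> \<open>k mem n\<close> by blast
    then show ?thesis
    proof cases
      case 1
      then show ?thesis using less(2)[of i] \<open>app s i \<noteq> app t i\<close> by simp
    next
      case 2
      then show ?thesis
        using linord_antisym[OF f[OF \<open>i mem n\<close>]] less(4) \<open>app s i \<noteq> app t i\<close>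
          \<open>pair (app s i) (app t i) mem app f i\<close> by blast
    next
      case 3
      then show ?thesis using \<open>\<And>j. j mem i \<Longrightarrow> app s j = app t j\<close>[of k] less(3) by simp
    qed
  qed
qed (use j in simp)

text \<open>The smaller of the two places decides between \<open>s\<close> and \<open>u\<close>. At
  a common place transitivity applies, and antisymmetry excludes
  \<open>app s i = app u i\<close>.\<close>

lemma lexle_trans:
  assumes n: "n mem omega" and f: "\<And>i. i mem n \<Longrightarrow> linord (app f i) (a i)"
    and st: "lexle f n s t" and tu: "lexle f n t u"
  shows "lexle f n s u"
  using st
proof (cases rule: lexle_cases)
  case eq
  from tu show ?thesis
  proof (cases rule: lexle_cases)
    case eq
    then show ?thesis using \<open>\<And>j. j mem n \<Longrightarrow> app s j = app t j\<close> unfolding lexle_def by simp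
  next
    case (less k)
    have "app s j = app t j" if "j mem k" for j
      using eq omega_trans[OF n less(1) that] by simp
    then show ?thesis
      using less eq[OF less(1)] by (intro lexle_less[of k]) auto
  qed
next
  case (less i)
  note i = less
  from tu show ?thesis
  proof (cases rule: lexle_cases)
    case eq
    have "app u j = app t j" if "j mem i" for j
      using eq omega_trans[OF n i(1) that] by simp
    then show ?thesis
      using i eq[OF i(1)] by (intro lexle_less[of i]) auto
  next
    case (less k)
    consider "i mem k" | "i = k" | "k mem i"
      using omega_linear omega_mem[OF n] i(1) less(1) by blast
    then show ?thesis
    proof cases
      case 1
      have "app t j = app u j" if "j mem i" for j
        using less(2) omega_trans[OF omega_mem[OF n less(1)] 1 that] by simp
      then show ?thesis using i less(2)[OF 1] by (intro lexle_less[of i]) auto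
    next
      case 2
      have "pair (app s i) (app u i) mem app f i"
        using linord_trans[OF f[OF i(1)]] i(4) less(4) 2 by blast
      moreover have "app s i \<noteq> app u i"
        using linord_antisym[OF f[OF i(1)]] i(3,4) less(4) 2 by metis
      ultimately show ?thesis using i less(2) 2 by (intro lexle_less[of i]) auto
    next
      case 3
      have "app s j = app t j" if "j mem k" for j
        using i(2) omega_trans[OF omega_mem[OF n i(1)] 3 that] by simp
      then show ?thesis using less i(2)[OF 3] by (intro lexle_less[of k]) auto
    qed
  qed
qed

lemma lexle_total:
  assumes n: "n mem omega" and f: "\<And>i. i mem n \<Longrightarrow> linord (app f i) (a i)"
    and s: "\<And>i. i mem n \<Longrightarrow> app s i mem a i" and t: "\<And>i. i mem n \<Longrightarrow> app t i mem a i"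
  shows "lexle f n s t \<or> lexle f n t s"
proof (cases "\<forall>j. j mem n \<longrightarrow> app s j = app t j")
  case False
  define N where "N = Sep n (\<lambda>j. app s j \<noteq> app t j)"
  have N: "j mem N \<longleftrightarrow> j mem n \<and> app s j \<noteq> app t j" for j
    unfolding N_def by (rule mem_Sep) (intro dfn)
  have Nw: "sub N omega" unfolding sub_def N using omega_mem[OF n] by blast
  obtain j where j: "j mem N" using False N by blast
  define i where "i = lst N"
  have i: "i mem n" "app s i \<noteq> app t i" using lst_mem[OF Nw j] N unfolding i_def by auto
  have eq: "app s j = app t j" if "j mem i" for j
  proof (rule ccontr)
    assume "app s j \<noteq> app t j"
    then have "j mem N" using N omega_trans[OF n i(1) that] by blast
    then have "i = j \<or> i mem j" using lst_le[OF Nw j] i_def by blast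
    then show False using that mem_asym by auto
  qed
  then show ?thesis
    using linord_total[OF f[OF i(1)] s[OF i(1)] t[OF i(1)]] i
      lexle_less[of i n s t f] lexle_less[of i n t s f] by metis
qed (auto simp: lexle_def)

text \<open>Coordinates are maximized one after the other: among the members of \<open>S\<close>
  that agree below \<open>k\<close> with a maximum \<open>u0\<close> for length \<open>k\<close>,
  the \<open>k\<close>-th coordinates form a countable subset of \<open>a k\<close>, and a member
  attaining its maximum is maximal for length \<open>suc k\<close>. The induction carries mere
  existence, so no choices accumulate.\<close>

lemma lexle_max:
  assumes n: "n mem omega" and f: "\<And>i. i mem n \<Longrightarrow> sclo (app f i) (a i)"
    and s: "\<And>s i. s mem S \<Longrightarrow> i mem n \<Longrightarrow> app s i mem a i" and S: "z mem S" "countable S"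
  shows "\<exists>u. u mem S \<and> (\<forall>s. s mem S \<longrightarrow> lexle f n s u)"
proof -
  have "k = n \<or> k mem n \<longrightarrow> (\<exists>u. u mem S \<and> (\<forall>s. s mem S \<longrightarrow> lexle f k s u))" if "k mem omega" for k
    using that
  proof (rule omega_induct)
    have "D (\<lambda>e. lexle f (e (Suc (Suc 0))) (e 0) (e (Suc 0)))" unfolding lexle_def by (intro dfn)
    then show "D (\<lambda>e. e 0 = n \<or> e 0 mem n \<longrightarrow> (\<exists>u. u mem S \<and> (\<forall>s. s mem S \<longrightarrow> lexle f (e 0) s u)))"
      by (intro dfn)
  next
    show "eset = n \<or> eset mem n \<longrightarrow> (\<exists>u. u mem S \<and> (\<forall>s. s mem S \<longrightarrow> lexle f eset s u))"
      using S(1) by (auto simp: lexle_def)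
  next
    fix k assume k: "k mem omega"
      and IH: "k = n \<or> k mem n \<longrightarrow> (\<exists>u. u mem S \<and> (\<forall>s. s mem S \<longrightarrow> lexle f k s u))"
    show "suc k = n \<or> suc k mem n \<longrightarrow> (\<exists>u. u mem S \<and> (\<forall>s. s mem S \<longrightarrow> lexle f (suc k) s u))"
    proof
      assume "suc k = n \<or> suc k mem n"
      then have kn: "k mem n" using omega_trans[OF n, of "suc k" k] by auto
      then obtain u0 where u0: "u0 mem S" "\<And>s. s mem S \<Longrightarrow> lexle f k s u0" using IH by blast
      define S' where "S' = Sep S (\<lambda>s. \<forall>j. j mem k \<longrightarrow> app s j = app u0 j)"
      have S': "s mem S' \<longleftrightarrow> s mem S \<and> (\<forall>j. j mem k \<longrightarrow> app s j = app u0 j)" for s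
        unfolding S'_def by (rule mem_Sep) (intro dfn)
      define C where "C = Rep S' (\<lambda>s. app s k)"
      have dC: "DF (\<lambda>e. app (e 0) k)" by (intro dfn)
      have C: "y mem C \<longleftrightarrow> (\<exists>s. s mem S' \<and> y = app s k)" for y
        unfolding C_def by (rule mem_Rep[OF dC])
      have "sub S' S" unfolding sub_def S' by blast
      then have "countable C" unfolding C_def by (rule countable_Rep[OF countable_sub[OF S(2)] dC])
      moreover have "sub C (a k)" unfolding sub_def C S' using s kn by blast
      moreover have "app u0 k mem C" unfolding C S' using u0(1) by blast
      ultimately obtain m where m: "m mem C" "\<And>x. x mem C \<Longrightarrow> pair x m mem app f k"
        using sclo_max[OF f[OF kn]] by blast
      then obtain u where u: "u mem S" "\<And>j. j mem k \<Longrightarrow> app u j = app u0 j" "m = app u k"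
        unfolding C S' by blast
      have "lexle f (suc k) s u" if s: "s mem S" for s
        using u0(2)[OF s]
      proof (cases rule: lexle_cases)
        case eq
        then have "app s k mem C" unfolding C S' using s by blast
        then have 1: "pair (app s k) (app u k) mem app f k" using m(2) u(3) by blast
        show ?thesis
        proof (cases "app s k = app u k")
          case True
          then show ?thesis unfolding lexle_def using eq u(2) by auto
        next
          case False
          then show ?thesis using 1 eq u(2) by (intro lexle_less[of k]) auto
        qed
      next
        case (less i)
        have "app u j = app u0 j" if "j mem i" for j
          using u(2) omega_trans[OF k less(1) that] by simp
        then show ?thesis using less u(2)[OF less(1)] by (intro lexle_less[of i]) auto
      qed
      then show "\<exists>u. u mem S \<and> (\<forall>s. s mem S \<longrightarrow> lexle f (suc k) s u)" using u(1) by blast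
    qed
  qed
  then show ?thesis using n by blast
qed

text \<open>Each induction step adds one element, so finite products are non-empty without any
  choice principle.\<close>

lemma finite_choice:
  assumes "family A" "n mem omega"
  shows "\<exists>h. fun_on h n \<and> (\<forall>i. i mem n \<longrightarrow> app h i mem app A i)"
  using assms(2)
proof (rule omega_induct, intro dfn)
  have "fun_on eset eset" unfolding fun_on_def by simp
  then show "\<exists>h. fun_on h eset \<and> (\<forall>i. i mem eset \<longrightarrow> app h i mem app A i)" by auto
next
  fix n assume n: "n mem omega" and "\<exists>h. fun_on h n \<and> (\<forall>i. i mem n \<longrightarrow> app h i mem app A i)"
  then obtain h where h: "\<And>i. i mem n \<Longrightarrow> app h i mem app A i" by blast
  obtain a where a: "a mem app A n" using assms(1) n unfolding family_def by blast
  have d: "DF (\<lambda>e. if e 0 = n then a else app h (e 0))" by (intro dfn)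
  show "\<exists>h. fun_on h (suc n) \<and> (\<forall>i. i mem suc n \<longrightarrow> app h i mem app A i)"
    by (rule exI[of _ "lam (suc n) (\<lambda>i. if i = n then a else app h i)"])
      (use h a in \<open>simp add: fun_on_lam[OF d] app_lam[OF d]\<close>)
qed

lemma PCACCLO_imp_CACCLO:
  assumes PCACCLO: "\<And>A f. family A \<Longrightarrow> orderings f A \<Longrightarrow>
      \<exists>I g. sub I omega \<and> \<not> (\<exists>n. n mem omega \<and> eqp I n) \<and> choice g A I"
    and A: "family A" and f: "orderings f A"
  shows "\<exists>g. choice g A omega"
proof -
  define U where "U = Uni (Rep omega (app A))"
  have dA: "DF (\<lambda>e. app A (e 0))" by (intro dfn)
  have U: "x mem U" if "i mem omega" "x mem app A i" for x i
    unfolding U_def mem_Uni mem_Rep[OF dA] using that by blast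
  have sclo: "sclo (app f i) (app A i)" if "i mem omega" for i using f that unfolding orderings_def by blast
  define B where "B n = Sep (Pw (cart n U)) (\<lambda>h. fun_on h n \<and> (\<forall>i. i mem n \<longrightarrow> app h i mem app A i))" for n
  have dB: "DF (\<lambda>e. B (e 0))" unfolding B_def by (intro dfn)
  have B: "h mem B n \<longleftrightarrow> fun_on h n \<and> (\<forall>i. i mem n \<longrightarrow> app h i mem app A i)" if n: "n mem omega" for h n
  proof -
    have "h mem B n \<longleftrightarrow> h mem Pw (cart n U) \<and> fun_on h n \<and> (\<forall>i. i mem n \<longrightarrow> app h i mem app A i)"
      unfolding B_def by (rule mem_Sep) (intro dfn)
    moreover have "sub h (cart n U)" if "fun_on h n" "\<forall>i. i mem n \<longrightarrow> app h i mem app A i"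
      unfolding sub_def mem_fun[OF that(1)] using that(2) U[OF omega_mem[OF n]] by auto
    ultimately show ?thesis by auto
  qed
  define r where "r n = Sep (cart (B n) (B n)) (\<lambda>p. \<exists>s t. p = pair s t \<and> lexle f n s t)" for n
  have "D (\<lambda>e. lexle f (e (Suc (Suc (Suc 0)))) (e (Suc 0)) (e 0))" unfolding lexle_def by (intro dfn)
  moreover have dB': "DF F \<Longrightarrow> DF (\<lambda>e. B (F e))" for F by (rule DF_subst1[OF dB])
  ultimately have dr: "DF (\<lambda>e. r (e 0))" unfolding r_def by (intro dfn dB')
  have r: "pair s t mem r n \<longleftrightarrow> s mem B n \<and> t mem B n \<and> lexle f n s t" for s t n
  proof -
    have "pair s t mem r n \<longleftrightarrow> pair s t mem cart (B n) (B n) \<and> (\<exists>s' t'. pair s t = pair s' t' \<and> lexle f n s' t')"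
      unfolding r_def by (rule mem_Sep) (intro dfn D_lexle)
    then show ?thesis by simp
  qed
  have rsub: "sub (r n) (cart (B n) (B n))" for n
    unfolding r_def by (rule sub_Sep) (intro dfn D_lexle)
  have scl: "sclo (r n) (B n)" if n: "n mem omega" for n
    unfolding sclo_def
  proof (intro conjI allI impI)
    have lin: "linord (app f i) (app A i)" if "i mem n" for i
      using sclo_linord[OF sclo[OF omega_mem[OF n that]]] .
    show "linord (r n) (B n)"
      unfolding linord_def
    proof (intro conjI allI impI; (elim conjE)?)
      fix p assume "p mem r n"
      then show "\<exists>x y. x mem B n \<and> y mem B n \<and> p = pair x y" using subD[OF rsub] mem_cart by blast
    next
      fix s assume "s mem B n"
      then show "pair s s mem r n" unfolding r by (simp add: lexle_def)
    next
      fix s t assume "pair s t mem r n" "pair t s mem r n"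
      then have *: "s mem B n" "t mem B n" "lexle f n s t" "lexle f n t s" unfolding r by auto
      have "app s j = app t j" if "j mem n" for j by (rule lexle_antisym[OF n lin *(3,4) that])
      then show "s = t" using *(1,2) fun_ext[of s n t] unfolding B[OF n] by blast
    next
      fix s t u assume "pair s t mem r n" "pair t u mem r n"
      then show "pair s u mem r n"
        using lexle_trans[OF n lin, of s t u] unfolding r by simp
    next
      fix s t assume "s mem B n" "t mem B n"
      then show "pair s t mem r n \<or> pair t s mem r n"
        using lexle_total[OF n lin, of s t] unfolding r B[OF n] by auto
    qed
  next
    fix S assume S: "sub S (B n) \<and> (\<exists>z. z mem S) \<and> countable S"
    then obtain z where z: "z mem S" by blast
    have "\<exists>u. u mem S \<and> (\<forall>s. s mem S \<longrightarrow> lexle f n s u)"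
    proof (rule lexle_max[OF n _ _ z])
      show "sclo (app f i) (app A i)" if "i mem n" for i using sclo omega_mem[OF n that] by blast
      show "app s i mem app A i" if "s mem S" "i mem n" for s i
        using S subD that B[OF n] by blast
    qed (use S in blast)
    then show "\<exists>m. m mem S \<and> (\<forall>x. x mem S \<longrightarrow> pair x m mem r n)" unfolding r using S subD by blast
  qed
  have "family (lam omega B)"
    unfolding family_def using finite_choice[OF A]
    by (simp add: fun_on_lam[OF dB] app_lam[OF dB] B)
  moreover have "orderings (lam omega r) (lam omega B)"
    unfolding orderings_def using scl by (simp add: fun_on_lam[OF dr] app_lam[OF dr] app_lam[OF dB])
  ultimately obtain I g where I: "sub I omega" "\<not> (\<exists>n. n mem omega \<and> eqp I n)"
    and g: "choice g (lam omega B) I" using PCACCLO by blast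
  \<comment> \<open>Coordinate \<open>i\<close> is read off the chosen tuple of least length above
    \<open>i\<close>; taking the least length makes \<open>h\<close> definable.\<close>
  define h where "h i = app (app g (lst (Sep I (\<lambda>n. i mem n)))) i" for i
  have dh: "DF (\<lambda>e. h (e 0))" unfolding h_def by (intro dfn)
  have "h i mem app A i" if i: "i mem omega" for i
  proof -
    define J where "J = Sep I (\<lambda>n. i mem n)"
    have J: "n mem J \<longleftrightarrow> n mem I \<and> i mem n" for n unfolding J_def by (rule mem_Sep) (intro dfn)
    obtain m where "m mem J" using infinite_unbounded[OF I i] J by blast
    moreover have "sub J omega" unfolding sub_def J using subD[OF I(1)] by blast
    ultimately have l: "lst J mem I" "i mem lst J" using lst_mem[of J m] J by blast+
    then have lw: "lst J mem omega" using subD[OF I(1)] by blast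
    have "app g (lst J) mem app (lam omega B) (lst J)" using g l(1) unfolding choice_def by blast
    then have "app g (lst J) mem B (lst J)" using app_lam[OF dB lw] by simp
    then show ?thesis unfolding h_def J_def[symmetric] using B[OF lw] l(2) by blast
  qed
  then have "choice (lam omega h) A omega"
    unfolding choice_def by (simp add: fun_on_lam[OF dh] app_lam[OF dh])
  then show ?thesis ..
qed

section \<open>A zero-dimensional space from strongly complete orderings\<close>

text \<open>Lets binary intersections of neighbourhoods be treated as countable ones.\<close>

lemma countable_upair: "countable (upair x y)"
proof (rule countableI[of "\<lambda>n z. (n = eset \<and> z = x) \<or> (n = suc eset \<and> z = y)"])
  show "D (\<lambda>e. (e 0 = eset \<and> e 1 = x) \<or> (e 0 = suc eset \<and> e 1 = y))" by (intro dfn)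
  show "\<exists>n. n mem omega \<and> (n = eset \<and> z = x \<or> n = suc eset \<and> z = y)" if "z mem upair x y" for z
    using that unfolding mem_upair using omega_0 omega_suc[OF omega_0] by blast
qed (use suc_ne_eset in metis)

text \<open>The isolated points are the pairs \<open>(i, y)\<close> with \<open>y\<close> in \<open>A\<^sub>i\<close> or \<open>y = A\<^sub>i\<close>; the latter is an
  extra point of the \<open>i\<close>-th column outside of its ordering.  The empty set is the point at infinity.  A
  basic neighbourhood of infinity cuts finitely many columns at some \<open>a\<close> in \<open>A\<^sub>i\<close>, keeping the points
  strictly above \<open>a\<close>.\<close>

definition points :: "'a \<Rightarrow> 'a" where
  "points A = cup (upair eset eset) (Sep (cart omega (cup (Uni (Rep omega (app A))) (Rep omega (app A))))
    (\<lambda>p. \<exists>i y. i mem omega \<and> (y mem app A i \<or> y = app A i) \<and> p = pair i y))"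

definition cut :: "'a \<Rightarrow> 'a \<Rightarrow> 'a \<Rightarrow> 'a \<Rightarrow> 'a \<Rightarrow> bool" where
  "cut A f i a U \<longleftrightarrow> (\<forall>y. pair i y mem U \<longleftrightarrow> y mem app A i \<and> pair a y mem app f i \<and> a \<noteq> y)"

definition full :: "'a \<Rightarrow> 'a \<Rightarrow> 'a \<Rightarrow> bool" where
  "full A i U \<longleftrightarrow> (\<forall>y. y mem app A i \<or> y = app A i \<longrightarrow> pair i y mem U)"

definition nbh :: "'a \<Rightarrow> 'a \<Rightarrow> 'a \<Rightarrow> bool" where
  "nbh A f U \<longleftrightarrow> sub U (points A) \<and> eset mem U \<and> (\<exists>n. n mem omega \<and> (\<forall>i. i mem omega \<longrightarrow>
    (i mem n \<and> (\<exists>a. a mem app A i \<and> cut A f i a U)) \<or> full A i U))"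

lemma D_nbh: "DF F \<Longrightarrow> D (\<lambda>e. nbh A f (F e))"
  by (rule D_comp1[of "nbh A f"]) (unfold nbh_def cut_def full_def, intro dfn)

lemma mem_points: "p mem points A \<longleftrightarrow>
  p = eset \<or> (\<exists>i y. i mem omega \<and> (y mem app A i \<or> y = app A i) \<and> p = pair i y)"
proof -
  let ?V = "cup (Uni (Rep omega (app A))) (Rep omega (app A))"
  have dA: "DF (\<lambda>e. app A (e 0))" by (intro dfn)
  have 1: "p mem Sep (cart omega ?V) (\<lambda>p. \<exists>i y. i mem omega \<and> (y mem app A i \<or> y = app A i) \<and> p = pair i y)
    \<longleftrightarrow> p mem cart omega ?V \<and> (\<exists>i y. i mem omega \<and> (y mem app A i \<or> y = app A i) \<and> p = pair i y)"
    by (rule mem_Sep) (intro dfn)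
  have 2: "y mem ?V" if "i mem omega" "y mem app A i \<or> y = app A i" for i y
    unfolding mem_cup mem_Uni mem_Rep[OF dA] using that by blast
  have "pair i y mem cart omega ?V" if "i mem omega" "y mem app A i \<or> y = app A i" for i y
    unfolding pair_mem_cart using 2[OF that] that(1) by blast
  then show ?thesis unfolding points_def mem_cup[of _ "upair eset eset"] 1 mem_upair by blast
qed

lemma pair_mem_points: "pair i y mem points A \<longleftrightarrow> i mem omega \<and> (y mem app A i \<or> y = app A i)"
  unfolding mem_points by (simp add: pair_ne_eset)

lemma nbh_points: "nbh A f (points A)"
  unfolding nbh_def full_def pair_mem_points
  by (auto simp: mem_points intro: exI[of _ eset])

text \<open>Cutting one column suffices: at the second component of \<open>z\<close> if that lies in
  \<open>app A i\<close>, because the cut is strict, and at any member otherwise, because every cut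
  drops the extra point.\<close>

lemma nbh_avoid:
  assumes A: "family A" and z: "z mem points A" "z \<noteq> eset"
  shows "\<exists>U. nbh A f U \<and> \<not> z mem U"
proof -
  obtain i v where i: "i mem omega" and v: "v mem app A i \<or> v = app A i" and zi: "z = pair i v"
    using z unfolding mem_points by blast
  obtain a where a: "a mem app A i" "v mem app A i \<Longrightarrow> a = v"
    using A i unfolding family_def by blast
  define U where "U = Sep (points A)
    (\<lambda>p. \<forall>y. p = pair i y \<longrightarrow> y mem app A i \<and> pair a y mem app f i \<and> a \<noteq> y)"
  have U: "p mem U \<longleftrightarrow> p mem points A \<and>
      (\<forall>y. p = pair i y \<longrightarrow> y mem app A i \<and> pair a y mem app f i \<and> a \<noteq> y)" for p
    unfolding U_def by (rule mem_Sep) (intro dfn)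
  have "nbh A f U"
    unfolding nbh_def
  proof (intro conjI)
    show "sub U (points A)" unfolding sub_def U by blast
    show "eset mem U" unfolding U using pair_ne_eset by (metis mem_points)
    have "(j mem suc i \<and> (\<exists>a. a mem app A j \<and> cut A f j a U)) \<or> full A j U" if "j mem omega" for j
    proof (cases "j = i")
      case True
      have "cut A f i a U" unfolding cut_def U pair_mem_points using i by auto
      then show ?thesis using True a(1) by auto
    next
      case False
      then have "full A j U" unfolding full_def U pair_mem_points using that by auto
      then show ?thesis ..
    qed
    then show "\<exists>n. n mem omega \<and> (\<forall>i. i mem omega \<longrightarrow>
        (i mem n \<and> (\<exists>a. a mem app A i \<and> cut A f i a U)) \<or> full A i U)"
      using omega_suc[OF i] by blast
  qed
  moreover have "\<not> z mem U" unfolding U zi using v a(2) by auto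
  ultimately show ?thesis by blast
qed

text \<open>The larger of two different points would belong to the cut at the smaller one but not to
  the cut at itself. Hence a neighbourhood determines where it cuts a column.\<close>

lemma cut_unique:
  assumes r: "linord (app f i) (app A i)" and a: "a mem app A i" "b mem app A i"
    and c: "cut A f i a U" "cut A f i b U"
  shows "a = b"
proof (rule ccontr)
  assume "a \<noteq> b"
  then show False using linord_total[OF r a] a c unfolding cut_def by metis
qed

text \<open>The points \<open>C j\<close> at which members of \<open>s\<close> cut column
  \<open>j\<close> are countable by \<open>cut_unique\<close>, so a non-empty \<open>C j\<close> has
  a maximum \<open>mx j\<close>. These maxima form a choice function on the set \<open>J\<close> of
  cut columns, and \<open>none\<close> makes \<open>J\<close> finite. The intersection cuts column
  \<open>j\<close> in \<open>J\<close> at \<open>mx j\<close> and leaves the other columns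
  full.\<close>

lemma nbh_meet:
  assumes A: "family A" and f: "orderings f A"
    and none: "\<forall>I g. sub I omega \<longrightarrow> choice g A I \<longrightarrow> (\<exists>n. n mem omega \<and> eqp I n)"
    and s: "countable s" "z mem s" "\<And>U. U mem s \<Longrightarrow> nbh A f U"
  shows "nbh A f (meet s)"
proof -
  have sclo: "sclo (app f i) (app A i)" if "i mem omega" for i using f that unfolding orderings_def by blast
  note lin = sclo_linord[OF sclo]
  define C where "C j = Sep (app A j) (\<lambda>a. \<exists>U. U mem s \<and> cut A f j a U)" for j
  have C: "a mem C j \<longleftrightarrow> a mem app A j \<and> (\<exists>U. U mem s \<and> cut A f j a U)" for a j
    unfolding C_def by (rule mem_Sep) (unfold cut_def, intro dfn)
  have dC: "DF (\<lambda>e. C (e 0))" unfolding C_def cut_def by (intro dfn)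
  have dC': "DF F \<Longrightarrow> DF (\<lambda>e. C (F e))" for F by (rule DF_subst1[OF dC])
  define J where "J = Sep omega (\<lambda>j. \<exists>a. a mem C j)"
  have J: "j mem J \<longleftrightarrow> j mem omega \<and> (\<exists>a. a mem C j)" for j
    unfolding J_def by (rule mem_Sep) (intro dfn dC')
  \<comment> \<open>The union of the singleton of maxima, so that one definable function yields all
    maxima.\<close>
  define mx where "mx j = Uni (Sep (C j) (\<lambda>m. \<forall>x. x mem C j \<longrightarrow> pair x m mem app f j))" for j
  have dm: "DF (\<lambda>e. mx (e 0))" unfolding mx_def by (intro dfn dC')
  have mx: "mx j mem C j" "\<And>x. x mem C j \<Longrightarrow> pair x (mx j) mem app f j" if "j mem J" for j
  proof -
    have jw: "j mem omega" and "\<exists>a. a mem C j" using \<open>j mem J\<close> unfolding J by auto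
    moreover have "countable (C j)"
    proof (rule countable_image[OF s(1), of "\<lambda>U a. cut A f j a U"])
      show "D (\<lambda>e. cut A f j (e 1) (e 0))" unfolding cut_def by (intro dfn)
      show "\<exists>U. U mem s \<and> cut A f j a U" if "a mem C j" for a using that unfolding C by blast
      show "a = a'" if "U mem s" "a mem C j" "a' mem C j" "cut A f j a U" "cut A f j a' U" for U a a'
        using cut_unique[OF lin[OF jw]] that unfolding C by blast
    qed
    moreover have "sub (C j) (app A j)" unfolding sub_def C by blast
    ultimately obtain m where m: "m mem C j" "\<And>x. x mem C j \<Longrightarrow> pair x m mem app f j"
      using sclo_max[OF sclo[OF jw], of "C j"] by blast
    have "x mem Sep (C j) (\<lambda>m. \<forall>x. x mem C j \<longrightarrow> pair x m mem app f j) \<longleftrightarrow>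
        x mem C j \<and> (\<forall>y. y mem C j \<longrightarrow> pair y x mem app f j)" for x
      by (rule mem_Sep) (intro dfn)
    moreover have "x = m" if "x mem C j" "\<forall>y. y mem C j \<longrightarrow> pair y x mem app f j" for x
      using linord_antisym[OF lin[OF jw]] m that by blast
    ultimately have "x mem Sep (C j) (\<lambda>m. \<forall>x. x mem C j \<longrightarrow> pair x m mem app f j) \<longleftrightarrow> x = m" for x
      using m by blast
    then have "mx j = m" unfolding mx_def by (intro ext) simp
    then show "mx j mem C j" "\<And>x. x mem C j \<Longrightarrow> pair x (mx j) mem app f j" using m by auto
  qed
  have Jw: "sub J omega" unfolding sub_def J by blast
  have "choice (lam J mx) A J"
    unfolding choice_def using mx(1) C by (simp add: fun_on_lam[OF dm] app_lam[OF dm])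
  then obtain k where "k mem omega" "eqp J k" using none Jw by blast
  \<comment> \<open>A set of indices equipotent to a natural number is bounded.\<close>
  then obtain n where n: "n mem omega" "\<And>m. m mem J \<Longrightarrow> \<not> n mem m"
    using unbounded_infinite[of J k] Jw by blast
  have Jn: "m mem suc n" if "m mem J" for m
    using n that omega_linear[of m n] subD[OF Jw that] unfolding mem_suc by blast
  have cf: "full A i U \<or> (\<exists>a. a mem C i \<and> cut A f i a U)" if "U mem s" "i mem omega" for i U
    using s(3)[OF that(1)] that unfolding nbh_def C by blast
  have meet: "x mem meet s \<longleftrightarrow> (\<forall>U. U mem s \<longrightarrow> x mem U)" for x by (rule mem_meet[OF s(2)])
  have "(i mem suc n \<and> (\<exists>a. a mem app A i \<and> cut A f i a (meet s))) \<or> full A i (meet s)"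
    if i: "i mem omega" for i
  proof (cases "i mem J")
    case False
    then have "full A i U" if "U mem s" for U using cf[OF that i] J i by blast
    then have "full A i (meet s)" unfolding full_def meet by blast
    then show ?thesis ..
  next
    case True
    have "pair i y mem meet s \<longleftrightarrow> y mem app A i \<and> pair (mx i) y mem app f i \<and> mx i \<noteq> y" for y
    proof
      assume "pair i y mem meet s"
      moreover obtain U where "U mem s" "cut A f i (mx i) U" using mx(1)[OF True] unfolding C by blast
      ultimately show "y mem app A i \<and> pair (mx i) y mem app f i \<and> mx i \<noteq> y"
        unfolding meet cut_def by blast
    next
      assume y: "y mem app A i \<and> pair (mx i) y mem app f i \<and> mx i \<noteq> y"
      show "pair i y mem meet s"
        unfolding meet
      proof (intro allI impI)
        fix U assume "U mem s"
        from cf[OF this i] show "pair i y mem U"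
        proof
          assume "full A i U"
          then show ?thesis using y unfolding full_def by blast
        next
          assume "\<exists>a. a mem C i \<and> cut A f i a U"
          then obtain a where a: "a mem C i" "cut A f i a U" by blast
          have 1: "pair a (mx i) mem app f i" by (rule mx(2)[OF True a(1)])
          then have "pair a y mem app f i" using linord_trans[OF lin[OF i]] y by blast
          moreover have "a \<noteq> y" using 1 y linord_antisym[OF lin[OF i]] by blast
          ultimately show ?thesis using a(2) y unfolding cut_def by blast
        qed
      qed
    qed
    then have "cut A f i (mx i) (meet s)" unfolding cut_def by blast
    moreover have "mx i mem app A i" using mx(1)[OF True] C by blast
    ultimately show ?thesis using Jn[OF True] by blast
  qed
  moreover have "sub (meet s) (points A)" "eset mem meet s"
    using s(2,3) unfolding nbh_def sub_def meet by blast+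
  ultimately show ?thesis unfolding nbh_def using omega_suc[OF n(1)] by blast
qed

lemma AB0P_imp_PCACCLO:
  assumes AB0P: "\<And>x t b b'. topology t x \<Longrightarrow> (\<And>u. u mem b \<longleftrightarrow> u mem t \<and> dif x u mem t) \<Longrightarrow> base b t \<Longrightarrow>
      (\<And>y z. y mem x \<Longrightarrow> z mem x \<Longrightarrow> y \<noteq> z \<Longrightarrow> \<exists>u. u mem t \<and> y mem u \<and> \<not> z mem u) \<Longrightarrow>
      base b' t \<Longrightarrow> stable b' \<Longrightarrow> pspace x t"
    and A: "family A" and f: "orderings f A"
  shows "\<exists>I g. sub I omega \<and> \<not> (\<exists>n. n mem omega \<and> eqp I n) \<and> choice g A I"
proof (rule ccontr)
  assume "\<not> ?thesis"
  then have none: "\<forall>I g. sub I omega \<longrightarrow> choice g A I \<longrightarrow> (\<exists>n. n mem omega \<and> eqp I n)" by blast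
  note nbh_meet = nbh_meet[OF A f none]
  define X where "X = points A"
  have X0: "eset mem X" unfolding X_def mem_points by simp
  \<comment> \<open>All points but infinity are isolated, so only sets containing
    \<open>eset\<close> are subject to a condition.\<close>
  define opn where "opn W \<longleftrightarrow> (eset mem W \<longrightarrow> (\<exists>U. nbh A f U \<and> sub U W))" for W
  define t where "t = Sep (Pw X) opn"
  have t: "W mem t \<longleftrightarrow> sub W X \<and> opn W" for W
    unfolding t_def mem_Pw[symmetric] by (rule mem_Sep) (unfold opn_def, intro dfn D_nbh)
  have nbh_t: "U mem t" if "nbh A f U" for U
    unfolding t opn_def using that sub_refl unfolding X_def by (auto simp: nbh_def)
  have iso_t: "W mem t" if "sub W X" "\<not> eset mem W" for W
    unfolding t opn_def using that by blast
  have sing_t: "upair p p mem t" if "p mem X" "p \<noteq> eset" for p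
    by (rule iso_t) (use that in \<open>auto simp: sub_def\<close>)
  have co_sing_t: "dif X (upair p p) mem t" if p: "p mem X" "p \<noteq> eset" for p
  proof -
    obtain U where U: "nbh A f U" "\<not> p mem U" using nbh_avoid[OF A] p unfolding X_def by blast
    then have "sub U (dif X (upair p p))" unfolding nbh_def X_def sub_def by auto
    moreover have "sub (dif X (upair p p)) X" unfolding sub_def by auto
    ultimately show ?thesis unfolding t opn_def using U by blast
  qed
  have top: "topology t X"
    unfolding topology_def
  proof (intro conjI allI impI)
    show "sub u X" if "u mem t" for u using that t by blast
    show "eset mem t" by (rule iso_t) (auto simp: sub_def)
    show "X mem t" unfolding X_def by (rule nbh_t[OF nbh_points])
  next
    fix u v assume uv: "u mem t \<and> v mem t"
    have "sub (cap u v) X" using uv unfolding t sub_def by auto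
    moreover have "opn (cap u v)"
      unfolding opn_def
    proof
      assume "eset mem cap u v"
      then obtain U V where UV: "nbh A f U" "sub U u" "nbh A f V" "sub V v"
        using uv unfolding t opn_def by auto
      have UVm: "U mem upair U V" by simp
      have "nbh A f (meet (upair U V))"
        by (rule nbh_meet[OF countable_upair UVm]) (use UV in auto)
      moreover have "sub (meet (upair U V)) (cap u v)"
        using UV(2,4) unfolding sub_def mem_meet[OF UVm] by auto
      ultimately show "\<exists>U. nbh A f U \<and> sub U (cap u v)" by blast
    qed
    ultimately show "cap u v mem t" unfolding t ..
  next
    fix s assume s: "sub s t"
    then have st: "sub u X \<and> opn u" if "u mem s" for u using t subD that by blast
    have "sub (Uni s) X" using st unfolding sub_def by auto
    moreover have "opn (Uni s)"
      unfolding opn_def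
    proof
      assume "eset mem Uni s"
      then obtain u where u: "u mem s" "eset mem u" by auto
      then obtain U where "nbh A f U" "sub U u" using st unfolding opn_def by blast
      moreover have "sub U (Uni s)" if "sub U u" for U using that u(1) unfolding sub_def by auto
      ultimately show "\<exists>U. nbh A f U \<and> sub U (Uni s)" by blast
    qed
    ultimately show "Uni s mem t" unfolding t ..
  qed
  define b where "b = Sep t (\<lambda>u. dif X u mem t)"
  have b: "u mem b \<longleftrightarrow> u mem t \<and> dif X u mem t" for u
    unfolding b_def by (rule mem_Sep) (intro dfn)
  have nbh_b: "U mem b" if "nbh A f U" for U
  proof -
    \<comment> \<open>A neighbourhood of infinity is closed because its complement omits
      infinity.\<close>
    have "dif X U mem t" by (rule iso_t) (use that in \<open>auto simp: nbh_def sub_def\<close>)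
    then show ?thesis using nbh_t[OF that] b by blast
  qed
  have local: "(\<exists>U. nbh A f U \<and> p mem U \<and> sub U u) \<or> (p \<noteq> eset \<and> p mem X \<and> sub (upair p p) u)"
    if "u mem t" "p mem u" for u p
  proof (cases "p = eset")
    case True
    then show ?thesis using that unfolding t opn_def nbh_def by blast
  next
    case False
    then show ?thesis using that unfolding t sub_def by auto
  qed
  have base_b: "base b t"
  proof (rule baseI)
    show "sub b t" unfolding sub_def b by blast
    show "\<exists>v. v mem b \<and> p mem v \<and> sub v u" if "u mem t" "p mem u" for u p
      using local[OF that]
    proof
      assume p: "p \<noteq> eset \<and> p mem X \<and> sub (upair p p) u"
      then have "upair p p mem b" using b sing_t co_sing_t by blast
      then show ?thesis using p by (intro exI[of _ "upair p p"]) simp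
    qed (use nbh_b in blast)
  qed
  define b' where "b' = Sep t (\<lambda>u. nbh A f u \<or> (\<exists>p. p mem X \<and> p \<noteq> eset \<and> u = upair p p))"
  have b': "u mem b' \<longleftrightarrow> nbh A f u \<or> (\<exists>p. p mem X \<and> p \<noteq> eset \<and> u = upair p p)" for u
  proof -
    have "u mem b' \<longleftrightarrow> u mem t \<and> (nbh A f u \<or> (\<exists>p. p mem X \<and> p \<noteq> eset \<and> u = upair p p))"
      unfolding b'_def by (rule mem_Sep) (intro dfn D_nbh)
    then show ?thesis using nbh_t sing_t by blast
  qed
  have base_b': "base b' t"
  proof (rule baseI)
    show "sub b' t" unfolding sub_def b'_def using sub_Sep subD by (metis b' b'_def nbh_t sing_t)
    show "\<exists>v. v mem b' \<and> p mem v \<and> sub v u" if "u mem t" "p mem u" for u p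
      using local[OF that]
    proof
      assume p: "p \<noteq> eset \<and> p mem X \<and> sub (upair p p) u"
      then have "upair p p mem b'" using b' by blast
      then show ?thesis using p by (intro exI[of _ "upair p p"]) simp
    qed (use b' in blast)
  qed
  have stable_b': "stable b'"
    unfolding stable_def
  proof (rule exI[of _ "cup b' (upair eset eset)"], intro conjI allI impI)
    show "u mem cup b' (upair eset eset) \<longleftrightarrow> u mem b' \<or> u = eset" for u by simp
  next
    fix s assume s: "sub s (cup b' (upair eset eset)) \<and> (\<exists>z. z mem s) \<and> countable s"
    then obtain z where z: "z mem s" by blast
    \<comment> \<open>If some member of \<open>s\<close> is a singleton or empty, the intersection
      has at most one point, and such a point is isolated; otherwise \<open>nbh_meet\<close>
      applies.\<close>
    have "meet s mem b' \<or> meet s = eset"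
    proof (cases "\<forall>U. U mem s \<longrightarrow> nbh A f U")
      case True
      then have "nbh A f (meet s)" using s by (intro nbh_meet[OF _ z]) auto
      then show ?thesis using b' by blast
    next
      case False
      then obtain U where U: "U mem s" "\<not> nbh A f U" by blast
      have sub: "sub (meet s) U" unfolding sub_def mem_meet[OF z] using U(1) by blast
      have "U mem b' \<or> U = eset" using U(1) s unfolding sub_def by auto
      then consider p where "p mem X" "p \<noteq> eset" "U = upair p p" | "U = eset"
        using U(2) b' by blast
      then show ?thesis
      proof cases
        case 1
        then have p: "x mem meet s \<Longrightarrow> x = p" for x using subD[OF sub] by auto
        have "meet s = eset \<or> meet s = upair p p"
        proof (cases "p mem meet s")
          case True
          have "meet s = upair p p" by (rule ext, unfold mem_upair) (use True p in blast)
          then show ?thesis ..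
        next
          case False
          have "meet s = eset" by (rule ext) (use False p mem_eset in blast)
          then show ?thesis ..
        qed
        then show ?thesis using 1 b' by auto
      next
        case 2
        then have "meet s = eset" using subD[OF sub] by (intro ext) auto
        then show ?thesis ..
      qed
    qed
    then show "\<exists>i. inter_of i s \<and> i mem cup b' (upair eset eset)"
      using inter_of_meet[OF z] by auto
  qed
  have "\<exists>u. u mem t \<and> y mem u \<and> \<not> z mem u" if yz: "y mem X" "z mem X" "y \<noteq> z" for y z
  proof (cases "y = eset")
    case True
    then obtain U where "nbh A f U" "\<not> z mem U" 
      using nbh_avoid[OF A, of z f] yz unfolding X_def by blast
    then show ?thesis using True nbh_t unfolding nbh_def by blast
  next
    case False
    then show ?thesis using sing_t[OF yz(1)] yz(3) by (intro exI[of _ "upair y y"]) auto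
  qed
  then have P: "pspace X t" using AB0P[OF top b base_b _ base_b' stable_b'] by blast
  define F where "F i = dif X (upair (pair i (app A i)) (pair i (app A i)))" for i
  have dF: "DF (\<lambda>e. F (e 0))" unfolding F_def by (intro dfn)
  have pt: "pair i (app A i) mem X" if "i mem omega" for i unfolding X_def pair_mem_points using that by blast
  have "F i mem t" if "i mem omega" for i
    unfolding F_def by (rule co_sing_t[OF pt[OF that] pair_ne_eset])
  then have "meet (Rep omega F) mem t"
    by (rule countable_meet_open[OF P countable_omega omega_0 dF])
  moreover have F0: "F eset mem Rep omega F" unfolding mem_Rep[OF dF] using omega_0 by blast
  moreover have "eset mem F i" for i unfolding F_def using X0 pair_ne_eset by (metis mem_dif mem_upair)
  ultimately obtain U where U: "nbh A f U" "sub U (meet (Rep omega F))"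
    unfolding t opn_def mem_meet[OF F0] mem_Rep[OF dF] by blast
  then obtain n where n: "n mem omega" "\<And>i. i mem omega \<Longrightarrow> \<not> i mem n \<Longrightarrow> full A i U"
    unfolding nbh_def by blast
  \<comment> \<open>Since \<open>n\<close> is not a member of itself, column \<open>n\<close> is
    already full.\<close>
  then have "pair n (app A n) mem U" unfolding full_def by simp
  then have "pair n (app A n) mem F n"
    using subD[OF U(2)] n(1) unfolding mem_meet[OF F0] mem_Rep[OF dF] by blast
  then show False unfolding F_def by simp
qed

section \<open>Dedekind-finite sets of reals\<close>

text \<open>Let \<open>N\<close> be the image of \<open>C\<close> under an injection into
  \<open>omega\<close>. If \<open>N\<close> is bounded, \<open>finite_max\<close> gives the maximum.
  If not, moving each element of \<open>C\<close> to the one with the next index maps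
  \<open>S\<close> injectively into a proper subset, against Dedekind-finiteness.\<close>

lemma countable_max:
  assumes S: "\<not> (\<exists>s. sub s S \<and> s \<noteq> S \<and> eqp S s)"
    and le: "D (\<lambda>e. le (e 0) (e 1))"
    and total: "\<And>x y. x mem S \<Longrightarrow> y mem S \<Longrightarrow> le x y \<or> le y x"
    and trans: "\<And>x y w. x mem S \<Longrightarrow> y mem S \<Longrightarrow> w mem S \<Longrightarrow> le x y \<Longrightarrow> le y w \<Longrightarrow> le x w"
    and C: "countable C" "sub C S" "c mem C"
  shows "\<exists>m. m mem C \<and> (\<forall>x. x mem C \<longrightarrow> le x m)"
proof -
  obtain f where f: "\<And>x. x mem C \<Longrightarrow> app f x mem omega"
    "\<And>x y. x mem C \<Longrightarrow> y mem C \<Longrightarrow> app f x = app f y \<Longrightarrow> x = y" using countableD[OF C(1)] by auto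
  define N where "N = Rep C (app f)"
  have N: "n mem N \<longleftrightarrow> (\<exists>x. x mem C \<and> n = app f x)" for n
    unfolding N_def by (rule mem_Rep) (intro dfn)
  have Nw: "sub N omega" unfolding sub_def N using f(1) by blast
  have le': "DF F \<Longrightarrow> DF G \<Longrightarrow> D (\<lambda>e. le (F e) (G e))" for F G by (rule D_comp2[of le, OF le])
  show ?thesis
  proof (cases "\<exists>n. n mem omega \<and> sub N n")
    case True
    then obtain n where n: "n mem omega" "sub N n" by blast
    define r where "r i j \<longleftrightarrow> (\<exists>x y. x mem C \<and> y mem C \<and> app f x = i \<and> app f y = j \<and> le x y)" for i j
    have r: "r (app f x) (app f y) \<longleftrightarrow> le x y" if "x mem C" "y mem C" for x y
      unfolding r_def using f(2) that by blast
    have "\<exists>k. k mem N \<and> (\<forall>j. j mem N \<longrightarrow> r j k)"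
    proof (rule finite_max[OF _ _ _ n])
      show "D (\<lambda>e. r (e 0) (e 1))" unfolding r_def by (intro dfn le')
      show "\<exists>k. k mem N" using N C(3) by blast
      show "r i j \<or> r j i" if ij: "i mem N" "j mem N" for i j
      proof -
        obtain x y where "x mem C" "i = app f x" "y mem C" "j = app f y" using ij unfolding N by blast
        then show ?thesis using r total[of x y] subD[OF C(2)] by simp
      qed
      show "r i k" if ijk: "i mem N" "j mem N" "k mem N" "r i j" "r j k" for i j k
      proof -
        obtain x y w where "x mem C" "i = app f x" "y mem C" "j = app f y" "w mem C" "k = app f w"
          using ijk(1-3) unfolding N by blast
        then show ?thesis using ijk(4,5) r trans[of x y w] subD[OF C(2)] by simp
      qed
    qed
    then obtain k where k: "k mem N" "\<And>j. j mem N \<Longrightarrow> r j k" by blast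
    then obtain m where m: "m mem C" "k = app f m" unfolding N by blast
    have "le x m" if "x mem C" for x using k(2)[of "app f x"] r[OF that m(1)] m(2) that N by blast
    then show ?thesis using m(1) by blast
  next
    case False
    have unb: "\<exists>m. m mem N \<and> n mem m" if n: "n mem omega" for n
    proof (rule ccontr)
      assume *: "\<not> ?thesis"
      have "sub N (suc n)"
        unfolding sub_def mem_suc using * omega_linear[OF n] subD[OF Nw] by blast
      then show False using False omega_suc[OF n] by blast
    qed
    define nx where "nx i = lst (Sep N (\<lambda>m. i mem m))" for i
    have nx: "nx i mem N" "i mem nx i" "\<And>m. m mem N \<Longrightarrow> i mem m \<Longrightarrow> nx i = m \<or> nx i mem m" if i: "i mem omega" for i
    proof -
      have M: "m mem Sep N (\<lambda>m. i mem m) \<longleftrightarrow> m mem N \<and> i mem m" for m by (rule mem_Sep) (intro dfn)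
      obtain m where m: "m mem Sep N (\<lambda>m. i mem m)" using unb[OF i] M by blast
      have w: "sub (Sep N (\<lambda>m. i mem m)) omega"
        unfolding sub_def M using subD[OF Nw] by blast
      show "nx i mem N" "i mem nx i" using lst_mem[OF w m] M unfolding nx_def by blast+
      show "nx i = m \<or> nx i mem m" if "m mem N" "i mem m" for m
        using lst_le[OF w m, of m] M that unfolding nx_def by blast
    qed
    \<comment> \<open>The inverse of \<open>f\<close>, as the union of a singleton.\<close>
    define g where "g i = Uni (Sep C (\<lambda>y. app f y = i))" for i
    have g: "g (app f x) = x" if "x mem C" for x
    proof -
      have "y mem Sep C (\<lambda>y. app f y = app f x) \<longleftrightarrow> y mem C \<and> app f y = app f x" for y
        by (rule mem_Sep) (intro dfn)
      then have "y mem Sep C (\<lambda>y. app f y = app f x) \<longleftrightarrow> y = x" for y using f(2) that by blast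
      then show ?thesis unfolding g_def by (intro ext) simp
    qed
    define F where "F x = (if x mem C then g (nx (app f x)) else x)" for x
    have dF: "DF (\<lambda>e. F (e 0))" unfolding F_def g_def nx_def by (intro dfn)
    have FC: "F x mem C \<and> app f (F x) = nx (app f x)" if x: "x mem C" for x
    proof -
      obtain y where "y mem C" "nx (app f x) = app f y" using nx(1)[OF f(1)[OF x]] N by blast
      then show ?thesis using g x unfolding F_def by simp
    qed
    have FnC: "F x = x" if "\<not> x mem C" for x using that unfolding F_def by simp
    have nx_inj: "\<not> i mem j" if "i mem omega" "j mem N" "nx i = nx j" for i j
    proof
      assume "i mem j"
      then have "nx i = j \<or> nx i mem j" using nx(3)[OF that(1)] that(2) by blast
      moreover have "j mem nx i" using nx(2) subD[OF Nw that(2)] that(3) by simp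
      ultimately show False using mem_asym by auto
    qed
    have FS: "F x mem S" if "x mem S" for x using FC FnC that subD[OF C(2)] by (cases "x mem C") auto
    have inj: "x = y" if xy: "F x = F y" for x y
    proof (cases "x mem C")
      case True
      then have y: "y mem C" using FC FnC xy by metis
      have "nx (app f x) = nx (app f y)" using FC[OF True] FC[OF y] xy by simp
      moreover have "app f x mem N" "app f y mem N" using N True y by blast+
      ultimately have "app f x = app f y"
        using nx_inj omega_linear subD[OF Nw] by metis
      then show ?thesis using f(2) True y by blast
    next
      case False
      then have "\<not> y mem C" using FC FnC xy by metis
      then show ?thesis using FnC False xy by simp
    qed
    \<comment> \<open>The element with the least index is not reached by the shift
      \<open>F\<close>.\<close>
    obtain c0 where c0: "c0 mem C" "app f c0 = lst N" using lst_mem[OF Nw, of "app f c"] N C(3) by metis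
    have "F x \<noteq> c0" for x
    proof
      assume *: "F x = c0"
      then have x: "x mem C" using FnC c0(1) by metis
      have "app f x mem lst N" using FC[OF x] nx(2)[OF f(1)[OF x]] * c0(2) by simp
      moreover have "app f x mem N" using N x by blast
      ultimately show False using lst_le[OF Nw, of "app f x" "app f x"] mem_asym by auto
    qed
    then have "\<not> c0 mem Rep S F" unfolding mem_Rep[OF dF] by metis
    moreover have "c0 mem S" using subD[OF C(2) c0(1)] .
    moreover have "sub (Rep S F) S" unfolding sub_def mem_Rep[OF dF] using FS by blast
    moreover have "eqp S (Rep S F)"
      by (rule eqpI[OF dF]) (use inj in \<open>auto simp: mem_Rep[OF dF]\<close>)
    ultimately show ?thesis using S by metis
  qed
qed

text \<open>Otherwise let \<open>b\<close> be least among the elements with an infinite initial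
  segment. Its strict predecessors are empty or form the initial segment of their maximum, so they
  are finite, and adding \<open>b\<close> keeps them finite. Hence all initial segments are finite,
  in particular that of the maximum of \<open>S\<close>.\<close>

lemma finite_if_max_min:
  assumes le: "D (\<lambda>e. le (e 0) (e 1))"
    and total: "\<And>x y. x mem S \<Longrightarrow> y mem S \<Longrightarrow> le x y \<or> le y x"
    and antisym: "\<And>x y. x mem S \<Longrightarrow> y mem S \<Longrightarrow> le x y \<Longrightarrow> le y x \<Longrightarrow> x = y"
    and trans: "\<And>x y w. x mem S \<Longrightarrow> y mem S \<Longrightarrow> w mem S \<Longrightarrow> le x y \<Longrightarrow> le y w \<Longrightarrow> le x w"
    and max: "\<And>T z. sub T S \<Longrightarrow> z mem T \<Longrightarrow> \<exists>m. m mem T \<and> (\<forall>x. x mem T \<longrightarrow> le x m)"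
    and min: "\<And>T z. sub T S \<Longrightarrow> z mem T \<Longrightarrow> \<exists>m. m mem T \<and> (\<forall>x. x mem T \<longrightarrow> le m x)"
  shows "\<exists>n. n mem omega \<and> eqp S n"
proof -
  have le': "DF F \<Longrightarrow> DF G \<Longrightarrow> D (\<lambda>e. le (F e) (G e))" for F G by (rule D_comp2[of le, OF le])
  define dn where "dn x = Sep S (\<lambda>y. le y x)" for x
  have dn: "y mem dn x \<longleftrightarrow> y mem S \<and> le y x" for x y
    unfolding dn_def by (rule mem_Sep) (intro dfn le')
  have ddn: "DF (\<lambda>e. dn (e 0))" unfolding dn_def by (intro dfn le')
  define Fin where "Fin s \<longleftrightarrow> (\<exists>n. n mem omega \<and> eqp s n)" for s
  have Fin_insert: "Fin (cup s (upair x x))" if "Fin s" "\<not> x mem s" for s x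
    using that eqp_insert omega_suc unfolding Fin_def by blast
  have Fin_eset: "Fin eset" unfolding Fin_def using eqp_eset omega_0 by blast
  define Bad where "Bad = Sep S (\<lambda>x. \<not> Fin (dn x))"
  have Bad: "x mem Bad \<longleftrightarrow> x mem S \<and> \<not> Fin (dn x)" for x
    unfolding Bad_def by (rule mem_Sep) (unfold Fin_def, intro dfn DF_subst1[OF ddn])
  have fin: "Fin (dn x)" if "x mem S" for x
  proof (rule ccontr)
    assume "\<not> Fin (dn x)"
    then have "x mem Bad" using Bad that by blast
    moreover have "sub Bad S" unfolding sub_def Bad by blast
    ultimately obtain b where b: "b mem Bad" "\<And>x. x mem Bad \<Longrightarrow> le b x" using min by blast
    have bS: "b mem S" "\<not> Fin (dn b)" using b(1) Bad by blast+
    define L where "L = Sep S (\<lambda>y. le y b \<and> y \<noteq> b)"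
    have L: "y mem L \<longleftrightarrow> y mem S \<and> le y b \<and> y \<noteq> b" for y
      unfolding L_def by (rule mem_Sep) (intro dfn le')
    have refl: "le b b" using total[OF bS(1) bS(1)] by blast
    have dnb: "dn b = cup L (upair b b)"
      by (rule ext, unfold mem_cup mem_upair dn L) (use bS(1) refl in blast)
    have "Fin L"
    proof (cases "\<exists>y. y mem L")
      case False
      then have "L = eset" using eset_iff by blast
      then show ?thesis using Fin_eset by simp
    next
      case True
      moreover have "sub L S" unfolding sub_def L by blast
      ultimately obtain m where m: "m mem L" "\<And>x. x mem L \<Longrightarrow> le x m" using max by blast
      have mS: "m mem S" "le m b" "m \<noteq> b" using m(1) L by blast+
      have "y mem L" if y: "y mem S" "le y m" for y
      proof -
        have "le y b" using trans[OF y(1) mS(1) bS(1) y(2) mS(2)] .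
        moreover have "y \<noteq> b" using antisym[OF mS(1) bS(1) mS(2)] y(2) mS(3) by blast
        ultimately show ?thesis using L y(1) by blast
      qed
      then have "L = dn m" by (intro ext) (use m(2) L dn in blast)
      moreover have "\<not> m mem Bad" using b(2) antisym[OF mS(1) bS(1) mS(2)] mS(3) by blast
      ultimately show ?thesis using Bad mS(1) by simp
    qed
    moreover have "\<not> b mem L" using L by blast
    ultimately show False using Fin_insert bS(2) dnb by simp
  qed
  have "Fin S"
  proof (cases "\<exists>y. y mem S")
    case False
    then have "S = eset" using eset_iff by blast
    then show ?thesis using Fin_eset by simp
  next
    case True
    then obtain m where m: "m mem S" "\<And>x. x mem S \<Longrightarrow> le x m" using max[OF sub_refl] by blast
    then have "S = dn m" by (intro ext) (use dn in blast)
    then show ?thesis using fin[OF m(1)] by simp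
  qed
  then show ?thesis unfolding Fin_def .
qed

end

text \<open>A gap-free ordered group with halving.  Unlike that of ordered fields, this class is closed under
  reversing the order.\<close>

locale halving_group = zf E for E :: "'a \<Rightarrow> 'a \<Rightarrow> bool" (infix "mem" 50) +
  fixes a z u :: 'a and pl :: "'a \<Rightarrow> 'a \<Rightarrow> 'a" and ng hf :: "'a \<Rightarrow> 'a" and le :: "'a \<Rightarrow> 'a \<Rightarrow> bool"
  assumes D_le: "D (\<lambda>e. le (e 0) (e 1))"
    and DF_pl: "DF F \<Longrightarrow> DF G \<Longrightarrow> DF (\<lambda>e. pl (F e) (G e))"
    and DF_hf: "DF F \<Longrightarrow> DF (\<lambda>e. hf (F e))"
    and z: "z mem a" and pl: "x mem a \<Longrightarrow> y mem a \<Longrightarrow> pl x y mem a"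
    and ng: "x mem a \<Longrightarrow> ng x mem a" and hf: "x mem a \<Longrightarrow> hf x mem a"
    and assoc: "x mem a \<Longrightarrow> y mem a \<Longrightarrow> w mem a \<Longrightarrow> pl (pl x y) w = pl x (pl y w)"
    and comm: "x mem a \<Longrightarrow> y mem a \<Longrightarrow> pl x y = pl y x"
    and zero: "x mem a \<Longrightarrow> pl x z = x" and inverse: "x mem a \<Longrightarrow> pl x (ng x) = z"
    and halve: "x mem a \<Longrightarrow> pl (hf x) (hf x) = x"
    and total: "x mem a \<Longrightarrow> y mem a \<Longrightarrow> le x y \<or> le y x"
    and antisym: "le x y \<Longrightarrow> le y x \<Longrightarrow> x = y"
    and trans: "le x y \<Longrightarrow> le y w \<Longrightarrow> le x w"
    and mono: "x mem a \<Longrightarrow> y mem a \<Longrightarrow> w mem a \<Longrightarrow> le x y \<Longrightarrow> le (pl x w) (pl y w)"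
    and u: "u mem a" "u \<noteq> z" "le z u"
    and gap: "sub X a \<Longrightarrow> sub Y a \<Longrightarrow> x mem X \<Longrightarrow> y mem Y \<Longrightarrow>
      (\<And>x y. x mem X \<Longrightarrow> y mem Y \<Longrightarrow> le x y) \<Longrightarrow>
      \<exists>w. w mem a \<and> (\<forall>x. x mem X \<longrightarrow> le x w) \<and> (\<forall>y. y mem Y \<longrightarrow> le w y)"
begin

lemma le_comp: "DF F \<Longrightarrow> DF G \<Longrightarrow> D (\<lambda>e. le (F e) (G e))"
  by (rule D_comp2[of le, OF D_le])

lemma le_refl: "x mem a \<Longrightarrow> le x x"
  using total by blast

lemma cancel: "x mem a \<Longrightarrow> w mem a \<Longrightarrow> pl (pl x w) (ng w) = x"
  by (simp add: assoc ng inverse zero)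

lemma cancel': "x mem a \<Longrightarrow> w mem a \<Longrightarrow> pl (pl x (ng w)) w = x"
  by (simp add: assoc ng inverse zero comm[of "ng w" w])

lemma le_diff: assumes "x mem a" "w mem a" "y mem a" shows "le (pl x w) y \<longleftrightarrow> le x (pl y (ng w))"
proof
  assume "le (pl x w) y"
  then show "le x (pl y (ng w))" using mono[of "pl x w" y "ng w"] cancel[of x w] assms pl ng by simp
next
  assume "le x (pl y (ng w))"
  then show "le (pl x w) y" using mono[of x "pl y (ng w)" w] cancel'[of y w] assms pl ng by simp
qed

lemma le_cancel: "x mem a \<Longrightarrow> w mem a \<Longrightarrow> y mem a \<Longrightarrow> le (pl x w) (pl y w) \<longleftrightarrow> le x y"
  by (simp add: le_diff pl cancel)

lemma eq_cancel: "x mem a \<Longrightarrow> w mem a \<Longrightarrow> y mem a \<Longrightarrow> pl x w = pl y w \<Longrightarrow> x = y"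
  using cancel by metis

lemma double_mono:
  assumes "x mem a" "y mem a" "le x y" shows "le (pl x x) (pl y y)"
proof -
  have "le (pl x x) (pl y x)" using mono assms by blast
  moreover have "le (pl x y) (pl y y)" using mono assms by blast
  ultimately show ?thesis using trans comm[OF assms(1,2)] by metis
qed

lemma double_le:
  assumes "x mem a" "y mem a" "le (pl x x) (pl y y)" shows "le x y"
proof (rule ccontr)
  assume n: "\<not> le x y"
  then have yx: "le y x" using total assms by blast
  have 1: "le (pl y y) (pl x y)" using mono yx assms by blast
  have 2: "le (pl x y) (pl x x)" using mono[OF assms(2,1,1) yx] comm[OF assms(1,2)] by simp
  have "pl x y = pl y y" using antisym[OF 1] trans[OF 2 assms(3)] by simp
  then have "x = y" by (rule eq_cancel[OF assms(1,2,2)])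
  then show False using n le_refl assms(1) by simp
qed

text \<open>The supremum fills the gap between \<open>X\<close> and the set of its upper
  bounds.\<close>

lemma upper_bounds:
  assumes "sub X a" "x mem X" "q mem a" "\<And>x. x mem X \<Longrightarrow> le x q"
  shows "\<exists>w. w mem a \<and> (\<forall>x. x mem X \<longrightarrow> le x w) \<and> (\<forall>y. y mem a \<longrightarrow> (\<forall>x. x mem X \<longrightarrow> le x y) \<longrightarrow> le w y)"
proof -
  define Y where "Y = Sep a (\<lambda>y. \<forall>x. x mem X \<longrightarrow> le x y)"
  have Y: "y mem Y \<longleftrightarrow> y mem a \<and> (\<forall>x. x mem X \<longrightarrow> le x y)" for y
    unfolding Y_def by (rule mem_Sep) (intro dfn le_comp)
  have "\<exists>w. w mem a \<and> (\<forall>x. x mem X \<longrightarrow> le x w) \<and> (\<forall>y. y mem Y \<longrightarrow> le w y)"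
  proof (rule gap[OF assms(1) _ assms(2)])
    show "sub Y a" unfolding sub_def Y by blast
    show "q mem Y" unfolding Y using assms by blast
  qed (use Y in blast)
  then show ?thesis unfolding Y by blast
qed

lemma mem_range: "n mem Rep omega (app c) \<longleftrightarrow> (\<exists>i. i mem omega \<and> n = app c i)"
  by (rule mem_Rep) (intro dfn)

lemma sequence_sup:
  assumes c: "\<And>n. n mem omega \<Longrightarrow> app c n mem a" and q: "q mem a" "\<And>n. n mem omega \<Longrightarrow> le (app c n) q"
  obtains w where "w mem a" "\<And>n. n mem omega \<Longrightarrow> le (app c n) w"
    "\<And>y. y mem a \<Longrightarrow> (\<And>n. n mem omega \<Longrightarrow> le (app c n) y) \<Longrightarrow> le w y"
proof -
  have "\<exists>w. w mem a \<and> (\<forall>x. x mem Rep omega (app c) \<longrightarrow> le x w) \<and>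
      (\<forall>y. y mem a \<longrightarrow> (\<forall>x. x mem Rep omega (app c) \<longrightarrow> le x y) \<longrightarrow> le w y)"
    by (rule upper_bounds[of _ "app c eset" q])
      (use c q in \<open>auto simp: sub_def mem_range intro: exI[of _ eset]\<close>)
  then obtain w where "w mem a" "\<forall>x. x mem Rep omega (app c) \<longrightarrow> le x w"
    "\<forall>y. y mem a \<longrightarrow> (\<forall>x. x mem Rep omega (app c) \<longrightarrow> le x y) \<longrightarrow> le w y" by blast
  then show ?thesis by (intro that[of w]) (auto simp: mem_range)
qed

text \<open>If the progression were bounded with supremum \<open>w\<close>, then
  \<open>w - u\<close> would bound it as well.\<close>

lemma archimedean:
  assumes c: "\<And>n. n mem omega \<Longrightarrow> app c n mem a" "\<And>n. n mem omega \<Longrightarrow> app c (suc n) = pl (app c n) u"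
    and q: "q mem a"
  shows "\<exists>n. n mem omega \<and> \<not> le (app c n) q"
proof (rule ccontr)
  assume "\<not> ?thesis"
  then have "\<And>n. n mem omega \<Longrightarrow> le (app c n) q" by blast
  then obtain w where w: "w mem a" "\<And>n. n mem omega \<Longrightarrow> le (app c n) w"
    "\<And>y. y mem a \<Longrightarrow> (\<And>n. n mem omega \<Longrightarrow> le (app c n) y) \<Longrightarrow> le w y"
    using sequence_sup[OF c(1) q] by blast
  have "le (app c n) (pl w (ng u))" if "n mem omega" for n
    using w(2)[OF omega_suc[OF that]] c that u(1) w(1) by (simp add: le_diff)
  then have "le w (pl w (ng u))" using w(1,3) pl ng u(1) by blast
  then have "le (pl w u) w" using le_diff[OF w(1) u(1) w(1)] by blast
  then have "le (pl u w) (pl z w)" using comm w(1) u(1) z zero by metis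
  then have "le u z" using le_cancel u(1) z w(1) by blast
  then show False using u antisym by blast
qed

text \<open>Each step goes halfway to \<open>p\<close>. If all terms stayed below
  \<open>q < p\<close>, with supremum \<open>w\<close>, then the midpoint of any term and
  \<open>p\<close> would be at most \<open>w\<close>, so \<open>2w - p\<close> would bound the
  terms. This gives \<open>w \<le> 2w - p\<close>, that is \<open>p \<le> w \<le> q\<close>.\<close>

lemma bisection:
  assumes c: "\<And>n. n mem omega \<Longrightarrow> app c n mem a" "\<And>n. n mem omega \<Longrightarrow> app c (suc n) = hf (pl (app c n) p)"
    and p: "p mem a" and q: "q mem a" "le q p" "q \<noteq> p"
  shows "\<exists>n. n mem omega \<and> \<not> le (app c n) q"
proof (rule ccontr)
  assume "\<not> ?thesis"
  then have cq: "\<And>n. n mem omega \<Longrightarrow> le (app c n) q" by blast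
  then obtain w where w: "w mem a" "\<And>n. n mem omega \<Longrightarrow> le (app c n) w"
    "\<And>y. y mem a \<Longrightarrow> (\<And>n. n mem omega \<Longrightarrow> le (app c n) y) \<Longrightarrow> le w y"
    using sequence_sup[OF c(1) q(1)] by blast
  have ww: "pl w w mem a" using pl w(1) by blast
  have "le (app c n) (pl (pl w w) (ng p))" if n: "n mem omega" for n
  proof -
    have cp: "pl (app c n) p mem a" using c(1)[OF n] p pl by blast
    have "le (hf (pl (app c n) p)) w" using w(2)[OF omega_suc[OF n]] c(2)[OF n] by simp
    then have "le (pl (app c n) p) (pl w w)"
      using double_mono[OF hf[OF cp] w(1)] halve[OF cp] by simp
    then show ?thesis using le_diff[OF c(1)[OF n] p ww] by blast
  qed
  then have "le w (pl (pl w w) (ng p))" using w(3) pl ng ww p by blast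
  then have "le (pl w p) (pl w w)" using le_diff[OF w(1) p ww] by blast
  then have "le (pl p w) (pl w w)" using comm[OF w(1) p] by simp
  then have "le p w" using le_cancel[OF p w(1) w(1)] by blast
  moreover have "le w q" using w(3)[OF q(1) cq] .
  ultimately show False using trans antisym q by blast
qed

text \<open>For unbounded \<open>T\<close> the multiples of \<open>u\<close> serve, by
  \<open>archimedean\<close>. Otherwise the supremum \<open>p\<close> is not attained, and halving
  the distance to \<open>p\<close> again and again from \<open>t0\<close> gives terms strictly below
  \<open>p\<close> that pass every member of \<open>T\<close>.\<close>

lemma cofinal_sequence:
  assumes T: "sub T a" "t0 mem T" and no_max: "\<not> (\<exists>m. m mem T \<and> (\<forall>x. x mem T \<longrightarrow> le x m))"
  shows "\<exists>c. (\<forall>n. n mem omega \<longrightarrow> app c n mem a \<and> (\<exists>t. t mem T \<and> \<not> le t (app c n))) \<and>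
    (\<forall>t. t mem T \<longrightarrow> (\<exists>n. n mem omega \<and> le t (app c n)))"
proof (cases "\<exists>q. q mem a \<and> (\<forall>t. t mem T \<longrightarrow> le t q)")
  case False
  have "\<exists>c. fun_on c omega \<and> app c eset = z \<and>
      (\<forall>n. n mem omega \<longrightarrow> app c n mem a \<and> app c (suc n) = pl (app c n) u)"
    by (rule recursion[where m = "\<lambda>x. pl x u"]) (use pl u(1) z in \<open>auto intro: dfn DF_pl\<close>)
  then obtain c where c: "\<And>n. n mem omega \<Longrightarrow> app c n mem a"
    "\<And>n. n mem omega \<Longrightarrow> app c (suc n) = pl (app c n) u" by blast
  have "\<exists>n. n mem omega \<and> le t (app c n)" if t: "t mem T" for t
    using archimedean[OF c subD[OF T(1) t]] total[OF subD[OF T(1) t]] c(1) by blast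
  then show ?thesis using False c(1) by (intro exI[of _ c]) blast
next
  case True
  then obtain q where "q mem a" "\<And>t. t mem T \<Longrightarrow> le t q" by blast
  then obtain p where p: "p mem a" "\<And>t. t mem T \<Longrightarrow> le t p"
    "\<And>y. y mem a \<Longrightarrow> (\<And>t. t mem T \<Longrightarrow> le t y) \<Longrightarrow> le p y"
    using upper_bounds[OF T] by blast
  have Tp: "t \<noteq> p" if "t mem T" for t using no_max p(2) that by blast
  \<comment> \<open>The recursion runs inside the points strictly below \<open>p\<close>, so that
    its result records this invariant.\<close>
  define a' where "a' = Sep a (\<lambda>x. le x p \<and> x \<noteq> p)"
  have a': "x mem a' \<longleftrightarrow> x mem a \<and> le x p \<and> x \<noteq> p" for x
    unfolding a'_def by (rule mem_Sep) (intro dfn le_comp)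
  have "\<exists>c. fun_on c omega \<and> app c eset = t0 \<and>
      (\<forall>n. n mem omega \<longrightarrow> app c n mem a' \<and> app c (suc n) = hf (pl (app c n) p))"
  proof (rule recursion[where m = "\<lambda>x. hf (pl x p)"])
    show "DF (\<lambda>e. hf (pl (e 0) p))" by (intro dfn DF_hf DF_pl)
    show "t0 mem a'" unfolding a' using subD[OF T] p(2)[OF T(2)] Tp[OF T(2)] by blast
    fix x assume "x mem a'"
    then have x: "x mem a" "le x p" "x \<noteq> p" unfolding a' by blast+
    have xp: "pl x p mem a" using x(1) p(1) pl by blast
    have "le (pl x p) (pl p p)" using mono x(1,2) p(1) by blast
    then have "le (hf (pl x p)) p" using double_le[OF hf[OF xp] p(1)] halve[OF xp] by simp
    moreover have "hf (pl x p) \<noteq> p" using halve[OF xp] eq_cancel[OF x(1) p(1) p(1)] x(3) by auto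
    ultimately show "hf (pl x p) mem a'" unfolding a' using hf[OF xp] by blast
  qed
  then obtain c where c: "\<And>n. n mem omega \<Longrightarrow> app c n mem a'"
    "\<And>n. n mem omega \<Longrightarrow> app c (suc n) = hf (pl (app c n) p)" by blast
  have ca: "app c n mem a" if "n mem omega" for n using c(1)[OF that] unfolding a' by blast
  have 1: "\<exists>t. t mem T \<and> \<not> le t (app c n)" if n: "n mem omega" for n
    using p(3)[OF ca[OF n]] c(1)[OF n] antisym unfolding a' by blast
  have 2: "\<exists>n. n mem omega \<and> le t (app c n)" if t: "t mem T" for t
    using bisection[OF ca c(2) p(1) subD[OF T(1) t] p(2)[OF t] Tp[OF t]]
      total[OF subD[OF T(1) t]] ca by blast
  show ?thesis using 1 2 ca by (intro exI[of _ c]) blast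
qed

lemma max_exists:
  assumes CACCLO: "\<forall>A f. family A \<longrightarrow> orderings f A \<longrightarrow> (\<exists>g. choice g A omega)"
    and S: "sub S a" "\<not> (\<exists>s. sub s S \<and> s \<noteq> S \<and> eqp S s)" and T: "sub T S" "t0 mem T"
  shows "\<exists>m. m mem T \<and> (\<forall>x. x mem T \<longrightarrow> le x m)"
proof (rule ccontr)
  assume "\<not> ?thesis"
  moreover have Ta: "sub T a" using S(1) T(1) unfolding sub_def by blast
  ultimately obtain c where c: "\<And>n. n mem omega \<Longrightarrow> app c n mem a"
    "\<And>n. n mem omega \<Longrightarrow> \<exists>t. t mem T \<and> \<not> le t (app c n)" "\<And>t. t mem T \<Longrightarrow> \<exists>n. n mem omega \<and> le t (app c n)"
    using cofinal_sequence[OF _ T(2)] by blast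
  have cmax: "\<exists>m. m mem C \<and> (\<forall>x. x mem C \<longrightarrow> le x m)" if C: "countable C" "sub C T" "y mem C" for C y
  proof (rule countable_max[OF S(2) D_le _ _ C(1) _ C(3)])
    show "sub C S" using C(2) T(1) unfolding sub_def by blast
  qed (use total trans subD[OF S(1)] in blast)+
  define A where "A n = Sep T (\<lambda>t. \<not> le t (app c n))" for n
  have A: "t mem A n \<longleftrightarrow> t mem T \<and> \<not> le t (app c n)" for t n
    unfolding A_def by (rule mem_Sep) (intro dfn le_comp)
  have dA: "DF (\<lambda>e. A (e 0))" unfolding A_def by (intro dfn le_comp)
  have dA': "DF F \<Longrightarrow> DF (\<lambda>e. A (F e))" for F by (rule DF_subst1[OF dA])
  define r where "r n = Sep (cart (A n) (A n)) (\<lambda>p. \<exists>x y. p = pair x y \<and> le x y)" for n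
  have dr: "DF (\<lambda>e. r (e 0))" unfolding r_def by (intro dfn dA' le_comp)
  have r: "pair x y mem r n \<longleftrightarrow> x mem A n \<and> y mem A n \<and> le x y" for x y n
  proof -
    have "pair x y mem r n \<longleftrightarrow> pair x y mem cart (A n) (A n) \<and> (\<exists>x' y'. pair x y = pair x' y' \<and> le x' y')"
      unfolding r_def by (rule mem_Sep) (intro dfn le_comp)
    then show ?thesis by simp
  qed
  have rsub: "sub (r n) (cart (A n) (A n))" for n
    unfolding r_def by (rule sub_Sep) (intro dfn le_comp)
  have Aa: "x mem a" if "x mem A n" for x n using that A subD[OF Ta] by blast
  have scl: "sclo (r n) (A n)" for n
    unfolding sclo_def
  proof (intro conjI allI impI)
    show "linord (r n) (A n)"
      unfolding linord_def
    proof (intro conjI allI impI; (elim conjE)?)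
      fix p assume "p mem r n"
      then show "\<exists>x y. x mem A n \<and> y mem A n \<and> p = pair x y" using subD[OF rsub] mem_cart by blast
    next
      fix x assume "x mem A n"
      then show "pair x x mem r n" unfolding r using le_refl Aa by blast
    next
      fix x y assume "pair x y mem r n" "pair y x mem r n"
      then show "x = y" unfolding r using antisym by blast
    next
      fix x y w assume "pair x y mem r n" "pair y w mem r n"
      then show "pair x w mem r n" unfolding r using trans by blast
    next
      fix x y assume "x mem A n" "y mem A n"
      then show "pair x y mem r n \<or> pair y x mem r n" unfolding r using total Aa by blast
    qed
  next
    fix C assume C: "sub C (A n) \<and> (\<exists>z. z mem C) \<and> countable C"
    then have CA: "\<And>x. x mem C \<Longrightarrow> x mem A n" using subD by blast
    then have "sub C T" unfolding sub_def using A by blast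
    then obtain m where "m mem C" "\<And>x. x mem C \<Longrightarrow> le x m" using cmax C by blast
    then show "\<exists>m. m mem C \<and> (\<forall>x. x mem C \<longrightarrow> pair x m mem r n)" unfolding r using CA by blast
  qed
  have "family (lam omega A)"
    unfolding family_def using c(2) A by (simp add: fun_on_lam[OF dA] app_lam[OF dA])
  moreover have "orderings (lam omega r) (lam omega A)"
    unfolding orderings_def using scl by (simp add: fun_on_lam[OF dr] app_lam[OF dr] app_lam[OF dA])
  ultimately obtain g where "choice g (lam omega A) omega" using CACCLO by blast
  then have g: "app g n mem A n" if "n mem omega" for n
    using that app_lam[OF dA that] unfolding choice_def by auto
  have "\<exists>m. m mem Rep omega (app g) \<and> (\<forall>x. x mem Rep omega (app g) \<longrightarrow> le x m)"
  proof (rule cmax)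
    show "countable (Rep omega (app g))" by (rule countable_Rep[OF countable_omega]) (intro dfn)
    show "sub (Rep omega (app g)) T" unfolding sub_def mem_range using g A by blast
    show "app g eset mem Rep omega (app g)" unfolding mem_range using omega_0 by blast
  qed
  then obtain i where i: "i mem omega" "\<And>n. n mem omega \<Longrightarrow> le (app g n) (app g i)"
    unfolding mem_range by blast
  \<comment> \<open>The maximum \<open>app g i\<close> of the chosen values is at most some
    \<open>app c n\<close>; then so is \<open>app g n\<close>, which was chosen not to be.\<close>
  then obtain n where n: "n mem omega" "le (app g i) (app c n)" using c(3) g A by blast
  have "le (app g n) (app c n)" using trans[OF i(2)[OF n(1)] n(2)] .
  then show False using g[OF n(1)] A by blast
qed

text \<open>Negating \<open>u\<close> makes it positive for the reversed order. The gap property is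
  symmetric in \<open>X\<close> and \<open>Y\<close>, so completeness in this form survives the
  reversal directly.\<close>

lemma reverse: "halving_group E a z (ng u) pl ng hf (\<lambda>x y. le y x)"
proof unfold_locales
  show "D (\<lambda>e. le (e 1) (e 0))" by (intro le_comp dfn)
  show "ng u \<noteq> z" using inverse[OF u(1)] zero[OF u(1)] u(2) by auto
  show "le (ng u) z" using mono[OF z u(1) ng[OF u(1)] u(3)] inverse[OF u(1)] zero[OF ng[OF u(1)]]
      comm[OF z ng[OF u(1)]] by simp
  show "\<exists>w. w mem a \<and> (\<forall>x. x mem X \<longrightarrow> le w x) \<and> (\<forall>y. y mem Y \<longrightarrow> le y w)"
    if X: "sub X a" "sub Y a" "x mem X" "y mem Y" and le: "\<And>x y. x mem X \<Longrightarrow> y mem Y \<Longrightarrow> le y x" for X Y x y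
  proof -
    have "\<exists>w. w mem a \<and> (\<forall>x. x mem Y \<longrightarrow> le x w) \<and> (\<forall>y. y mem X \<longrightarrow> le w y)"
      by (rule gap[OF X(2,1,4,3)]) (rule le)
    then show ?thesis by blast
  qed
  show "le y x \<or> le x y" if "x mem a" "y mem a" for x y using total[OF that] by blast
  show "x = y" if "le y x" "le x y" for x y by (rule antisym[OF that(2,1)])
  show "le w x" if "le y x" "le w y" for x y w by (rule trans[OF that(2,1)])
  show "le (pl y w) (pl x w)" if "x mem a" "y mem a" "w mem a" "le y x" for x y w
    by (rule mono[OF that(2,1,3,4)])
  show "ng u mem a" by (rule ng[OF u(1)])
qed (rule DF_pl DF_hf z pl ng hf assoc comm zero inverse halve; assumption)+

lemma infinite_imp_dedekind_infinite:
  assumes CACCLO: "\<forall>A f. family A \<longrightarrow> orderings f A \<longrightarrow> (\<exists>g. choice g A omega)"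
    and S: "sub S a" "\<not> (\<exists>n. n mem omega \<and> eqp S n)"
  shows "\<exists>s. sub s S \<and> s \<noteq> S \<and> eqp S s"
proof (rule ccontr)
  assume D: "\<not> ?thesis"
  interpret rev: halving_group E a z "ng u" pl ng hf "\<lambda>x y. le y x" by (rule reverse)
  have "\<exists>n. n mem omega \<and> eqp S n"
  proof (rule finite_if_max_min[OF D_le])
    show "\<exists>m. m mem T \<and> (\<forall>x. x mem T \<longrightarrow> le x m)" if "sub T S" "t mem T" for T t
      using max_exists[OF CACCLO S(1) D that] by blast
    show "\<exists>m. m mem T \<and> (\<forall>x. x mem T \<longrightarrow> le m x)" if "sub T S" "t mem T" for T t
      using rev.max_exists[OF CACCLO S(1) D that] by blast
    show "le x y \<or> le y x" if "x mem S" "y mem S" for x y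
      by (rule total[OF subD[OF S(1) that(1)] subD[OF S(1) that(2)]])
    show "x = y" if "x mem S" "y mem S" "le x y" "le y x" for x y
      by (rule antisym[OF that(3,4)])
    show "le x w" if "x mem S" "y mem S" "w mem S" "le x y" "le y w" for x y w
      by (rule trans[OF that(4,5)])
  qed
  then show False using S(2) by blast
qed

end

section \<open>The real line as a halving group\<close>

context zf
begin

definition ap :: "'a \<Rightarrow> 'a \<Rightarrow> 'a \<Rightarrow> 'a \<Rightarrow> bool" where
  "ap f x y w \<longleftrightarrow> pair (pair x y) w mem f"

definition cmonoid :: "'a \<Rightarrow> 'a \<Rightarrow> 'a \<Rightarrow> bool" where
  "cmonoid a f e \<longleftrightarrow> (fun_on f (cart a a) \<and> (\<forall>x y. pair x y mem f \<longrightarrow> y mem a)) \<and>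
    (\<forall>x y z u v s. ap f x y u \<and> ap f u z s \<and> ap f y z v \<longrightarrow> ap f x v s) \<and>
    (\<forall>x y u. ap f x y u \<longrightarrow> ap f y x u) \<and> e mem a \<and> (\<forall>x. x mem a \<longrightarrow> ap f x e x)"

definition ofield :: "'a \<Rightarrow> 'a \<Rightarrow> 'a \<Rightarrow> 'a \<Rightarrow> 'a \<Rightarrow> 'a \<Rightarrow> bool" where
  "ofield a add mul zero one le \<longleftrightarrow> cmonoid a add zero \<and>
    (\<forall>x. x mem a \<longrightarrow> (\<exists>y. ap add x y zero)) \<and> cmonoid a mul one \<and>
    (\<forall>x. x mem a \<and> x \<noteq> zero \<longrightarrow> (\<exists>y. ap mul x y one)) \<and> zero \<noteq> one \<and>
    (\<forall>x y z s t u v. ap add y z s \<and> ap mul x s t \<and> ap mul x y u \<and> ap mul x z v \<longrightarrow> ap add u v t) \<and>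
    linord le a \<and>
    (\<forall>x y z u v. pair x y mem le \<and> ap add x z u \<and> ap add y z v \<longrightarrow> pair u v mem le) \<and>
    (\<forall>x y u. pair zero x mem le \<and> pair zero y mem le \<and> ap mul x y u \<longrightarrow> pair zero u mem le)"

definition real_line :: "'a \<Rightarrow> bool" where
  "real_line a \<longleftrightarrow> (\<exists>add mul zero one le. ofield a add mul zero one le \<and>
    (\<forall>s. sub s a \<and> (\<exists>z. z mem s) \<and> (\<exists>u. u mem a \<and> (\<forall>x. x mem s \<longrightarrow> pair x u mem le)) \<longrightarrow>
      (\<exists>u. (u mem a \<and> (\<forall>x. x mem s \<longrightarrow> pair x u mem le)) \<and>
        (\<forall>v. v mem a \<and> (\<forall>x. x mem s \<longrightarrow> pair x v mem le) \<longrightarrow> pair u v mem le))))"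

lemma lsat_app2:
  "f < d \<Longrightarrow> x < d \<Longrightarrow> y < d \<Longrightarrow> w < d \<Longrightarrow> lsat d l (app2 f x y w) \<longleftrightarrow> ap (l f) (l x) (l y) (l w)"
  by (simp add: app2_def lsat_simps lsat_pair lsat_pair_mem ap_def)

lemma lsat_commutative_monoid:
  "a < d \<Longrightarrow> f < d \<Longrightarrow> e < d \<Longrightarrow> lsat d l (commutative_monoid a f e) \<longleftrightarrow> cmonoid (l a) (l f) (l e)"
  by (simp add: commutative_monoid_def function_into_def lsat_simps lsat_cart lsat_function_on
      lsat_pair_mem lsat_app2 cmonoid_def)

lemma lsat_ordered_field:
  "a < d \<Longrightarrow> add < d \<Longrightarrow> mul < d \<Longrightarrow> zero < d \<Longrightarrow> one < d \<Longrightarrow> le < d \<Longrightarrow>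
    lsat d l (ordered_field a add mul zero one le) \<longleftrightarrow>
    ofield (l a) (l add) (l mul) (l zero) (l one) (l le)"
  by (simp add: ordered_field_def lsat_simps lsat_commutative_monoid lsat_app2 lsat_linear_ordering
      lsat_pair_mem ofield_def)

lemma lsat_real_line: "a < d \<Longrightarrow> lsat d l (is_real_line a) \<longleftrightarrow> real_line (l a)"
  by (simp add: is_real_line_def upper_bound_def lsat_simps lsat_basic lsat_ordered_field
      lsat_pair_mem real_line_def)

lemma lsat_IDI_R: "lsat 0 l IDI_R \<longleftrightarrow> (\<forall>a. real_line a \<longrightarrow>
  (\<forall>s. sub s a \<and> \<not> (\<exists>n. n mem omega \<and> eqp s n) \<longrightarrow> (\<exists>s'. sub s' s \<and> s' \<noteq> s \<and> eqp s s')))"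
  by (simp add: IDI_R_def lsat_simps lsat_real_line lsat_basic lsat_infinite lsat_dedekind_infinite)

text \<open>Passing from the relation \<open>ap\<close> to the function
  \<open>app f (pair x y)\<close> turns the axioms into equations.\<close>

lemma cmonoidD:
  assumes "cmonoid a f e"
  shows cmonoid_ap: "ap f x y w \<longleftrightarrow> x mem a \<and> y mem a \<and> w = app f (pair x y)"
    and cmonoid_closed: "x mem a \<Longrightarrow> y mem a \<Longrightarrow> app f (pair x y) mem a"
    and cmonoid_assoc: "x mem a \<Longrightarrow> y mem a \<Longrightarrow> w mem a \<Longrightarrow>
      app f (pair (app f (pair x y)) w) = app f (pair x (app f (pair y w)))"
    and cmonoid_comm: "x mem a \<Longrightarrow> y mem a \<Longrightarrow> app f (pair x y) = app f (pair y x)"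
    and cmonoid_unit: "e mem a" "x mem a \<Longrightarrow> app f (pair x e) = x"
proof -
  note 1 = assms[unfolded cmonoid_def]
  have f: "fun_on f (cart a a)" using 1 by blast
  have ap: "ap f x y w \<longleftrightarrow> x mem a \<and> y mem a \<and> w = app f (pair x y)" for x y w
    unfolding ap_def pair_mem_fun[OF f] by simp
  then show "ap f x y w \<longleftrightarrow> x mem a \<and> y mem a \<and> w = app f (pair x y)" .
  have closed: "app f (pair x y) mem a" if "x mem a" "y mem a" for x y
    using 1[THEN conjunct1, THEN conjunct2, rule_format, of "pair x y"] pair_mem_fun[OF f, of "pair x y"] that
    by simp
  then show "x mem a \<Longrightarrow> y mem a \<Longrightarrow> app f (pair x y) mem a" .
  note 2 = 1[THEN conjunct2, unfolded ap]
  show "app f (pair (app f (pair x y)) w) = app f (pair x (app f (pair y w)))"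
    if x: "x mem a" "y mem a" "w mem a"
    using 2[THEN conjunct1, rule_format, of x y "app f (pair x y)" w "app f (pair (app f (pair x y)) w)"
        "app f (pair y w)"] x closed[OF x(1,2)] closed[OF x(2,3)] by blast
  note 3 = 2[THEN conjunct2]
  show "x mem a \<Longrightarrow> y mem a \<Longrightarrow> app f (pair x y) = app f (pair y x)"
    using 3[THEN conjunct1, rule_format, of x y "app f (pair x y)"] by blast
  note 4 = 3[THEN conjunct2]
  show "e mem a" using 4 by blast
  show "x mem a \<Longrightarrow> app f (pair x e) = x" using 4[THEN conjunct2, rule_format, of x] by simp
qed

lemma real_line_halving_group:
  assumes "real_line a"
  shows "\<exists>z u pl ng hf le. halving_group E a z u pl ng hf le"
proof -
  obtain add mul zero one le where field: "ofield a add mul zero one le"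
    and complete: "\<And>s. sub s a \<Longrightarrow> \<exists>z. z mem s \<Longrightarrow> \<exists>u. u mem a \<and> (\<forall>x. x mem s \<longrightarrow> pair x u mem le) \<Longrightarrow>
      \<exists>u. (u mem a \<and> (\<forall>x. x mem s \<longrightarrow> pair x u mem le)) \<and>
        (\<forall>v. v mem a \<and> (\<forall>x. x mem s \<longrightarrow> pair x v mem le) \<longrightarrow> pair u v mem le)"
    using assms unfolding real_line_def by blast
  have M: "cmonoid a add zero" "cmonoid a mul one" and lin: "linord le a" and "zero \<noteq> one"
    and inv_add: "\<And>x. x mem a \<Longrightarrow> \<exists>y. ap add x y zero"
    and inv_mul: "\<And>x. x mem a \<Longrightarrow> x \<noteq> zero \<Longrightarrow> \<exists>y. ap mul x y one"
    and dist: "\<And>x y z s t u v. ap add y z s \<Longrightarrow> ap mul x s t \<Longrightarrow> ap mul x y u \<Longrightarrow> ap mul x z v \<Longrightarrow> ap add u v t"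
    and mono: "\<And>x y z u v. pair x y mem le \<Longrightarrow> ap add x z u \<Longrightarrow> ap add y z v \<Longrightarrow> pair u v mem le"
    using field[unfolded ofield_def] by blast+
  define pl where "pl x y = app add (pair x y)" for x y
  define ml where "ml x y = app mul (pair x y)" for x y
  note ap = cmonoid_ap[OF M(1), folded pl_def] cmonoid_ap[OF M(2), folded ml_def]
  note closed = cmonoid_closed[OF M(1), folded pl_def] cmonoid_closed[OF M(2), folded ml_def]
  note unit = cmonoid_unit[OF M(1), folded pl_def] cmonoid_unit[OF M(2), folded ml_def]
  note plc = cmonoid_comm[OF M(1), folded pl_def] and mlc = cmonoid_comm[OF M(2), folded ml_def]
  \<comment> \<open>A choice made in HOL is harmless here: negatives enter only as single elements,
    and definability is demanded of \<open>pl\<close>, \<open>hf\<close> and \<open>le\<close>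
    alone.\<close>
  define ng where "ng x = (SOME y. ap add x y zero)" for x
  have ng: "ng x mem a" "pl x (ng x) = zero" if "x mem a" for x
    using someI_ex[OF inv_add[OF that], folded ng_def] unfolding ap by auto
  have distrib: "ml x (pl y w) = pl (ml x y) (ml x w)" if "x mem a" "y mem a" "w mem a" for x y w
    using dist[of y w "pl y w" x "ml x (pl y w)" "ml x y" "ml x w"] that unfolding ap
    by (simp add: closed)
  have le_mono: "pair (pl x w) (pl y w) mem le" if "x mem a" "y mem a" "w mem a" "pair x y mem le" for x y w
    using mono[OF that(4), of w "pl x w" "pl y w"] that unfolding ap by simp
  \<comment> \<open>Otherwise adding \<open>one\<close> to both sides of a comparison of
    \<open>zero\<close> and \<open>one\<close> would yield the reverse comparison.\<close>
  have two: "pl one one \<noteq> zero"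
  proof
    assume 0: "pl one one = zero"
    from linord_total[OF lin unit(1) unit(3)] show False
    proof
      assume 1: "pair zero one mem le"
      then have "pair (pl zero one) (pl one one) mem le" using le_mono unit by blast
      then have "pair one zero mem le" using 0 plc[OF unit(1) unit(3)] unit(2)[OF unit(3)] by simp
      then show False using linord_antisym[OF lin 1] \<open>zero \<noteq> one\<close> by blast
    next
      assume 1: "pair one zero mem le"
      then have "pair (pl one one) (pl zero one) mem le" using le_mono unit by blast
      then have "pair zero one mem le" using 0 plc[OF unit(1) unit(3)] unit(2)[OF unit(3)] by simp
      then show False using linord_antisym[OF lin 1] \<open>zero \<noteq> one\<close> by blast
    qed
  qed
  \<comment> \<open>One half; halving is multiplication by \<open>h\<close> and hence
    definable.\<close>
  obtain h where h: "h mem a" "ml (pl one one) h = one"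
    using inv_mul[OF closed(1)[OF unit(3) unit(3)] two] unfolding ap by auto
  have hh: "pl h h = one"
  proof -
    have "pl h h = pl (ml h one) (ml h one)" using unit(4)[OF h(1)] by simp
    also have "\<dots> = ml h (pl one one)" by (rule distrib[OF h(1) unit(3) unit(3), symmetric])
    also have "\<dots> = one" using mlc[OF h(1) closed(1)[OF unit(3) unit(3)]] h(2) by simp
    finally show ?thesis .
  qed
  have halve: "pl (ml x h) (ml x h) = x" if "x mem a" for x
    using distrib[OF that h(1) h(1)] hh unit(4)[OF that] by simp
  \<comment> \<open>Whichever of \<open>one\<close> and its negative is positive, which spares a
    proof that \<open>one\<close> is.\<close>
  define u where "u = (if pair zero one mem le then one else ng one)"
  have u: "u mem a" "u \<noteq> zero" "pair zero u mem le"
  proof -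
    show "u mem a" unfolding u_def using unit(3) ng(1) by simp
    have "ng one \<noteq> zero" using ng(2)[OF unit(3)] unit(2)[OF unit(3)] \<open>zero \<noteq> one\<close> by auto
    then show "u \<noteq> zero" unfolding u_def using \<open>zero \<noteq> one\<close> by auto
    have "pair zero (ng one) mem le" if "pair one zero mem le"
      using le_mono[OF unit(3) unit(1) ng(1)[OF unit(3)] that] ng[OF unit(3)]
        plc[OF unit(1) ng(1)[OF unit(3)]] unit(2)[OF ng(1)[OF unit(3)]] by simp
    then show "pair zero u mem le" unfolding u_def using linord_total[OF lin unit(1) unit(3)] by auto
  qed
  have "halving_group E a zero u pl ng (\<lambda>x. ml x h) (\<lambda>x y. pair x y mem le)"
  proof unfold_locales
    show "D (\<lambda>e. pair (e 0) (e 1) mem le)" by (intro dfn)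
    show "DF (\<lambda>e. pl (F e) (G e))" if "DF F" "DF G" for F G unfolding pl_def by (intro dfn that)
    show "DF (\<lambda>e. ml (F e) h)" if "DF F" for F unfolding ml_def by (intro dfn that)
    show "ml x h mem a" if "x mem a" for x by (rule closed(2)[OF that h(1)])
    show "pl (pl x y) w = pl x (pl y w)" if "x mem a" "y mem a" "w mem a" for x y w
      using cmonoid_assoc[OF M(1) that] unfolding pl_def .
    show "pair x y mem le \<or> pair y x mem le" if "x mem a" "y mem a" for x y by (rule linord_total[OF lin that])
    show "x = y" if "pair x y mem le" "pair y x mem le" for x y by (rule linord_antisym[OF lin that])
    show "pair x w mem le" if "pair x y mem le" "pair y w mem le" for x y w
      by (rule linord_trans[OF lin that])
    show "\<exists>w. w mem a \<and> (\<forall>x. x mem X \<longrightarrow> pair x w mem le) \<and> (\<forall>y. y mem Y \<longrightarrow> pair w y mem le)"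
      if X: "sub X a" "sub Y a" "x mem X" "y mem Y" and le: "\<And>x y. x mem X \<Longrightarrow> y mem Y \<Longrightarrow> pair x y mem le"
      for X Y x y
    proof -
      have "\<exists>u. u mem a \<and> (\<forall>x. x mem X \<longrightarrow> pair x u mem le)" using subD[OF X(2,4)] le X(4) by blast
      then obtain w where w: "w mem a" "\<forall>x. x mem X \<longrightarrow> pair x w mem le"
        "\<And>v. v mem a \<and> (\<forall>x. x mem X \<longrightarrow> pair x v mem le) \<Longrightarrow> pair w v mem le"
        using complete[OF X(1)] X(3) by blast
      have "pair w y mem le" if "y mem Y" for y using w(3) subD[OF X(2) that] le that by blast
      then show ?thesis using w(1,2) by blast
    qed
  qed (rule closed unit plc ng halve le_mono u; assumption)+
  then show ?thesis by blast
qed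

lemma real_line_infinite_imp_dedekind_infinite:
  assumes "\<forall>A f. family A \<longrightarrow> orderings f A \<longrightarrow> (\<exists>g. choice g A omega)"
    and "real_line a" "sub s a" "\<not> (\<exists>n. n mem omega \<and> eqp s n)"
  shows "\<exists>s'. sub s' s \<and> s' \<noteq> s \<and> eqp s s'"
proof -
  obtain z u pl ng hf le where "halving_group E a z u pl ng hf le"
    using real_line_halving_group[OF assms(2)] by blast
  then show ?thesis by (rule halving_group.infinite_imp_dedekind_infinite[OF _ assms(1,3,4)])
qed

lemma implications_in_model:
  "lsat 0 l (CMC \<^bold>\<longrightarrow> ABP)" "lsat 0 l (ABP \<^bold>\<longrightarrow> PPP)" "lsat 0 l (CACCLO \<^bold>\<longleftrightarrow> PCACCLO)"
  "lsat 0 l (AB0P \<^bold>\<longrightarrow> CACCLO)" "lsat 0 l (CACCLO \<^bold>\<longrightarrow> IDI_R)"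
proof -
  show "lsat 0 l (CMC \<^bold>\<longrightarrow> ABP)"
    unfolding lsat_simps lsat_CMC lsat_ABP using CMC_imp_ABP by blast
  show "lsat 0 l (ABP \<^bold>\<longrightarrow> PPP)"
    unfolding lsat_simps lsat_ABP lsat_PPP by (intro allI impI ABP_imp_PPP) blast+
  have P: "lsat 0 l PCACCLO \<Longrightarrow> lsat 0 l CACCLO"
    unfolding lsat_CACCLO lsat_PCACCLO by (intro allI impI PCACCLO_imp_CACCLO) blast+
  moreover have "lsat 0 l CACCLO \<Longrightarrow> lsat 0 l PCACCLO"
    unfolding lsat_CACCLO lsat_PCACCLO using CACCLO_imp_PCACCLO by blast
  ultimately show "lsat 0 l (CACCLO \<^bold>\<longleftrightarrow> PCACCLO)" unfolding lsat_simps by blast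
  \<comment> \<open>The topological argument yields only a partial choice function, hence the
    passage through \<open>PCACCLO\<close>.\<close>
  have "lsat 0 l PCACCLO" if "lsat 0 l AB0P"
    unfolding lsat_PCACCLO
  proof (intro allI impI)
    fix A f assume A: "family A" "orderings f A"
    show "\<exists>I g. sub I omega \<and> \<not> (\<exists>n. n mem omega \<and> eqp I n) \<and> choice g A I"
    proof (rule AB0P_imp_PCACCLO[OF _ A])
      fix x t b b'
      assume "topology t x" "\<And>u. u mem b \<longleftrightarrow> u mem t \<and> dif x u mem t" "base b t"
        "\<And>y z. y mem x \<Longrightarrow> z mem x \<Longrightarrow> y \<noteq> z \<Longrightarrow> \<exists>u. u mem t \<and> y mem u \<and> \<not> z mem u"
        "base b' t" "stable b'"
      then show "pspace x t" using that[unfolded lsat_AB0P, rule_format, of t x] by blast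
    qed
  qed
  then show "lsat 0 l (AB0P \<^bold>\<longrightarrow> CACCLO)" unfolding lsat_simps using P by blast
  show "lsat 0 l (CACCLO \<^bold>\<longrightarrow> IDI_R)"
    unfolding lsat_simps lsat_CACCLO lsat_IDI_R
    using real_line_infinite_imp_dedekind_infinite by blast
qed

end

lemma ZF_proves_if_lsat:
  assumes "clo 0 \<phi>" "\<And>E :: nat \<Rightarrow> nat \<Rightarrow> bool. zf E \<Longrightarrow> qsat E (=) 0 undefined \<phi>"
  shows "ZF_proves \<phi>"
  using assms(1)
proof (rule ZF_provesI)
  fix E :: "nat \<Rightarrow> nat \<Rightarrow> bool"
  assume "\<And>q e. q \<in> ZF \<Longrightarrow> sat E (=) e q"
  then have "zf E" by unfold_locales
  then show "sat E (=) (env 0 undefined) (\<phi> 0)" using assms(2) unfolding qsat_def by blast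
qed

theorem theorem5p9:
  shows "ZF_proves (CMC \<^bold>\<longrightarrow> ABP) \<and> ZF_proves (ABP \<^bold>\<longrightarrow> PPP) \<and>
    ZF_proves (CACCLO \<^bold>\<longleftrightarrow> PCACCLO) \<and>
    ZF_proves (AB0P \<^bold>\<longrightarrow> CACCLO) \<and> ZF_proves (CACCLO \<^bold>\<longrightarrow> IDI_R)"
proof -
  have "clo 0 CMC" "clo 0 ABP" "clo 0 PPP" "clo 0 CACCLO" "clo 0 PCACCLO" "clo 0 AB0P" "clo 0 IDI_R"
    by (simp_all add: vocabulary_defs clo_simps)
  then show ?thesis
    by (intro conjI ZF_proves_if_lsat zf.implications_in_model) (simp_all add: clo_simps)
qed

end
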